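(* For each $k\in\mathbb{Z}\setminus\{0\}$, there exist parameters $c>1$ and $p,q,r\ge0$ with $p+q+r=1$, $p+r>0$, $q+r>0$ such that $\mu^{(k)\,\mathrm{sym}}\in ID$ and $\rho^{(k)\,\mathrm{sym}}\in ID^0$.
   Context: For $k\in\mathbb{Z}$ and parameters $c,p,q,r$ as in the claim, let $\{(N_t^{(k)},L_t^{(k)}),t\ge0\}$ be the bivariate compound Poisson process (pure jump, no drift) with $E[e^{i(z_1N_t^{(k)}+z_2L_t^{(k)})}]=\exp[t\int_{\mathbb{R}^2}(e^{i(z_1x_1+z_2x_2)}-1)\nu^{(k)}(dx)]$, where $\nu^{(k)}$ is concentrated on the points $(1,0)$, $(0,1)$, $(1,c^{-k})$ with masses $u,v,w\ge0$ respectively, and $p=u/(u+v+w)$, $q=v/(u+v+w)$, $r=w/(u+v+w)$. Let $T$ be the first jump time of $\{N_t^{(k)}\}$. Define $\rho^{(k)}$ as the distribution of $L_T^{(k)}$, and $\mu^{(k)}$ as the distribution of $\int_0^{\infty-}c^{-N^{(k)}_{s-}}\,dL_s^{(k)}$ (the almost sure limit of $\int_0^t$ as $t\to\infty$, which exists). These depend on $u,v,w$ only through $p,q,r$. The symmetrization $\sigma^{\mathrm{sym}}$ of a distribution $\sigma$ is the distribution with characteristic function $|\widehat\sigma(z)|^2$; $\rho^{(k)\,\mathrm{sym}},\mu^{(k)\,\mathrm{sym}}$ are the symmetrizations of $\rho^{(k)},\mu^{(k)}$. A distribution $\sigma$ on $\mathbb{R}$ is quasi-infinitely divisible if its characteristic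 function is $\widehat\sigma(z)=\exp[i\gamma z-az^2+\int_{\mathbb{R}}(e^{izx}-1-izx1_{[-1,1]}(x))\,\nu_\sigma(dx)]$, where $\gamma,a\in\mathbb{R}$ and $\nu_\sigma$ is a signed measure (a difference $\nu_\sigma^+-\nu_\sigma^-$ of mutually singular measures, possibly both of infinite mass near $0$) with total variation measure $|\nu_\sigma|$ satisfying $\nu_\sigma(\{0\})=0$ and $\int(x^2\wedge1)\,|\nu_\sigma|(dx)<\infty$. $ID$ is the class of infinitely divisible distributions on $\mathbb{R}$; $ID^0$ is the class of quasi-infinitely divisible distributions that are not infinitely divisible. *)

theory Defs
  imports "HOL-Probability.Probability"
begin

section \<open>Infinitely divisible and quasi-infinitely divisible distributions\<close>

primrec conv_power :: "real measure \<Rightarrow> nat \<Rightarrow> real measure" where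
  "conv_power \<tau> 0 = return borel 0"
| "conv_power \<tau> (Suc n) = (\<tau> \<star> conv_power \<tau> n)"

definition infinitely_divisible :: "real measure \<Rightarrow> bool" where
  "infinitely_divisible \<sigma> \<longleftrightarrow> real_distribution \<sigma> \<and>
     (\<forall>n\<ge>1. \<exists>\<tau>. real_distribution \<tau> \<and> \<sigma> = conv_power \<tau> n)"

definition mutually_singular :: "real measure \<Rightarrow> real measure \<Rightarrow> bool" where
  "mutually_singular \<nu>1 \<nu>2 \<longleftrightarrow>
     (\<exists>A\<in>sets borel. emeasure \<nu>1 A = 0 \<and> emeasure \<nu>2 (- A) = 0)"

definition pre_levy_measure :: "real measure \<Rightarrow> bool" where
  "pre_levy_measure \<nu> \<longleftrightarrow> sets \<nu> = sets borel \<and> emeasure \<nu> {0} = 0 \<and>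
     (\<integral>\<^sup>+ x. ennreal (min (x\<^sup>2) 1) \<partial>\<nu>) < \<infinity>"

definition levy_integrand :: "real \<Rightarrow> real \<Rightarrow> complex" where
  "levy_integrand z x = iexp (z * x) - 1 - \<i> * of_real (z * x * indicator {-1..1} x)"

text \<open>The signed measure is given by its Jordan parts \<open>\<nu>p\<close> and \<open>\<nu>n\<close>, since both of them may
  have infinite mass near \<open>0\<close>. Its total variation is \<open>\<nu>p + \<nu>n\<close>, so the conditions on the
  total variation amount to the same conditions on both parts.\<close>

definition quasi_infinitely_divisible :: "real measure \<Rightarrow> bool" where
  "quasi_infinitely_divisible \<sigma> \<longleftrightarrow> real_distribution \<sigma> \<and>
     (\<exists>(\<gamma>::real) (a::real) \<nu>p \<nu>n.
        pre_levy_measure \<nu>p \<and> pre_levy_measure \<nu>n \<and> mutually_singular \<nu>p \<nu>n \<and>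
        (\<forall>z. char \<sigma> z = exp (\<i> * of_real (\<gamma> * z) - of_real (a * z\<^sup>2) +
               ((CLINT x|\<nu>p. levy_integrand z x) - (CLINT x|\<nu>n. levy_integrand z x)))))"

definition ID :: "real measure set" where
  "ID = {\<sigma>. infinitely_divisible \<sigma>}"

definition ID0 :: "real measure set" where
  "ID0 = {\<sigma>. quasi_infinitely_divisible \<sigma>} - ID"

definition symmetrization :: "real measure \<Rightarrow> real measure" where
  "symmetrization \<sigma> =
     (THE \<tau>. real_distribution \<tau> \<and> (\<forall>z. char \<tau> z = of_real ((cmod (char \<sigma> z))\<^sup>2)))"

section \<open>Levy processes with pure jump paths\<close>

definition left_lim :: "(real \<Rightarrow> 'b::t2_space) \<Rightarrow> real \<Rightarrow> 'b" where
  "left_lim f s = Lim (at_left s) f"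

definition jump :: "(real \<Rightarrow> 'b::real_normed_vector) \<Rightarrow> real \<Rightarrow> 'b" where
  "jump f s = f s - left_lim f s"

definition jump_times :: "(real \<Rightarrow> 'b::real_normed_vector) \<Rightarrow> real set" where
  "jump_times f = {s. 0 < s \<and> jump f s \<noteq> 0}"

definition cadlag :: "(real \<Rightarrow> 'b::real_normed_vector) \<Rightarrow> bool" where
  "cadlag f \<longleftrightarrow> (\<forall>t\<ge>0. continuous (at_right t) f) \<and> (\<forall>t>0. \<exists>l. (f \<longlongrightarrow> l) (at_left t))"

definition pure_jump :: "(real \<Rightarrow> 'b::real_normed_vector) \<Rightarrow> bool" where
  "pure_jump f \<longleftrightarrow> cadlag f \<and>
     (\<forall>t\<ge>0. finite (jump_times f \<inter> {..t}) \<and> f t = (\<Sum>s\<in>jump_times f \<inter> {..t}. jump f s))"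

text \<open>Processes are functions of a real time parameter of which only the values at times
  \<open>t \<ge> 0\<close> are relevant. Path properties are required for every (not only almost every) sample
  point, so that functionals of the paths are measurable without completing the space.\<close>

definition levy_process ::
  "'a measure \<Rightarrow> (real \<Rightarrow> 'a \<Rightarrow> 'b::euclidean_space) \<Rightarrow> bool" where
  "levy_process M Z \<longleftrightarrow> prob_space M \<and>
     (\<forall>t\<ge>0. Z t \<in> borel_measurable M) \<and>
     (\<forall>\<omega>\<in>space M. Z 0 \<omega> = 0 \<and> cadlag (\<lambda>t. Z t \<omega>)) \<and>
     (\<forall>(n::nat) t. 0 \<le> t 0 \<longrightarrow> mono t \<longrightarrow>
        prob_space.indep_vars M (\<lambda>_. borel) (\<lambda>(i::nat) \<omega>. Z (t (Suc i)) \<omega> - Z (t i) \<omega>) {..<n}) \<and>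
     (\<forall>s\<ge>0. \<forall>h\<ge>0. distr M borel (\<lambda>\<omega>. Z (s + h) \<omega> - Z s \<omega>) = distr M borel (Z h))"

section \<open>The bivariate compound Poisson process and the two associated distributions\<close>

definition biv_levy_measure ::
  "int \<Rightarrow> real \<Rightarrow> real \<Rightarrow> real \<Rightarrow> real \<Rightarrow> (real \<times> real) measure" where
  "biv_levy_measure k c u v w =
     distr (point_measure {(1, 0), (0, 1), (1, c powi (- k))}
             (\<lambda>x. ennreal (if x = (1, 0) then u else if x = (0, 1) then v else w)))
           borel (\<lambda>x. x)"

definition biv_compound_poisson ::
  "int \<Rightarrow> real \<Rightarrow> real \<Rightarrow> real \<Rightarrow> real \<Rightarrow> 'a measure \<Rightarrow> (real \<Rightarrow> 'a \<Rightarrow> real) \<Rightarrow> (real \<Rightarrow> 'a \<Rightarrow> real) \<Rightarrow> bool"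
  where
  "biv_compound_poisson k c u v w M N L \<longleftrightarrow>
     levy_process M (\<lambda>t \<omega>. (N t \<omega>, L t \<omega>)) \<and>
     (\<forall>\<omega>\<in>space M. pure_jump (\<lambda>t. (N t \<omega>, L t \<omega>))) \<and>
     (\<forall>t\<ge>0. \<forall>z1 z2.
        (CLINT \<omega>|M. iexp (z1 * N t \<omega> + z2 * L t \<omega>)) =
        exp (of_real t *
          (CLINT x|biv_levy_measure k c u v w. iexp (z1 * fst x + z2 * snd x) - 1)))"

text \<open>If \<open>N\<close> never jumps, which has probability \<open>0\<close> when \<open>u + w > 0\<close>, the value is set to \<open>0\<close>, since
  \<open>Inf {}\<close> is unspecified on the reals and the process is arbitrary at negative times.\<close>

definition first_jump_time :: "(real \<Rightarrow> 'a \<Rightarrow> real) \<Rightarrow> 'a \<Rightarrow> real" where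
  "first_jump_time N \<omega> =
     (if jump_times (\<lambda>t. N t \<omega>) = {} then 0 else Inf (jump_times (\<lambda>t. N t \<omega>)))"

text \<open>The pathwise integral of \<open>c\<close> to the power \<open>- N (s-)\<close> against \<open>dL s\<close> over \<open>(0, t]\<close>. As \<open>L\<close> is
  a pure jump path with finitely many jumps up to \<open>t\<close>, it is a finite sum over these jumps.\<close>

definition exp_integral ::
  "real \<Rightarrow> (real \<Rightarrow> 'a \<Rightarrow> real) \<Rightarrow> (real \<Rightarrow> 'a \<Rightarrow> real) \<Rightarrow> real \<Rightarrow> 'a \<Rightarrow> real" where
  "exp_integral c N L t \<omega> =
     (\<Sum>s\<in>jump_times (\<lambda>t. L t \<omega>) \<inter> {..t}.
        c powr (- left_lim (\<lambda>t. N t \<omega>) s) * jump (\<lambda>t. L t \<omega>) s)"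

text \<open>The distributions depend on \<open>u, v, w\<close> only through the normalized masses \<open>p, q, r\<close>, and not
  on the realization of the process. The sample space type \<open>nat \<Rightarrow> real\<close> is rich enough to carry
  such a process.\<close>

definition realizes ::
  "int \<Rightarrow> real \<Rightarrow> real \<Rightarrow> real \<Rightarrow> real \<Rightarrow> 'a measure \<Rightarrow> (real \<Rightarrow> 'a \<Rightarrow> real) \<Rightarrow> (real \<Rightarrow> 'a \<Rightarrow> real) \<Rightarrow> bool"
  where
  "realizes k c p q r M N L \<longleftrightarrow>
     (\<exists>u v w. 0 \<le> u \<and> 0 \<le> v \<and> 0 \<le> w \<and> 0 < u + v + w \<and>
        p = u / (u + v + w) \<and> q = v / (u + v + w) \<and> r = w / (u + v + w) \<and>
        biv_compound_poisson k c u v w M N L)"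

definition rho_law :: "int \<Rightarrow> real \<Rightarrow> real \<Rightarrow> real \<Rightarrow> real \<Rightarrow> real measure" where
  "rho_law k c p q r =
     (THE \<sigma>. \<exists>(M :: (nat \<Rightarrow> real) measure) N L. realizes k c p q r M N L \<and>
        \<sigma> = distr M borel (\<lambda>\<omega>. L (first_jump_time N \<omega>) \<omega>))"

definition mu_law :: "int \<Rightarrow> real \<Rightarrow> real \<Rightarrow> real \<Rightarrow> real \<Rightarrow> real measure" where
  "mu_law k c p q r =
     (THE \<sigma>. \<exists>(M :: (nat \<Rightarrow> real) measure) N L. realizes k c p q r M N L \<and>
        \<sigma> = distr M borel (\<lambda>\<omega>. Lim at_top (\<lambda>t. exp_integral c N L t \<omega>)))"

end

theory Submission
  imports Defs
begin

text \<open>Write \<open>\<alpha> = c\<^sup>-\<^sup>k\<close>. Observing \<open>N\<close> and \<open>L\<close> on a fine grid and using only that the increments are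
  independent with a common law gives \<open>\<rho>\<close> the characteristic function
  \<open>(p + r e\<^sup>i\<^sup>\<alpha>\<^sup>z) / (1 - q e\<^sup>i\<^sup>z)\<close>, and shows that the one of \<open>\<mu>\<close> solves \<open>g(z) = \<rho>(z) g(z/c)\<close>, so that it is the
  product of the \<open>\<rho>(z/c\<^sup>m)\<close>.

  Take \<open>c\<close> with \<open>c\<^sup>2\<^sup>|\<^sup>k\<^sup>| = 2\<close>, so that \<open>\<alpha>\<close> is \<open>\<surd>2\<close> or its inverse, \<open>q = 1/2\<close> and \<open>a = r/p = 1/16\<close>.
  Then \<open>\<rho>\<close> symmetrized has the signed Levy measure with mass \<open>q\<^sup>l/l\<close> at \<open>\<plusminus>l\<close> and \<open>-(-a)\<^sup>l/l\<close> at
  \<open>\<plusminus>\<alpha>l\<close>. As \<open>\<alpha>\<close> is irrational nothing compensates the negative mass at \<open>2\<alpha>\<close>. In the product defining \<open>\<mu>\<close>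
  the negative masses of the factors sit on top of larger positive ones: for \<open>k > 0\<close> the lattice \<open>\<alpha>\<int>\<close>
  is one of the lattices \<open>c\<^sup>-\<^sup>m\<int>\<close>, and for \<open>k < 0\<close> the lattices \<open>c\<^sup>i\<int>\<close> with \<open>0 < i \<le> |k|\<close>
  are contained in \<open>c\<^sup>i\<^sup>-\<^sup>2\<^sup>|\<^sup>k\<^sup>|\<int>\<close> because \<open>c\<^sup>2\<^sup>|\<^sup>k\<^sup>| = 2\<close>.\<close>

text \<open>\<open>rho_law\<close> and \<open>mu_law\<close> are definite descriptions over all
  realizations on the sample space \<open>nat \<Rightarrow> real\<close>. So one realization has to
  be built, with good paths at every sample point, and all others have to be shown to give the same
  law. Of such an arbitrary realization only the pure jump paths and the law of the increments are
  known. Hence the grids: a cell of length h is controlled up to O(h^2) by the generator of a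
  compound Poisson law, and no enumeration of the jumps with their marks is needed.

  Complex logarithms are avoided: after symmetrization the characteristic functions are positive,
  exponentials of combinations of the real series \<open>lgs\<close> or limits of such, and infinite
  divisibility becomes a question of signs of coefficients.

  The value 1/16 comes from k < 0. Stretched by 2, the mass 16^(-l)/l lands on 2l, where the
  positive mass is 4^(-l)/(2l); it uses up at most half of that, and the other negative part at most
  a quarter. Only |k| factors of the product are exceptional: regrouping the masses changes the
  partial sums of the exponents by |k| terms that tend to 0.\<close>

lemma iexp_add: "iexp (x + y) = iexp x * iexp y"
  by (simp add: distrib_left exp_add)

text \<open>Along a generic direction \<open>(1, \<tau>, \<tau>\<^sup>2, ...)\<close> a linear combination is injective on the countable
  set \<open>C\<close>, so that the one-dimensional uniqueness theorem applies.\<close>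

lemma measure_eqI_countable_char:
  fixes \<phi> :: "'i \<Rightarrow> 'a \<Rightarrow> real"
  assumes M: "prob_space M" and M': "prob_space M'" and sets: "sets M' = sets M"
    and C: "countable C" "AE x in M. x \<in> C" "AE x in M'. x \<in> C" "\<And>x. x \<in> C \<Longrightarrow> {x} \<in> sets M"
    and I: "finite I" and \<phi>[measurable]: "\<And>i. i \<in> I \<Longrightarrow> \<phi> i \<in> borel_measurable M"
    and sep: "\<And>x y. x \<in> C \<Longrightarrow> y \<in> C \<Longrightarrow> (\<And>i. i \<in> I \<Longrightarrow> \<phi> i x = \<phi> i y) \<Longrightarrow> x = y"
    and ch: "\<And>z. (CLINT x|M. iexp (\<Sum>i\<in>I. z i * \<phi> i x)) = (CLINT x|M'. iexp (\<Sum>i\<in>I. z i * \<phi> i x))"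
  shows "M = M'"
proof -
  interpret M: prob_space M by fact
  interpret M': prob_space M' by fact
  obtain e :: "'i \<Rightarrow> nat" where e: "inj_on e I"
    using I finite_imp_inj_to_nat_seg by blast
  \<comment> \<open>The exponents \<open>e i\<close> are distinct, so the differences of values
    become the coefficients of a polynomial in \<tau>, and \<open>B x y\<close> is its finite set of
    roots. Any \<tau> outside these countably many finite sets makes \<open>h\<close> injective on
    \<open>C\<close>.\<close>
  define B where "B x y = {\<tau>::real. (\<Sum>i\<in>I. (\<phi> i x - \<phi> i y) * \<tau> ^ e i) = 0}" for x y
  have fin: "finite (B x y)" if xy: "x \<in> C" "y \<in> C" "x \<noteq> y" for x y
  proof -
    define P where "P = (\<Sum>i\<in>I. Polynomial.monom (\<phi> i x - \<phi> i y) (e i))"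
    have pc: "poly P \<tau> = (\<Sum>i\<in>I. (\<phi> i x - \<phi> i y) * \<tau> ^ e i)" for \<tau>
      by (simp add: P_def poly_sum poly_monom)
    obtain j where j: "j \<in> I" "\<phi> j x \<noteq> \<phi> j y" using sep[OF xy(1,2)] xy(3) by blast
    have "coeff P (e j) = (\<Sum>i\<in>I. if i = j then \<phi> i x - \<phi> i y else 0)"
      unfolding P_def coeff_sum using e j by (intro sum.cong) (auto simp: inj_on_def)
    also have "\<dots> \<noteq> 0" using I j by simp
    finally have "P \<noteq> 0" by auto
    then show ?thesis unfolding B_def using poly_roots_finite[of P] by (simp add: pc)
  qed
  have "countable (\<Union>x\<in>C. \<Union>y\<in>C - {x}. B x y)"
    using C(1) fin by (intro countable_UN) (auto intro: countable_finite)
  then obtain \<tau> where \<tau>: "\<tau> \<notin> (\<Union>x\<in>C. \<Union>y\<in>C - {x}. B x y)"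
    using uncountable_UNIV_real by (metis UNIV_eq_I)
  define h where "h x = (\<Sum>i\<in>I. \<tau> ^ e i * \<phi> i x)" for x
  have h[measurable]: "h \<in> borel_measurable M" unfolding h_def by measurable
  have h'[measurable]: "h \<in> borel_measurable M'" using h by (simp cong: measurable_cong_sets add: sets)
  have inj: "inj_on h C"
  proof (rule inj_onI, rule ccontr)
    fix x y assume xy: "x \<in> C" "y \<in> C" "h x = h y" "x \<noteq> y"
    then have "(\<Sum>i\<in>I. (\<phi> i x - \<phi> i y) * \<tau> ^ e i) = 0"
      by (simp add: h_def algebra_simps sum_subtractf)
    with xy \<tau> show False by (auto simp: B_def)
  qed
  have "char (distr M borel h) = char (distr M' borel h)"
  proof
    fix t
    have "char (distr M borel h) t = (CLINT x|M. iexp (\<Sum>i\<in>I. (t * \<tau> ^ e i) * \<phi> i x))"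
      by (simp add: char_def integral_distr h_def sum_distrib_left mult.assoc)
    also have "\<dots> = (CLINT x|M'. iexp (\<Sum>i\<in>I. (t * \<tau> ^ e i) * \<phi> i x))" by (rule ch)
    also have "\<dots> = char (distr M' borel h) t"
      by (simp add: char_def integral_distr h_def sum_distrib_left mult.assoc)
    finally show "char (distr M borel h) t = char (distr M' borel h) t" .
  qed
  then have D: "distr M borel h = distr M' borel h"
    by (intro Levy_uniqueness) auto
  \<comment> \<open>By injectivity on \<open>C\<close>, a measurable \<open>A\<close> is recovered
    up to a null set from the image of \<open>A \<inter> C\<close> under \<open>h\<close>, which is
    Borel because it is countable.\<close>
  have key: "emeasure N A = emeasure (distr N borel h) (h ` (A \<inter> C))"
    if N: "prob_space N" "sets N = sets M" "AE x in N. x \<in> C" "h \<in> borel_measurable N"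
      and A: "A \<in> sets M" for N A
  proof -
    interpret N: prob_space N by fact
    note [measurable] = N(4)
    have "countable (h ` (A \<inter> C))" using C(1) by auto
    then have b: "h ` (A \<inter> C) \<in> sets borel"
      by (rule sets.countable[rotated]) auto
    have "emeasure (distr N borel h) (h ` (A \<inter> C)) = emeasure N (h -` (h ` (A \<inter> C)) \<inter> space N)"
      using b by (intro emeasure_distr) auto
    also have "\<dots> = emeasure N A"
    proof (rule emeasure_eq_AE)
      show "AE x in N. x \<in> h -` (h ` (A \<inter> C)) \<inter> space N \<longleftrightarrow> x \<in> A"
        using N(3) AE_space
      proof eventually_elim
        case (elim x)
        then show ?case using inj A by (auto simp: inj_on_def)
      qed
      show "h -` (h ` (A \<inter> C)) \<inter> space N \<in> sets N" using b N(4) by (rule measurable_sets[rotated])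
      show "A \<in> sets N" using A N by simp
    qed
    finally show ?thesis by simp
  qed
  show ?thesis
  proof (rule measure_eqI)
    fix A assume "A \<in> sets M"
    then show "emeasure M A = emeasure M' A"
      using key[OF M refl C(2) h] key[OF M' sets C(3) h'] D by simp
  qed (simp add: sets)
qed

section \<open>Compound Poisson distributions on countable sets\<close>

text \<open>Fubini for mixtures of discrete laws, reduced to real integrands by taking real and
  imaginary parts.\<close>

lemma expectation_bind_pmf_bounded:
  fixes f :: "'b \<Rightarrow> complex"
  assumes B: "\<And>x. norm (f x) \<le> B"
  shows "measure_pmf.expectation (bind_pmf M N) f = measure_pmf.expectation M (\<lambda>x. measure_pmf.expectation (N x) f)"
proof -
  have r: "measure_pmf.expectation (bind_pmf M N) g = measure_pmf.expectation M (\<lambda>x. measure_pmf.expectation (N x) g)"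
    if g: "\<And>x. \<bar>g x\<bar> \<le> B" for g :: "'b \<Rightarrow> real"
    unfolding measure_pmf_bind
    by (rule integral_bind[where K="count_space UNIV" and B=B and B'=1])
       (auto simp: g measure_pmf.emeasure_space_1 measure_pmf_in_subprob_space intro: measure_pmf.finite_measure_axioms)
  have i: "integrable (measure_pmf p) f" for p
    using B by (intro measure_pmf.integrable_const_bound[where B=B]) auto
  have i2: "integrable (measure_pmf p) (\<lambda>x. measure_pmf.expectation (N x) f)" for p
  proof (intro measure_pmf.integrable_const_bound[where B=B])
    show "AE x in measure_pmf p. norm (measure_pmf.expectation (N x) f) \<le> B"
    proof (rule AE_I2)
      fix x
      have "norm (measure_pmf.expectation (N x) f) \<le> measure_pmf.expectation (N x) (\<lambda>x. norm (f x))"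
        by (rule integral_norm_bound)
      also have "\<dots> \<le> measure_pmf.expectation (N x) (\<lambda>_. B)"
        using i B by (intro integral_mono) auto
      finally show "norm (measure_pmf.expectation (N x) f) \<le> B" by simp
    qed
  qed auto
  show ?thesis
  proof (rule complex_eqI)
    show "Re (measure_pmf.expectation (bind_pmf M N) f) = Re (measure_pmf.expectation M (\<lambda>x. measure_pmf.expectation (N x) f))"
      using r[of "\<lambda>x. Re (f x)"] B abs_Re_le_cmod order_trans i i2 by (simp flip: integral_Re) blast
    show "Im (measure_pmf.expectation (bind_pmf M N) f) = Im (measure_pmf.expectation M (\<lambda>x. measure_pmf.expectation (N x) f))"
      using r[of "\<lambda>x. Im (f x)"] B abs_Im_le_cmod order_trans i i2 by (simp flip: integral_Im) blast
  qed
qed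

lemma cmod_expectation_pmf_le:
  fixes f :: "'b \<Rightarrow> complex"
  assumes B: "\<And>x. norm (f x) \<le> B"
  shows "norm (measure_pmf.expectation p f) \<le> B"
proof -
  have i: "integrable (measure_pmf p) f"
    using B by (intro measure_pmf.integrable_const_bound[where B=B]) auto
  have "norm (measure_pmf.expectation p f) \<le> measure_pmf.expectation p (\<lambda>x. norm (f x))"
    by (rule integral_norm_bound)
  also have "\<dots> \<le> measure_pmf.expectation p (\<lambda>_. B)"
    using i B by (intro integral_mono) auto
  finally show ?thesis by simp
qed

lemma expectation_nat_sums:
  fixes f :: "nat \<Rightarrow> complex"
  assumes B: "\<And>x. norm (f x) \<le> B"
  shows "(\<lambda>k. of_real (pmf p k) * f k) sums measure_pmf.expectation p f"
proof -
  have i: "integrable (measure_pmf p) f"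
    using B by (intro measure_pmf.integrable_const_bound[where B=B]) auto
  have "integrable (density (count_space UNIV) (pmf p)) f" using i by (simp flip: measure_pmf_eq_density)
  then have i': "integrable (count_space UNIV) (\<lambda>k. pmf p k *\<^sub>R f k)"
    by (subst (asm) integrable_density) auto
  have "measure_pmf.expectation p f = integral\<^sup>L (count_space UNIV) (\<lambda>k. pmf p k *\<^sub>R f k)"
    unfolding measure_pmf_eq_density by (subst integral_density) auto
  then show ?thesis
    using sums_integral_count_space_nat[OF i'] by (simp add: scaleR_conv_of_real)
qed

text \<open>Law of the sum of \<open>k\<close> independent steps with law \<open>J\<close>. The
  general monoid covers both uses of \<open>cpois\<close> below: increments in the plane and laws on
  the natural numbers.\<close>

primrec walk :: "'a::comm_monoid_add pmf \<Rightarrow> nat \<Rightarrow> 'a pmf" where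
  "walk J 0 = return_pmf 0"
| "walk J (Suc k) = bind_pmf J (\<lambda>x. map_pmf ((+) x) (walk J k))"

definition cpois :: "real \<Rightarrow> 'a::comm_monoid_add pmf \<Rightarrow> 'a pmf" where
  "cpois l J = bind_pmf (poisson_pmf l) (walk J)"

lemma expectation_cpois_sums:
  fixes f :: "'a::comm_monoid_add \<Rightarrow> complex"
  assumes l: "0 < l" and B: "\<And>x. norm (f x) \<le> B"
  shows "(\<lambda>k. of_real (l ^ k / fact k * exp (- l)) * measure_pmf.expectation (walk J k) f) sums
           measure_pmf.expectation (cpois l J) f"
  unfolding cpois_def expectation_bind_pmf_bounded[of f, OF B]
  using expectation_nat_sums[of "\<lambda>k. measure_pmf.expectation (walk J k) f" B "poisson_pmf l"]
    cmod_expectation_pmf_le[of f, OF B] l by simp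

lemma expectation_walk_mult:
  fixes f :: "'a::comm_monoid_add \<Rightarrow> complex"
  assumes B: "\<And>x. norm (f x) \<le> B" and f: "f 0 = 1" "\<And>x y. f (x + y) = f x * f y"
  shows "measure_pmf.expectation (walk J k) f = measure_pmf.expectation J f ^ k"
  using assms
  by (induction k) (simp_all add: expectation_bind_pmf_bounded[of f, OF B] mult.commute)

text \<open>A multiplicative \<open>f\<close> turns \<open>k\<close> steps into the k-th power of
  the one-step expectation, so the Poisson weights add up to an exponential series.\<close>

lemma expectation_cpois_mult:
  fixes f :: "'a::comm_monoid_add \<Rightarrow> complex"
  assumes l: "0 < l" and B: "\<And>x. norm (f x) \<le> B" and f: "f 0 = 1" "\<And>x y. f (x + y) = f x * f y"
  shows "measure_pmf.expectation (cpois l J) f = exp (of_real l * (measure_pmf.expectation J f - 1))"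
proof -
  let ?E = "measure_pmf.expectation J f"
  have "(\<lambda>k. exp (- of_real l) * ((of_real l * ?E) ^ k /\<^sub>R fact k)) sums (exp (- of_real l) * exp (of_real l * ?E))"
    by (intro sums_mult exp_converges)
  also have "(\<lambda>k. exp (- of_real l) * ((of_real l * ?E) ^ k /\<^sub>R fact k)) =
     (\<lambda>k. of_real (l ^ k / fact k * exp (- l)) * measure_pmf.expectation (walk J k) f)"
    by (simp add: expectation_walk_mult[of f, OF B f] scaleR_conv_of_real power_mult_distrib field_simps
         flip: exp_of_real)
  finally have "measure_pmf.expectation (cpois l J) f = exp (- of_real l) * exp (of_real l * ?E)"
    using expectation_cpois_sums[of l f, OF l B] sums_unique2 by blast
  then show ?thesis by (simp add: algebra_simps flip: exp_add)
qed

text \<open>Short-time expansion. \<open>f\<close> is merely bounded, since it will be applied to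
  discontinuous functions that test whether \<open>N\<close> has moved in a grid cell. Two or more
  steps have probability at most l^2, and replacing exp(-l) by 1 - l and l exp(-l) by l costs
  another l^2 each; hence the factor 3.\<close>

lemma expectation_cpois_generator:
  fixes f :: "'a::comm_monoid_add \<Rightarrow> complex"
  assumes l: "0 < l" and B: "\<And>x. norm (f x) \<le> B"
  shows "norm (measure_pmf.expectation (cpois l J) f - f 0 - of_real l * (measure_pmf.expectation J f - f 0)) \<le> 3 * B * l\<^sup>2"
proof -
  define a where "a k = of_real (l ^ k / fact k * exp (- l)) * measure_pmf.expectation (walk J k) f" for k
  have B0: "0 \<le> B" using B[of 0] norm_ge_zero order_trans by blast
  have w1: "measure_pmf.expectation (walk J 1) f = measure_pmf.expectation J f"
    by (simp add: expectation_bind_pmf_bounded[of f, OF B])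
  have s: "a sums measure_pmf.expectation (cpois l J) f"
    unfolding a_def by (rule expectation_cpois_sums[OF l B])
  have e1: "(\<lambda>k. B * exp (- l) * (l ^ k / fact k)) sums (B * exp (- l) * exp l)"
    using exp_converges[of l] by (intro sums_mult) (simp add: field_simps)
  then have e2: "(\<lambda>k. B * exp (- l) * (l ^ (k + 2) / fact (k + 2))) sums (B * exp (- l) * exp l - (\<Sum>k<2. B * exp (- l) * (l ^ k / fact k)))"
    by (rule sums_split_initial_segment)
  have a2: "(\<lambda>k. a (k + 2)) sums (measure_pmf.expectation (cpois l J) f - (\<Sum>k<2. a k))"
    using s by (rule sums_split_initial_segment)
  have ab: "norm (a k) \<le> B * exp (- l) * (l ^ k / fact k)" for k
  proof -
    have "norm (a k) = (l ^ k / fact k * exp (- l)) * norm (measure_pmf.expectation (walk J k) f)"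
      using l by (simp add: a_def norm_mult norm_divide norm_power)
    also have "\<dots> \<le> (l ^ k / fact k * exp (- l)) * B"
      using l cmod_expectation_pmf_le[of f, OF B] by (intro mult_left_mono) auto
    finally show ?thesis by (simp add: mult_ac)
  qed
  have "norm (\<Sum>k. a (k + 2)) \<le> (\<Sum>k. B * exp (- l) * (l ^ (k + 2) / fact (k + 2)))"
    by (rule norm_suminf_le[OF ab sums_summable[OF e2]])
  then have R: "norm (measure_pmf.expectation (cpois l J) f - (a 0 + a 1)) \<le> B * exp (- l) * exp l - (B * exp (-l) + B * exp (-l) * l)"
    using sums_unique[OF e2] sums_unique[OF a2] by (simp add: numeral_2_eq_2)
  have x1: "1 - l \<le> exp (- l)" using exp_ge_add_one_self[of "-l"] by simp
  have x2: "exp (- l) \<le> 1 - l + l\<^sup>2" 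
  proof -
    have "exp (- l) * exp l = 1" by (simp flip: exp_add)
    moreover have "1 + l \<le> exp l" by (rule exp_ge_add_one_self)
    ultimately have "exp (- l) * (1 + l) \<le> 1" by (metis exp_ge_zero mult_left_mono)
    then have "exp (- l) \<le> 1 / (1 + l)" using l by (simp add: field_simps)
    also have "\<dots> \<le> 1 - l + l\<^sup>2" using l by (simp add: field_simps power2_eq_square)
    finally show ?thesis .
  qed
  have "1 - exp (- l) - exp (- l) * l \<le> 1 - (1 - l) - (1 - l) * l"
    using x1 l by (intro diff_mono mult_right_mono) auto
  also have "\<dots> = l\<^sup>2" by (simp add: power2_eq_square algebra_simps)
  finally have "B * (1 - exp (- l) - exp (- l) * l) \<le> B * l\<^sup>2" by (rule mult_left_mono) fact
  then have R': "norm (measure_pmf.expectation (cpois l J) f - (a 0 + a 1)) \<le> B * l\<^sup>2"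
    using R by (simp add: algebra_simps flip: exp_add)
  have a0: "a 0 = of_real (exp (-l)) * f 0" by (simp add: a_def)
  have a1: "a 1 = of_real (l * exp (-l)) * measure_pmf.expectation J f" using w1 by (simp add: a_def)
  have n0: "norm (a 0 - of_real (1 - l) * f 0) \<le> l\<^sup>2 * B"
  proof -
    have "norm (a 0 - of_real (1 - l) * f 0) = \<bar>exp (-l) - (1 - l)\<bar> * norm (f 0)"
      unfolding a0 by (metis left_diff_distrib norm_mult norm_of_real of_real_diff)
    also have "\<dots> \<le> l\<^sup>2 * B" using x1 x2 B by (intro mult_mono) auto
    finally show ?thesis .
  qed
  have n1: "norm (a 1 - of_real l * measure_pmf.expectation J f) \<le> l\<^sup>2 * B"
  proof -
    have "norm (a 1 - of_real l * measure_pmf.expectation J f) = \<bar>l * exp (-l) - l\<bar> * norm (measure_pmf.expectation J f)"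
      unfolding a1 by (metis left_diff_distrib norm_mult norm_of_real of_real_diff)
    also have "\<dots> \<le> l\<^sup>2 * B"
    proof (intro mult_mono)
      have "l * (1 - l) \<le> l * exp (-l)" "l * exp (-l) \<le> l * 1" using x1 l by (auto intro!: mult_left_mono)
      then show "\<bar>l * exp (-l) - l\<bar> \<le> l\<^sup>2" by (simp add: power2_eq_square algebra_simps abs_if)
    qed (use cmod_expectation_pmf_le[of f, OF B] in auto)
    finally show ?thesis .
  qed
  have "measure_pmf.expectation (cpois l J) f - f 0 - of_real l * (measure_pmf.expectation J f - f 0) =
     (measure_pmf.expectation (cpois l J) f - (a 0 + a 1)) + (a 0 - of_real (1 - l) * f 0) + (a 1 - of_real l * measure_pmf.expectation J f)"
    by (simp add: algebra_simps)
  also have "norm \<dots> \<le> B * l\<^sup>2 + l\<^sup>2 * B + l\<^sup>2 * B"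
    using R' n0 n1 by (intro norm_triangle_le add_mono) auto
  finally show ?thesis by (simp add: algebra_simps)
qed

text \<open>A bound of Wald type: by subadditivity the mean of \<open>g\<close> after
  \<open>k\<close> steps is at most \<open>k\<close> times the one-step mean, and the Poisson mean
  of \<open>k\<close> is \<open>l\<close>.\<close>

lemma nn_integral_cpois_le:
  fixes g :: "'a::comm_monoid_add \<Rightarrow> ennreal"
  assumes l: "0 < l" and g0: "g 0 = 0" and g: "\<And>x y. g (x + y) \<le> g x + g y"
  shows "(\<integral>\<^sup>+x. g x \<partial>cpois l J) \<le> ennreal l * (\<integral>\<^sup>+x. g x \<partial>J)"
proof -
  have w: "(\<integral>\<^sup>+x. g x \<partial>walk J k) \<le> of_nat k * (\<integral>\<^sup>+x. g x \<partial>J)" for k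
  proof (induction k)
    case (Suc k)
    have "(\<integral>\<^sup>+x. g x \<partial>walk J (Suc k)) = (\<integral>\<^sup>+x. \<integral>\<^sup>+y. g (x + y) \<partial>walk J k \<partial>J)" by simp
    also have "\<dots> \<le> (\<integral>\<^sup>+x. \<integral>\<^sup>+y. g x + g y \<partial>walk J k \<partial>J)" by (intro nn_integral_mono g)
    also have "\<dots> = (\<integral>\<^sup>+x. g x \<partial>J) + (\<integral>\<^sup>+y. g y \<partial>walk J k)" by (simp add: nn_integral_add)
    also have "\<dots> \<le> of_nat (Suc k) * (\<integral>\<^sup>+x. g x \<partial>J)" using Suc by (simp add: distrib_right add_left_mono)
    finally show ?case .
  qed (simp add: g0)
  have "(\<lambda>k. exp (-l) * l * (l ^ k /\<^sub>R fact k)) sums (exp (-l) * l * exp l)"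
    by (intro sums_mult exp_converges)
  then have s: "(\<lambda>k. (l ^ Suc k / fact (Suc k) * exp (- l)) * real (Suc k)) sums l"
    by (simp add: field_simps del: of_nat_Suc flip: exp_add)
  have "(\<integral>\<^sup>+k. of_nat k \<partial>poisson_pmf l) = (\<Sum>k. ennreal ((l ^ k / fact k * exp (- l)) * real k))"
    using l by (simp add: nn_integral_measure_pmf nn_integral_count_space_nat ennreal_mult'' ennreal_of_nat_eq_real_of_nat del: ennreal_mult_divide_eq flip: times_divide_eq_left)
  also have "\<dots> = ennreal l"
    using l sums_Suc[OF s] by (intro suminf_ennreal_eq) auto
  finally have m: "(\<integral>\<^sup>+k. of_nat k \<partial>poisson_pmf l) = ennreal l" .
  have "(\<integral>\<^sup>+x. g x \<partial>cpois l J) = (\<integral>\<^sup>+k. \<integral>\<^sup>+x. g x \<partial>walk J k \<partial>poisson_pmf l)" by (simp add: cpois_def)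
  also have "\<dots> \<le> (\<integral>\<^sup>+k. of_nat k * (\<integral>\<^sup>+x. g x \<partial>J) \<partial>poisson_pmf l)" by (intro nn_integral_mono w)
  also have "\<dots> = ennreal l * (\<integral>\<^sup>+x. g x \<partial>J)" by (simp add: nn_integral_multc m)
  finally show ?thesis .
qed

section \<open>Paths with locally finitely many jumps\<close>

text \<open>Distinct indices may share a time and their marks may cancel, so the jump times are only
  contained in the set of point times. The path is therefore summed over all times
  \<open>\<tau> e\<close>, and those with vanishing jump are dropped afterwards.\<close>

lemma pure_jump_point_sum:
  fixes x :: "'e \<Rightarrow> 'b::real_normed_vector" and \<tau> :: "'e \<Rightarrow> real"
  assumes fin: "\<And>t. finite {e\<in>E. \<tau> e \<le> t}" and pos: "\<And>e. e \<in> E \<Longrightarrow> 0 < \<tau> e"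
  shows "pure_jump (\<lambda>t. \<Sum>e\<in>{e\<in>E. \<tau> e \<le> t}. x e)"
proof -
  define f where "f t = (\<Sum>e\<in>{e\<in>E. \<tau> e \<le> t}. x e)" for t
  define g where "g t = (\<Sum>e\<in>{e\<in>E. \<tau> e < t}. x e)" for t
  have fin': "finite {e\<in>E. \<tau> e < t}" for t by (rule finite_subset[OF _ fin[of t]]) auto
  have R: "eventually (\<lambda>s. f s = f t) (at_right t)" for t
  proof -
    have "eventually (\<lambda>s. \<forall>e\<in>{e\<in>E. \<tau> e \<le> t + 1 \<and> t < \<tau> e}. s < \<tau> e) (at_right t)"
    proof (rule eventually_ball_finite)
      show "finite {e\<in>E. \<tau> e \<le> t + 1 \<and> t < \<tau> e}" by (rule finite_subset[OF _ fin[of "t+1"]]) auto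
      show "\<forall>e\<in>{e\<in>E. \<tau> e \<le> t + 1 \<and> t < \<tau> e}. eventually (\<lambda>s. s < \<tau> e) (at_right t)"
        by (auto intro: order_tendstoD(2)[OF tendsto_ident_at])
    qed
    moreover have "eventually (\<lambda>s. s < t + 1) (at_right t)"
      by (rule order_tendstoD(2)[OF tendsto_ident_at]) simp
    moreover have "eventually (\<lambda>s. t < s) (at_right t)" by (rule eventually_at_right_less)
    ultimately show ?thesis
    proof eventually_elim
      case (elim s)
      then have "{e\<in>E. \<tau> e \<le> s} = {e\<in>E. \<tau> e \<le> t}" by force
      then show ?case by (simp add: f_def)
    qed
  qed
  have L: "eventually (\<lambda>s. f s = g t) (at_left t)" for t
  proof -
    have "eventually (\<lambda>s. \<forall>e\<in>{e\<in>E. \<tau> e < t}. \<tau> e < s) (at_left t)"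
      using fin' by (intro eventually_ball_finite) (auto intro: order_tendstoD(1)[OF tendsto_ident_at])
    moreover have "eventually (\<lambda>s. s < t) (at_left t)"
      by (auto simp: eventually_at_filter)
    ultimately show ?thesis
    proof eventually_elim
      case (elim s)
      then have "{e\<in>E. \<tau> e \<le> s} = {e\<in>E. \<tau> e < t}" by force
      then show ?case by (simp add: f_def g_def)
    qed
  qed
  have Ll: "(f \<longlongrightarrow> g t) (at_left t)" for t using L by (rule tendsto_eventually)
  have j: "jump f t = (\<Sum>e\<in>{e\<in>E. \<tau> e = t}. x e)" for t
  proof -
    have "left_lim f t = g t" unfolding left_lim_def using Ll by (intro tendsto_Lim) auto
    moreover have "f t = g t + (\<Sum>e\<in>{e\<in>E. \<tau> e = t}. x e)"
      unfolding f_def g_def using fin' finite_subset[OF _ fin[of t], of "{e\<in>E. \<tau> e = t}"]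
      by (subst sum.union_disjoint[symmetric]) (auto intro!: sum.cong)
    ultimately show ?thesis by (simp add: jump_def)
  qed
  have js: "jump_times f \<inter> {..t} \<subseteq> \<tau> ` {e\<in>E. \<tau> e \<le> t}" for t
  proof
    fix s assume s: "s \<in> jump_times f \<inter> {..t}"
    then have "(\<Sum>e\<in>{e\<in>E. \<tau> e = s}. x e) \<noteq> 0" by (simp add: jump_times_def j)
    then have "{e\<in>E. \<tau> e = s} \<noteq> {}" using sum.empty by metis
    with s show "s \<in> \<tau> ` {e\<in>E. \<tau> e \<le> t}" by auto
  qed
  have "pure_jump f"
    unfolding pure_jump_def cadlag_def
  proof (intro conjI allI impI)
    fix t :: real assume "0 \<le> t"
    show "continuous (at_right t) f" unfolding continuous_within using R by (rule tendsto_eventually)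
  next
    fix t :: real assume "0 < t"
    show "\<exists>l. (f \<longlongrightarrow> l) (at_left t)" using Ll by blast
  next
    fix t :: real assume "0 \<le> t"
    show "finite (jump_times f \<inter> {..t})" by (rule finite_subset[OF js]) (simp add: fin)
  next
    fix t :: real assume "0 \<le> t"
    have "f t = (\<Sum>s\<in>\<tau> ` {e\<in>E. \<tau> e \<le> t}. \<Sum>e\<in>{e\<in>{e\<in>E. \<tau> e \<le> t}. \<tau> e = s}. x e)"
      unfolding f_def by (rule sum.image_gen) (rule fin)
    also have "\<dots> = (\<Sum>s\<in>\<tau> ` {e\<in>E. \<tau> e \<le> t}. jump f s)"
      unfolding j by (intro sum.cong) auto
    also have "\<dots> = (\<Sum>s\<in>jump_times f \<inter> {..t}. jump f s)"
      using fin pos js[of t] by (intro sum.mono_neutral_right) (auto simp: jump_times_def)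
    finally show "f t = (\<Sum>s\<in>jump_times f \<inter> {..t}. jump f s)" .
  qed
  then show ?thesis by (simp add: f_def[abs_def])
qed

lemma indep_coordinates:
  fixes D :: "nat \<Rightarrow> real measure"
  assumes D: "\<And>n. prob_space (D n)" and sets: "\<And>n. sets (D n) = sets borel"
  shows "(\<lambda>\<omega>. \<omega> n) \<in> borel_measurable (PiM UNIV D)"
    and "distr (PiM UNIV D) borel (\<lambda>\<omega>. \<omega> n) = D n"
    and "prob_space.indep_vars (PiM UNIV D) (\<lambda>_. borel) (\<lambda>n \<omega>. \<omega> n) UNIV"
proof -
  interpret prob_space "PiM UNIV D" by (intro prob_space_PiM D)
  have "(\<lambda>\<omega>. \<omega> n) \<in> measurable (PiM UNIV D) (D n)" for n by measurable
  then show m: "(\<lambda>\<omega>. \<omega> n) \<in> borel_measurable (PiM UNIV D)" for n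
    by (simp add: sets cong: measurable_cong_sets)
  show d: "distr (PiM UNIV D) borel (\<lambda>\<omega>. \<omega> n) = D n" for n
  proof -
    have "distr (PiM UNIV D) borel (\<lambda>\<omega>. \<omega> n) = distr (PiM UNIV D) (D n) (\<lambda>\<omega>. \<omega> n)"
      by (intro distr_cong) (auto simp: sets)
    also have "\<dots> = D n" by (intro distr_PiM_component D) auto
    finally show ?thesis .
  qed
  have "sets (PiM UNIV D) = sets (PiM UNIV (\<lambda>_. borel))" by (rule sets_PiM_cong) (auto simp: sets)
  then have "distr (PiM UNIV D) (PiM UNIV (\<lambda>_. borel)) (\<lambda>x. x) = PiM UNIV D"
    by (intro distr_id2) simp
  then show "indep_vars (\<lambda>_. borel) (\<lambda>n \<omega>. \<omega> n) UNIV"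
    by (subst indep_vars_iff_distr_eq_PiM) (auto simp: restrict_def d intro: m)
qed

section \<open>Construction of the process\<close>

text \<open>Block \<open>b\<close> carries the jumps of type \<open>b mod 3\<close> in the time interval \<open>(n, n + 1]\<close>, \<open>n = b div 3\<close>:
  coordinate \<open>(b, 0)\<close> is their Poisson number, coordinate \<open>(b, i + 1)\<close> the position of the \<open>i\<close>-th.\<close>

definition pt_dist :: "(nat \<Rightarrow> real) \<Rightarrow> nat \<Rightarrow> real measure" where
  "pt_dist rate n = (case prod_decode n of (b, i) \<Rightarrow>
     if i = 0 then distr (measure_pmf (poisson_pmf (rate (b mod 3)))) borel real
     else uniform_measure lborel {0<..1})"

definition pt_space :: "(nat \<Rightarrow> real) \<Rightarrow> (nat \<Rightarrow> real) measure" where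
  "pt_space rate = PiM UNIV (pt_dist rate)"

definition cnt :: "(nat \<Rightarrow> real) \<Rightarrow> nat \<Rightarrow> nat" where
  "cnt \<omega> b = nat \<lfloor>\<omega> (prod_encode (b, 0))\<rfloor>"

text \<open>Uniform coordinates lie in (0, 1] only almost surely, while a realization must have good
  paths at every sample point. Clamping, like the total function used in \<open>cnt\<close>, leaves
  no exceptional set.\<close>

definition clamp01 :: "real \<Rightarrow> real" where
  "clamp01 u = (if 0 < u \<and> u \<le> 1 then u else 1)"

definition ptime :: "(nat \<Rightarrow> real) \<Rightarrow> nat \<times> nat \<Rightarrow> real" where
  "ptime \<omega> e = real (fst e div 3) + clamp01 (\<omega> (prod_encode (fst e, Suc (snd e))))"

definition jvec :: "real \<Rightarrow> nat \<Rightarrow> real \<times> real" where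
  "jvec \<alpha> b = (if b mod 3 = 0 then (1, 0) else if b mod 3 = 1 then (0, 1) else (1, \<alpha>))"

definition pproc :: "real \<Rightarrow> real \<Rightarrow> (nat \<Rightarrow> real) \<Rightarrow> real \<times> real" where
  "pproc \<alpha> t \<omega> = (\<Sum>e\<in>{e\<in>{(b, i). i < cnt \<omega> b}. ptime \<omega> e \<le> t}. jvec \<alpha> (fst e))"

lemma clamp01: "0 < clamp01 u" "clamp01 u \<le> 1" by (auto simp: clamp01_def)

lemma ptime_gt: "real (b div 3) < ptime \<omega> (b, i)"
  using clamp01[of "\<omega> (prod_encode (b, Suc i))"] by (simp add: ptime_def)

text \<open>Points of block \<open>b\<close> come strictly after time \<open>b div 3\<close>, so
  only the first 3N blocks matter up to time N. This gives local finiteness and a formula for the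
  process with a fixed finite range of blocks.\<close>

lemma points_subset:
  assumes "t \<le> real N"
  shows "{e\<in>{(b, i). i < cnt \<omega> b}. ptime \<omega> e \<le> t} \<subseteq> (SIGMA b:{..<3 * N}. {..<cnt \<omega> b})"
proof (clarsimp)
  fix b i assume "ptime \<omega> (b, i) \<le> t"
  then have "real (b div 3) < real N" using ptime_gt[of b \<omega> i] assms by linarith
  then show "b < 3 * N" by (simp add: less_mult_imp_div_less mult.commute div_less_iff_less_mult)
qed

lemma finite_points: "finite {e\<in>{(b, i). i < cnt \<omega> b}. ptime \<omega> e \<le> t}"
proof -
  obtain N where "t \<le> real N" using real_arch_simple by blast
  from finite_subset[OF points_subset[OF this]] show ?thesis by auto
qed

lemma pure_jump_pproc: "pure_jump (\<lambda>t. pproc \<alpha> t \<omega>)"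
  unfolding pproc_def
proof (rule pure_jump_point_sum[OF finite_points])
  fix e assume "e \<in> {(b, i). i < cnt \<omega> b}"
  show "0 < ptime \<omega> e" using ptime_gt[of "fst e" \<omega> "snd e"] by (simp add: le_less_trans[rotated])
qed

lemma pproc_eq:
  assumes "t \<le> real N"
  shows "pproc \<alpha> t \<omega> = (\<Sum>b<3 * N. \<Sum>i<cnt \<omega> b. indicator {..t} (ptime \<omega> (b, i)) *\<^sub>R jvec \<alpha> b)"
proof -
  have "pproc \<alpha> t \<omega> = (\<Sum>e\<in>(SIGMA b:{..<3 * N}. {..<cnt \<omega> b}). indicator {..t} (ptime \<omega> e) *\<^sub>R jvec \<alpha> (fst e))"
    unfolding pproc_def
  proof (rule sum.mono_neutral_cong_left)
    show "\<forall>e\<in>(SIGMA b:{..<3 * N}. {..<cnt \<omega> b}) - {e\<in>{(b, i). i < cnt \<omega> b}. ptime \<omega> e \<le> t}.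
       indicator {..t} (ptime \<omega> e) *\<^sub>R jvec \<alpha> (fst e) = 0"
      by (auto simp: indicator_def)
    show "jvec \<alpha> (fst e) = indicator {..t} (ptime \<omega> e) *\<^sub>R jvec \<alpha> (fst e)"
      if "e \<in> {e\<in>{(b, i). i < cnt \<omega> b}. ptime \<omega> e \<le> t}" for e
      using that by (simp add: indicator_def)
  qed (use points_subset[OF assms] in auto)
  also have "\<dots> = (\<Sum>b<3 * N. \<Sum>i<cnt \<omega> b. indicator {..t} (ptime \<omega> (b, i)) *\<^sub>R jvec \<alpha> b)"
    by (subst sum.Sigma) (simp_all add: case_prod_unfold)
  finally show ?thesis .
qed

lemma pproc_0: "pproc \<alpha> 0 \<omega> = 0"
  using pproc_eq[of 0 0 \<alpha> \<omega>] by simp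

lemma pproc_diff:
  assumes "s \<le> t" "t \<le> real N"
  shows "pproc \<alpha> t \<omega> - pproc \<alpha> s \<omega> = (\<Sum>b<3 * N. \<Sum>i<cnt \<omega> b. indicator {s<..t} (ptime \<omega> (b, i)) *\<^sub>R jvec \<alpha> b)"
proof -
  have "indicator {..t} y *\<^sub>R jvec \<alpha> b - indicator {..s} y *\<^sub>R jvec \<alpha> b = indicator {s<..t} y *\<^sub>R jvec \<alpha> b" for y b
    using assms(1) by (auto simp: indicator_def)
  then show ?thesis
    using assms by (simp only: pproc_eq[where N=N] order_trans[OF assms] flip: sum_subtractf)
qed

lemma sets_pt_dist[measurable_cong, simp]: "sets (pt_dist rate n) = sets borel"
  by (simp add: pt_dist_def split: prod.split)

lemma prob_space_pt_dist: "prob_space (pt_dist rate n)"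
  unfolding pt_dist_def
  by (auto split: prod.split intro!: measure_pmf.prob_space_distr prob_space_uniform_measure)

lemma prob_space_pt_space: "prob_space (pt_space rate)"
  unfolding pt_space_def by (intro prob_space_PiM prob_space_pt_dist)

lemma measurable_coord: "(\<lambda>\<omega>. \<omega> n) \<in> borel_measurable (pt_space rate)"
  and distr_coord: "distr (pt_space rate) borel (\<lambda>\<omega>. \<omega> n) = pt_dist rate n"
  and indep_coords: "prob_space.indep_vars (pt_space rate) (\<lambda>_. borel) (\<lambda>n \<omega>. \<omega> n) UNIV"
  unfolding pt_space_def by (rule indep_coordinates[OF prob_space_pt_dist sets_pt_dist])+

lemma measurable_cnt[measurable]: "(\<lambda>\<omega>. cnt \<omega> b) \<in> measurable (pt_space rate) (count_space UNIV)"
  unfolding cnt_def by (rule measurable_compose[OF measurable_coord]) measurable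

lemma measurable_clamp01[measurable]: "clamp01 \<in> borel_measurable borel"
  unfolding clamp01_def[abs_def] by measurable

lemma measurable_ptime[measurable]: "(\<lambda>\<omega>. ptime \<omega> e) \<in> borel_measurable (pt_space rate)"
  unfolding ptime_def
  by (intro borel_measurable_add borel_measurable_const measurable_compose[OF measurable_coord measurable_clamp01])

lemma measurable_pproc[measurable]: "pproc \<alpha> t \<in> borel_measurable (pt_space rate)"
proof -
  obtain N where N: "t \<le> real N" using real_arch_simple by blast
  have "(\<lambda>\<omega>. \<Sum>i<cnt \<omega> b. indicator {..t} (ptime \<omega> (b, i)) *\<^sub>R jvec \<alpha> b) \<in> borel_measurable (pt_space rate)" for b
    by (rule measurable_compose_countable[where f="\<lambda>k \<omega>. \<Sum>i<k. indicator {..t} (ptime \<omega> (b, i)) *\<^sub>R jvec \<alpha> b"]) measurable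
  then show ?thesis unfolding pproc_eq[OF N, abs_def] by measurable
qed

section \<open>Characteristic functional of the point configuration\<close>

abbreviation unif :: "real measure" where "unif \<equiv> uniform_measure lborel {0<..1}"

lemma cmod_prod_le_1:
  fixes f :: "'a \<Rightarrow> complex"
  assumes "\<And>i. i \<in> A \<Longrightarrow> norm (f i) \<le> 1"
  shows "norm (prod f A) \<le> 1"
  using assms by (simp add: prod_norm[symmetric] prod_le_1)

text \<open>Functional of a Poisson cloud of independent points. On the event that the count is
  \<open>k\<close> just \<open>k + 1\<close> independent coordinates are involved, which gives a
  Poisson probability times the k-th power of the mean of \<open>g\<close>; the sum over
  \<open>k\<close> is an exponential.\<close>

lemma expectation_block:
  fixes g :: "real \<Rightarrow> complex"
  assumes rate: "\<And>j. 0 < rate j" and g[measurable]: "g \<in> borel_measurable borel" and g1: "\<And>u. norm (g u) \<le> 1"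
  shows "(CLINT \<omega>|pt_space rate. (\<Prod>i<cnt \<omega> b. g (\<omega> (prod_encode (b, Suc i))))) =
           exp (of_real (rate (b mod 3)) * ((CLINT u|unif. g u) - 1))"
proof -
  interpret prob_space "pt_space rate" by (rule prob_space_pt_space)
  let ?l = "rate (b mod 3)" and ?G = "CLINT u|unif. g u"
  define S where "S k \<omega> = (if cnt \<omega> b = k then \<Prod>i<k. g (\<omega> (prod_encode (b, Suc i))) else 0)" for k \<omega>
  have S[measurable]: "S k \<in> borel_measurable (pt_space rate)" for k
  proof -
    have [measurable]: "(\<lambda>\<omega>. \<Prod>i<k. g (\<omega> (prod_encode (b, Suc i)))) \<in> borel_measurable (pt_space rate)"
      by (intro borel_measurable_prod measurable_compose[OF measurable_coord g])
    show ?thesis unfolding S_def[abs_def] by measurable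
  qed
  have nS: "norm (S k \<omega>) \<le> (if cnt \<omega> b = k then 1 else 0)" for k \<omega>
    unfolding S_def using g1 by (simp add: cmod_prod_le_1)
  have iS: "integrable (pt_space rate) (S k)" for k
    by (rule integrable_const_bound[where B=1], rule AE_I2, rule order_trans[OF nS]) auto
  have E: "expectation (S k) = of_real (?l ^ k / fact k * exp (- ?l)) * ?G ^ k" for k
  proof -
    \<comment> \<open>One family for all coordinates of the block: the count coordinate is tested
      for the value \<open>k\<close>, every position coordinate is fed into
      \<open>g\<close>.\<close>
    define h where "h n = (\<lambda>x::real. if snd (prod_decode n) = 0 then (if nat \<lfloor>x\<rfloor> = k then 1 else 0) else g x)" for n
    let ?I = "(\<lambda>i. prod_encode (b, i)) ` {..k}"
    have hm: "h n \<in> borel_measurable borel" for n unfolding h_def by measurable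
    have h1: "norm (h n x) \<le> 1" for n x using g1 by (auto simp: h_def)
    have inj: "inj_on (\<lambda>i. prod_encode (b, i)) {..k}" by (auto simp: inj_on_def)
    have "S k \<omega> = (\<Prod>n\<in>?I. h n (\<omega> n))" for \<omega>
      unfolding prod.reindex[OF inj] by (simp add: S_def h_def cnt_def prod.atMost_shift)
    then have "expectation (S k) = (CLINT \<omega>|pt_space rate. \<Prod>n\<in>?I. h n (\<omega> n))" by presburger
    also have "\<dots> = (\<Prod>n\<in>?I. CLINT \<omega>|pt_space rate. h n (\<omega> n))"
    proof (rule indep_vars_lebesgue_integral)
      show "indep_vars (\<lambda>_. borel) (\<lambda>n \<omega>. h n (\<omega> n)) ?I"
        by (rule indep_vars_compose2[OF indep_vars_subset[OF indep_coords]]) (auto intro: hm)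
      show "integrable (pt_space rate) (\<lambda>\<omega>. h n (\<omega> n))" for n
        by (rule integrable_const_bound[where B=1]) (use h1 measurable_compose[OF measurable_coord hm] in auto)
    qed simp
    also have "\<dots> = (\<Prod>n\<in>?I. CLINT x|pt_dist rate n. h n x)"
      by (intro prod.cong refl) (simp only: integral_distr[OF measurable_coord hm] flip: distr_coord)
    also have "\<dots> = (CLINT x|pt_dist rate (prod_encode (b, 0)). h (prod_encode (b, 0)) x) * ?G ^ k"
      unfolding prod.reindex[OF inj] by (simp add: prod.atMost_shift pt_dist_def h_def)
    finally have *: "expectation (S k) = (CLINT x|pt_dist rate (prod_encode (b, 0)). h (prod_encode (b, 0)) x) * ?G ^ k" .
    have i: "indicat_real {k} = (\<lambda>n. if n = k then 1 else 0)" by (auto simp: indicator_def)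
    have "(CLINT x|pt_dist rate (prod_encode (b, 0)). h (prod_encode (b, 0)) x) =
       (CLINT x|distr (measure_pmf (poisson_pmf ?l)) borel real. complex_of_real (if nat \<lfloor>x\<rfloor> = k then 1 else 0))"
      by (rule Bochner_Integration.integral_cong) (simp_all add: pt_dist_def h_def)
    also have "\<dots> = of_real (LINT x|distr (measure_pmf (poisson_pmf ?l)) borel real. (if nat \<lfloor>x\<rfloor> = k then 1 else 0))"
      by (rule integral_complex_of_real)
    also have "(LINT x|distr (measure_pmf (poisson_pmf ?l)) borel real. (if nat \<lfloor>x\<rfloor> = k then 1 else 0)) =
       (LINT n|measure_pmf (poisson_pmf ?l). indicat_real {k} n)"
      unfolding i by (subst integral_distr) simp_all
    also have "\<dots> = measure (measure_pmf (poisson_pmf ?l)) {k}" by simp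
    also have "\<dots> = of_real (?l ^ k / fact k * exp (- ?l))"
      using rate[of "b mod 3"] by (simp add: measure_pmf_single)
    finally show ?thesis using * by simp
  qed
  have "(\<lambda>n. expectation (\<lambda>\<omega>. \<Sum>k<n. S k \<omega>)) \<longlonglongrightarrow>
     expectation (\<lambda>\<omega>. \<Prod>i<cnt \<omega> b. g (\<omega> (prod_encode (b, Suc i))))"
  proof (rule integral_dominated_convergence[where w="\<lambda>_. 1"])
    \<comment> \<open>At most one summand is nonzero, so a partial sum is the full product or 0;
      convergence and the bound 1 both follow.\<close>
    have s: "(\<Sum>k<n. S k \<omega>) = (if cnt \<omega> b < n then \<Prod>i<cnt \<omega> b. g (\<omega> (prod_encode (b, Suc i))) else 0)" for n \<omega>
      by (simp add: S_def)
    show "AE \<omega> in pt_space rate. (\<lambda>n. \<Sum>k<n. S k \<omega>) \<longlonglongrightarrow> (\<Prod>i<cnt \<omega> b. g (\<omega> (prod_encode (b, Suc i))))"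
    proof (rule AE_I2, rule tendsto_eventually)
      fix \<omega>
      show "eventually (\<lambda>n. (\<Sum>k<n. S k \<omega>) = (\<Prod>i<cnt \<omega> b. g (\<omega> (prod_encode (b, Suc i))))) sequentially"
        using eventually_gt_at_top[of "cnt \<omega> b"] unfolding s by eventually_elim simp
    qed
    show "AE \<omega> in pt_space rate. norm (\<Sum>k<n. S k \<omega>) \<le> 1" for n
      unfolding s by (rule AE_I2) (simp add: cmod_prod_le_1 g1)
    show "(\<lambda>\<omega>. \<Prod>i<cnt \<omega> b. g (\<omega> (prod_encode (b, Suc i)))) \<in> borel_measurable (pt_space rate)"
    proof (rule measurable_compose_countable[where f="\<lambda>k \<omega>. \<Prod>i<k. g (\<omega> (prod_encode (b, Suc i)))"])
      show "(\<lambda>\<omega>. \<Prod>i<k. g (\<omega> (prod_encode (b, Suc i)))) \<in> borel_measurable (pt_space rate)" for k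
        by (intro borel_measurable_prod measurable_compose[OF measurable_coord g])
    qed (rule measurable_cnt)
    show "(\<lambda>\<omega>. \<Sum>k<n. S k \<omega>) \<in> borel_measurable (pt_space rate)" for n
      by (intro borel_measurable_sum S)
    show "integrable (pt_space rate) (\<lambda>_. 1::real)" by simp
  qed
  then have s1: "(\<lambda>k. expectation (S k)) sums expectation (\<lambda>\<omega>. \<Prod>i<cnt \<omega> b. g (\<omega> (prod_encode (b, Suc i))))"
    unfolding sums_def by (simp add: iS)
  have s2: "(\<lambda>k. exp (- of_real ?l) * ((of_real ?l * ?G) ^ k /\<^sub>R fact k)) sums (exp (- of_real ?l) * exp (of_real ?l * ?G))"
    by (intro sums_mult exp_converges)
  have "exp (- of_real ?l) * ((of_real ?l * ?G) ^ k /\<^sub>R fact k) = expectation (S k)" for k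
    unfolding E by (simp add: scaleR_conv_of_real power_mult_distrib divide_inverse mult_ac flip: exp_of_real)
  with s2 have "(\<lambda>k. expectation (S k)) sums (exp (- of_real ?l) * exp (of_real ?l * ?G))" by simp
  from sums_unique2[OF s1 this]
  have "expectation (\<lambda>\<omega>. \<Prod>i<cnt \<omega> b. g (\<omega> (prod_encode (b, Suc i)))) = exp (- of_real ?l) * exp (of_real ?l * ?G)" .
  then show ?thesis by (simp add: algebra_simps flip: exp_add)
qed

text \<open>Different blocks read disjoint sets of coordinates, hence are independent.\<close>

lemma expectation_blocks:
  fixes g :: "nat \<Rightarrow> real \<Rightarrow> complex"
  assumes rate: "\<And>j. 0 < rate j" and g[measurable]: "\<And>b. g b \<in> borel_measurable borel" and g1: "\<And>b u. norm (g b u) \<le> 1"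
  shows "(CLINT \<omega>|pt_space rate. (\<Prod>b<B. \<Prod>i<cnt \<omega> b. g b (\<omega> (prod_encode (b, Suc i))))) =
           (\<Prod>b<B. exp (of_real (rate (b mod 3)) * ((CLINT u|unif. g b u) - 1)))"
proof -
  interpret prob_space "pt_space rate" by (rule prob_space_pt_space)
  let ?K = "\<lambda>b. range (\<lambda>i. prod_encode (b, i))"
  let ?Y = "\<lambda>b \<omega>. \<Prod>i<cnt \<omega> b. g b (\<omega> (prod_encode (b, Suc i)))"
  have ind: "indep_vars (\<lambda>b. PiM (?K b) (\<lambda>_. borel)) (\<lambda>b \<omega>. restrict (\<lambda>n. \<omega> n) (?K b)) {..<B}"
    by (rule indep_vars_restrict[OF indep_coords]) (auto simp: disjoint_family_on_def)
  have Ym: "?Y b \<in> borel_measurable (PiM (?K b) (\<lambda>_. borel))" for b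
  proof -
    have [measurable]: "(\<lambda>\<omega>. \<omega> (prod_encode (b, i))) \<in> borel_measurable (PiM (?K b) (\<lambda>_. borel))" for i
      by (rule measurable_component_singleton) auto
    show ?thesis
      by (rule measurable_compose_countable[where f="\<lambda>k \<omega>. \<Prod>i<k. g b (\<omega> (prod_encode (b, Suc i)))"])
        (simp_all add: cnt_def)
  qed
  have ind': "indep_vars (\<lambda>_. borel) (\<lambda>b \<omega>. ?Y b (restrict (\<lambda>n. \<omega> n) (?K b))) {..<B}"
    by (rule indep_vars_compose2[OF ind Ym])
  have r: "?Y b (restrict (\<lambda>n. \<omega> n) (?K b)) = ?Y b \<omega>" for b \<omega> by (simp add: cnt_def)
  have ind'': "indep_vars (\<lambda>_. borel) ?Y {..<B}" using ind' unfolding r .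
  have "(CLINT \<omega>|pt_space rate. (\<Prod>b<B. ?Y b \<omega>)) = (\<Prod>b<B. CLINT \<omega>|pt_space rate. ?Y b \<omega>)"
  proof (rule indep_vars_lebesgue_integral[OF _ ind''])
    fix b assume "b \<in> {..<B}"
    then have "?Y b \<in> borel_measurable (pt_space rate)" using ind'' by (simp add: indep_vars_def)
    then show "integrable (pt_space rate) (?Y b)"
      by (intro integrable_const_bound[where B=1] AE_I2 cmod_prod_le_1 g1)
  qed simp
  then show ?thesis using expectation_block[OF rate g g1] by simp
qed

text \<open>Length of the part of (s, t] inside (m, m + 1]. The differences of minima are what makes
  the sum over m telescope in \<open>char_increments\<close>.\<close>

lemma measure_unif_shift:
  assumes "s \<le> t"
  shows "measure unif {u. s < m + clamp01 u \<and> m + clamp01 u \<le> t} = (min t (m + 1) - min t m) - (min s (m + 1) - min s m)"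
proof -
  have m: "{u. s < m + clamp01 u \<and> m + clamp01 u \<le> t} \<in> sets borel" by measurable
  have e: "{0<..1} \<inter> {u. s < m + clamp01 u \<and> m + clamp01 u \<le> t} = {max 0 (s - m)<..min 1 (t - m)}"
    by (auto simp: clamp01_def)
  have "measure unif {u. s < m + clamp01 u \<and> m + clamp01 u \<le> t} = measure lborel {max 0 (s - m)<..min 1 (t - m)}"
    using m by (subst measure_uniform_measure) (auto simp: e)
  also have "\<dots> = (min t (m + 1) - min t m) - (min s (m + 1) - min s m)"
  proof (cases "max 0 (s - m) \<le> min 1 (t - m)")
    case True
    then have "measure lborel {max 0 (s - m)<..min 1 (t - m)} = min 1 (t - m) - max 0 (s - m)" by simp
    then show ?thesis using assms True by linarith
  next
    case False
    then have "{max 0 (s - m)<..min 1 (t - m)} = {}" by (intro greaterThanAtMost_empty) linarith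
    then have "measure lborel {max 0 (s - m)<..min 1 (t - m)} = 0" by (simp only: measure_empty)
    then show ?thesis using assms False by linarith
  qed
  finally show ?thesis .
qed

lemma sum_mod3: "(\<Sum>b<3 * N. f (b mod 3) (b div 3)) = (\<Sum>m<N. \<Sum>j<3. f j m)" for f :: "nat \<Rightarrow> nat \<Rightarrow> 'a::comm_monoid_add"
proof (induction N)
  case (Suc N)
  have "(\<Sum>b<3 * Suc N. f (b mod 3) (b div 3)) = (\<Sum>b<Suc (Suc (Suc (3 * N))). f (b mod 3) (b div 3))"
    by (rule arg_cong[where f="\<lambda>n. \<Sum>b<n. f (b mod 3) (b div 3)"]) simp
  also have "\<dots> = (\<Sum>m<Suc N. \<Sum>j<3. f j m)"
  proof -
    have e: "3 * N mod 3 = 0" "3 * N div 3 = N" "Suc (3 * N) mod 3 = 1" "Suc (3 * N) div 3 = N" "Suc (Suc (3 * N)) mod 3 = 2" "Suc (Suc (3 * N)) div 3 = N"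
      by presburger+
    have "(\<Sum>b<Suc (Suc (Suc (3 * N))). f (b mod 3) (b div 3)) = (\<Sum>b<3 * N. f (b mod 3) (b div 3)) + f 0 N + f 1 N + f 2 N"
      by (simp only: sum.lessThan_Suc e)
    also have "\<dots> = (\<Sum>m<Suc N. \<Sum>j<3. f j m)"
    proof -
      have "{..<3::nat} = {0, 1, 2}" by auto
      then show ?thesis using Suc by (simp add: add.assoc)
    qed
    finally show ?thesis .
  qed
  finally show ?case .
qed simp

lemma jvec_mod: "jvec \<alpha> (b mod 3) = jvec \<alpha> b" by (simp add: jvec_def)

text \<open>All increments are treated at once, so that both independence and stationarity can be
  read off. A point falls into at most one of the disjoint intervals, so its contribution to the
  exponent splits additively, with the overlap lengths as factors.\<close>

theorem char_increments:
  assumes rate: "\<And>j. 0 < rate j" and t: "0 \<le> t 0" "mono t"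
  shows "(CLINT \<omega>|pt_space rate. iexp (\<Sum>l<n. z1 l * fst (pproc \<alpha> (t (Suc l)) \<omega> - pproc \<alpha> (t l) \<omega>) +
              z2 l * snd (pproc \<alpha> (t (Suc l)) \<omega> - pproc \<alpha> (t l) \<omega>))) =
         (\<Prod>l<n. exp (of_real (t (Suc l) - t l) *
            (\<Sum>j<3. of_real (rate j) * (iexp (z1 l * fst (jvec \<alpha> j) + z2 l * snd (jvec \<alpha> j)) - 1))))"
proof -
  obtain N where N: "t n \<le> real N" using real_arch_simple by blast
  define a where "a l b = z1 l * fst (jvec \<alpha> b) + z2 l * snd (jvec \<alpha> b)" for l b
  define I :: "nat \<Rightarrow> nat \<Rightarrow> real \<Rightarrow> real" where "I l m u = indicator {t l<..t (Suc l)} (real m + clamp01 u)" for l m u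
  define h where "h b u = (\<Sum>l<n. a l b * I l (b div 3) u)" for b u
  have tl: "t l \<le> t (Suc l)" for l using t(2) by (simp add: monoD)
  have tN: "t (Suc l) \<le> real N" if "l < n" for l
    using N monoD[OF t(2), of "Suc l" n] that by simp
  have Im[measurable]: "I l m \<in> borel_measurable borel" for l m
    unfolding I_def by measurable
  have hm[measurable]: "h b \<in> borel_measurable borel" for b
    unfolding h_def by measurable
  have inc: "(\<Sum>l<n. z1 l * fst (pproc \<alpha> (t (Suc l)) \<omega> - pproc \<alpha> (t l) \<omega>) + z2 l * snd (pproc \<alpha> (t (Suc l)) \<omega> - pproc \<alpha> (t l) \<omega>))
      = (\<Sum>b<3 * N. \<Sum>i<cnt \<omega> b. h b (\<omega> (prod_encode (b, Suc i))))" for \<omega>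
  proof -
    have "(\<Sum>l<n. z1 l * fst (pproc \<alpha> (t (Suc l)) \<omega> - pproc \<alpha> (t l) \<omega>) + z2 l * snd (pproc \<alpha> (t (Suc l)) \<omega> - pproc \<alpha> (t l) \<omega>))
       = (\<Sum>l<n. \<Sum>b<3 * N. \<Sum>i<cnt \<omega> b. a l b * I l (b div 3) (\<omega> (prod_encode (b, Suc i))))"
    proof (rule sum.cong[OF refl])
      fix l assume "l \<in> {..<n}"
      then have d: "pproc \<alpha> (t (Suc l)) \<omega> - pproc \<alpha> (t l) \<omega> =
         (\<Sum>b<3 * N. \<Sum>i<cnt \<omega> b. I l (b div 3) (\<omega> (prod_encode (b, Suc i))) *\<^sub>R jvec \<alpha> b)"
        using pproc_diff[OF tl tN, of l] by (simp add: I_def ptime_def)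
      show "z1 l * fst (pproc \<alpha> (t (Suc l)) \<omega> - pproc \<alpha> (t l) \<omega>) + z2 l * snd (pproc \<alpha> (t (Suc l)) \<omega> - pproc \<alpha> (t l) \<omega>)
         = (\<Sum>b<3 * N. \<Sum>i<cnt \<omega> b. a l b * I l (b div 3) (\<omega> (prod_encode (b, Suc i))))"
        unfolding d a_def
        by (simp add: fst_sum snd_sum sum_distrib_left algebra_simps flip: sum.distrib)
    qed
    also have "\<dots> = (\<Sum>b<3 * N. \<Sum>i<cnt \<omega> b. h b (\<omega> (prod_encode (b, Suc i))))"
      unfolding h_def by (subst sum.swap) (intro sum.cong refl sum.swap)
    finally show ?thesis .
  qed
  \<comment> \<open>At most one indicator is nonzero because \<open>t\<close> is monotone; this
    turns an exponential of a sum over intervals into a sum over intervals.\<close>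
  have pw: "iexp (h b u) - 1 = (\<Sum>l<n. (iexp (a l b) - 1) * of_real (I l (b div 3) u))" for b u
  proof (cases "\<exists>l<n. I l (b div 3) u \<noteq> 0")
    case True
    then obtain l where l: "l < n" "I l (b div 3) u \<noteq> 0" by blast
    have o: "I l' (b div 3) u = (if l' = l then 1 else 0)" for l'
    proof -
      have "\<not> (t l' < x \<and> x \<le> t (Suc l'))" if "l' \<noteq> l" "t l < x" "x \<le> t (Suc l)" for x
      proof (cases "l' < l")
        case True
        then have "t (Suc l') \<le> t l" using t(2) by (simp add: monoD)
        with that show ?thesis by linarith
      next
        case False
        then have "t (Suc l) \<le> t l'" using t(2) that by (simp add: monoD)
        with that show ?thesis by linarith
      qed
      with l(2) show ?thesis by (auto simp: I_def indicator_def split: if_splits)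
    qed
    show ?thesis using l(1) by (simp add: h_def o if_distrib cong: if_cong)
  next
    case False
    then show ?thesis by (simp add: h_def)
  qed
  interpret U: prob_space unif by (intro prob_space_uniform_measure) auto
  have iI: "(CLINT u|unif. of_real (I l m u)) = complex_of_real (measure unif {u. t l < real m + clamp01 u \<and> real m + clamp01 u \<le> t (Suc l)})" for l m
  proof -
    let ?A = "{u. t l < real m + clamp01 u \<and> real m + clamp01 u \<le> t (Suc l)}"
    have "I l m = indicator ?A" by (auto simp: I_def indicator_def)
    moreover have "?A \<in> sets unif" by simp
    ultimately have "(LINT u|unif. I l m u) = measure unif ?A"
      by (simp add: integral_indicator del: measure_uniform_measure)
    then show ?thesis by simp
  qed
  define len where "len l m = measure unif {u. t l < real m + clamp01 u \<and> real m + clamp01 u \<le> t (Suc l)}" for l m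
  have intI: "integrable unif (\<lambda>u. complex_of_real (I l m u))" for l m
  proof (rule U.integrable_const_bound[where B=1])
    show "AE u in unif. norm (complex_of_real (I l m u)) \<le> 1" by (auto simp: I_def indicator_def)
  qed measurable
  have inth: "(CLINT u|unif. iexp (h b u)) - 1 = (\<Sum>l<n. (iexp (a l b) - 1) * of_real (len l (b div 3)))" for b
  proof -
    have "(CLINT u|unif. iexp (h b u)) - 1 = (CLINT u|unif. iexp (h b u) - 1)"
      by (subst Bochner_Integration.integral_diff) (auto simp: U.prob_space intro: U.integrable_iexp)
    also have "\<dots> = (\<Sum>l<n. (iexp (a l b) - 1) * of_real (len l (b div 3)))"
      unfolding pw
      by (rule trans[OF Bochner_Integration.integral_sum], intro integrable_mult_right intI,
          simp only: integral_mult_right_zero iI len_def)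
    finally show ?thesis .
  qed
  have lens: "(\<Sum>m<N. len l m) = t (Suc l) - t l" if l: "l < n" for l
  proof -
    have t0: "0 \<le> t i" for i using monoD[OF t(2), of 0 i] t(1) by simp
    have "(\<Sum>m<N. len l m) = (\<Sum>m<N. (min (t (Suc l)) (real (Suc m)) - min (t l) (real (Suc m))) - (min (t (Suc l)) (real m) - min (t l) (real m)))"
      unfolding len_def measure_unif_shift[OF tl] by (intro sum.cong) (auto simp: algebra_simps)
    also have "\<dots> = t (Suc l) - t l"
      using tN[OF l] tl[of l] t0[of l] t0[of "Suc l"] by (subst sum_lessThan_telescope) (auto simp: min_def)
    finally show ?thesis .
  qed
  have "(CLINT \<omega>|pt_space rate. iexp (\<Sum>l<n. z1 l * fst (pproc \<alpha> (t (Suc l)) \<omega> - pproc \<alpha> (t l) \<omega>) +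
              z2 l * snd (pproc \<alpha> (t (Suc l)) \<omega> - pproc \<alpha> (t l) \<omega>))) =
     (CLINT \<omega>|pt_space rate. (\<Prod>b<3 * N. \<Prod>i<cnt \<omega> b. iexp (h b (\<omega> (prod_encode (b, Suc i))))))"
    unfolding inc by (simp add: sum_distrib_left exp_sum)
  also have "\<dots> = (\<Prod>b<3 * N. exp (of_real (rate (b mod 3)) * ((CLINT u|unif. iexp (h b u)) - 1)))"
    by (rule expectation_blocks[OF rate]) auto
  also have "\<dots> = exp (\<Sum>b<3 * N. of_real (rate (b mod 3)) * (\<Sum>l<n. (iexp (a l (b mod 3)) - 1) * of_real (len l (b div 3))))"
    unfolding inth by (simp add: exp_sum a_def jvec_mod)
  also have "(\<Sum>b<3 * N. of_real (rate (b mod 3)) * (\<Sum>l<n. (iexp (a l (b mod 3)) - 1) * of_real (len l (b div 3)))) =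
     (\<Sum>m<N. \<Sum>j<3. of_real (rate j) * (\<Sum>l<n. (iexp (a l j) - 1) * of_real (len l m)))"
    by (rule sum_mod3)
  also have "\<dots> = (\<Sum>j<3. \<Sum>l<n. \<Sum>m<N. of_real (rate j) * ((iexp (a l j) - 1) * of_real (len l m)))"
    unfolding sum_distrib_left by (subst sum.swap) (intro sum.cong refl sum.swap)
  also have "\<dots> = (\<Sum>l<n. \<Sum>j<3. \<Sum>m<N. of_real (rate j) * ((iexp (a l j) - 1) * of_real (len l m)))"
    by (rule sum.swap)
  also have "\<dots> = (\<Sum>l<n. of_real (t (Suc l) - t l) * (\<Sum>j<3. of_real (rate j) * (iexp (a l j) - 1)))"
  proof (intro sum.cong refl)
    fix l assume "l \<in> {..<n}"
    then have "(\<Sum>m<N. complex_of_real (len l m)) = of_real (t (Suc l) - t l)" using lens[of l] by (simp flip: of_real_sum)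
    moreover have "(\<Sum>j<3. \<Sum>m<N. complex_of_real (rate j) * ((iexp (a l j) - 1) * of_real (len l m))) =
       (\<Sum>m<N. complex_of_real (len l m)) * (\<Sum>j<3. of_real (rate j) * (iexp (a l j) - 1))"
      unfolding sum_distrib_left sum_distrib_right by (intro sum.cong refl) (simp add: mult_ac)
    ultimately show "(\<Sum>j<3. \<Sum>m<N. complex_of_real (rate j) * ((iexp (a l j) - 1) * of_real (len l m))) =
       of_real (t (Suc l) - t l) * (\<Sum>j<3. of_real (rate j) * (iexp (a l j) - 1))" by simp
  qed
  finally show ?thesis unfolding a_def by (simp add: exp_sum)
qed

section \<open>Laws of the increments\<close>

lemma measurable_fst_snd[measurable]:
  "(fst :: real \<times> real \<Rightarrow> real) \<in> borel_measurable borel" "(snd :: real \<times> real \<Rightarrow> real) \<in> borel_measurable borel"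
  by (auto intro!: borel_measurable_continuous_onI continuous_intros)

lemma fst_snd_separate:
  "(\<And>i. i \<in> (UNIV :: bool set) \<Longrightarrow> (if i then fst else snd) x = (if i then fst else snd) y) \<Longrightarrow> x = (y :: 'a \<times> 'a)"
  by (metis (full_types) UNIV_I prod_eq_iff)

text \<open>Nothing is known beforehand about the values of \<open>X\<close>. One-dimensional
  uniqueness identifies its marginals, which puts \<open>X\<close> almost surely into the countable
  product of the marginal supports of \<open>D\<close>; there the uniqueness on countable sets
  applies.\<close>

lemma distr_pair_eq_pmfI:
  fixes X :: "'a \<Rightarrow> real \<times> real" and D :: "(real \<times> real) pmf"
  assumes M: "prob_space M" and X[measurable]: "X \<in> borel_measurable M"
    and ch: "\<And>z1 z2. (CLINT \<omega>|M. iexp (z1 * fst (X \<omega>) + z2 * snd (X \<omega>))) =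
                      (CLINT x|D. iexp (z1 * fst x + z2 * snd x))"
  shows "distr M borel X = distr (measure_pmf D) borel (\<lambda>x. x)"
proof -
  interpret prob_space M by fact
  have marg: "AE \<omega> in M. f (X \<omega>) \<in> f ` set_pmf D"
    if f: "f = fst \<or> f = snd" for f :: "real \<times> real \<Rightarrow> real"
  proof -
    have [measurable]: "f \<in> borel_measurable borel"
      using f borel_measurable_continuous_onI[of fst] borel_measurable_continuous_onI[of snd]
      by (auto intro!: borel_measurable_continuous_onI continuous_intros)
    have "char (distr M borel (\<lambda>\<omega>. f (X \<omega>))) = char (distr (measure_pmf D) borel f)"
    proof
      fix t
      show "char (distr M borel (\<lambda>\<omega>. f (X \<omega>))) t = char (distr (measure_pmf D) borel f) t"
        using f ch[of t 0] ch[of 0 t] by (auto simp: char_def integral_distr)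
    qed
    then have eq: "distr M borel (\<lambda>\<omega>. f (X \<omega>)) = distr (measure_pmf D) borel f"
      by (intro Levy_uniqueness real_distribution_distr prob_space.real_distribution_distr[OF prob_space_measure_pmf]) auto
    have b: "f ` set_pmf D \<in> sets borel"
      by (rule sets.countable) auto
    have "AE x in distr (measure_pmf D) borel f. x \<in> f ` set_pmf D"
      using b by (subst AE_distr_iff) (auto simp: AE_measure_pmf_iff)
    then have "AE x in distr M borel (\<lambda>\<omega>. f (X \<omega>)). x \<in> f ` set_pmf D" unfolding eq .
    then show ?thesis using b by (subst (asm) AE_distr_iff) auto
  qed
  let ?C = "fst ` set_pmf D \<times> snd ` set_pmf D"
  have C: "countable ?C" by auto
  then have Cb: "?C \<in> sets borel" by (rule sets.countable[rotated]) auto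
  have fs[measurable]: "(fst :: real \<times> real \<Rightarrow> real) \<in> borel_measurable borel" "(snd :: real \<times> real \<Rightarrow> real) \<in> borel_measurable borel"
    by (auto intro!: borel_measurable_continuous_onI continuous_intros)
  show ?thesis
  proof (rule measure_eqI_countable_char[where C="?C" and I="UNIV :: bool set" and \<phi>="\<lambda>b. if b then fst else snd"])
    show "prob_space (distr M borel X)" by (rule prob_space_distr) simp
    show "prob_space (distr (measure_pmf D) borel (\<lambda>x. x))" by (rule measure_pmf.prob_space_distr) simp
    show "AE x in distr M borel X. x \<in> ?C"
    proof -
      have "AE \<omega> in M. X \<omega> \<in> ?C" using marg[of fst] marg[of snd] by (simp add: mem_Times_iff)
      then show ?thesis using Cb by (subst AE_distr_iff) auto
    qed
    show "AE x in distr (measure_pmf D) borel (\<lambda>x. x). x \<in> ?C"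
      using Cb by (subst AE_distr_iff) (auto simp: AE_measure_pmf_iff intro!: image_eqI)
    show "(CLINT x|distr M borel X. iexp (\<Sum>i\<in>UNIV. z i * (if i then fst else snd) x)) =
         (CLINT x|distr (measure_pmf D) borel (\<lambda>x. x). iexp (\<Sum>i\<in>UNIV. z i * (if i then fst else snd) x))" for z
      using ch[of "z True" "z False"] by (simp add: integral_distr UNIV_bool add.commute)
    show "x = y" if "\<And>i. i \<in> (UNIV :: bool set) \<Longrightarrow> (if i then fst else snd) x = (if i then fst else snd) y" for x y :: "real \<times> real"
      using that by (rule fst_snd_separate)
  qed (use C in auto)
qed

definition jump_pmf :: "real \<Rightarrow> real \<Rightarrow> real \<Rightarrow> real \<Rightarrow> (real \<times> real) pmf" where
  "jump_pmf \<alpha> p q r = pmf_of_list [((1, 0), p), ((0, 1), q), ((1, \<alpha>), r)]"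

context
  fixes \<alpha> p q r :: real
  assumes pqr: "0 \<le> p" "0 \<le> q" "0 \<le> r" "p + q + r = 1" and \<alpha>: "\<alpha> \<noteq> 0"
begin

lemma jump_pmf_wf: "pmf_of_list_wf [((1, 0::real), p), ((0::real, 1), q), ((1, \<alpha>), r)]"
  using pqr by (intro pmf_of_list_wfI) auto

lemma set_jump_pmf: "set_pmf (jump_pmf \<alpha> p q r) \<subseteq> {(1, 0), (0, 1), (1, \<alpha>)}"
  using set_pmf_of_list[OF jump_pmf_wf] unfolding jump_pmf_def by auto

lemma pmf_jump_pmf:
  "pmf (jump_pmf \<alpha> p q r) (1, 0) = p" "pmf (jump_pmf \<alpha> p q r) (0, 1) = q" "pmf (jump_pmf \<alpha> p q r) (1, \<alpha>) = r"
  using \<alpha> by (simp_all add: jump_pmf_def pmf_pmf_of_list[OF jump_pmf_wf])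

lemma expectation_jump_pmf:
  fixes f :: "real \<times> real \<Rightarrow> complex"
  shows "measure_pmf.expectation (jump_pmf \<alpha> p q r) f = of_real p * f (1, 0) + of_real q * f (0, 1) + of_real r * f (1, \<alpha>)"
  using set_jump_pmf \<alpha>
  by (subst integral_measure_pmf[of "{(1, 0), (0, 1), (1, \<alpha>)}"])
     (auto simp: pmf_jump_pmf scaleR_conv_of_real)

lemma nn_integral_jump_pmf:
  fixes f :: "real \<times> real \<Rightarrow> ennreal"
  shows "(\<integral>\<^sup>+x. f x \<partial>jump_pmf \<alpha> p q r) = ennreal p * f (1, 0) + ennreal q * f (0, 1) + ennreal r * f (1, \<alpha>)"
proof -
  have "(\<integral>\<^sup>+x. f x \<partial>jump_pmf \<alpha> p q r) = (\<Sum>x\<in>{(1, 0), (0, 1), (1, \<alpha>)}. f x * ennreal (pmf (jump_pmf \<alpha> p q r) x))"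
    using set_jump_pmf by (intro nn_integral_measure_pmf_support) (auto simp: set_pmf_iff)
  then show ?thesis using \<alpha> by (simp add: pmf_jump_pmf mult.commute add.assoc)
qed

end

lemma biv_levy_integral:
  assumes c: "0 < c" and u: "0 \<le> u" "0 \<le> v" "0 \<le> w"
  shows "(CLINT x|biv_levy_measure k c u v w. iexp (z1 * fst x + z2 * snd x) - 1) =
     of_real u * (iexp z1 - 1) + of_real v * (iexp z2 - 1) + of_real w * (iexp (z1 + z2 * c powi (- k)) - 1)"
proof -
  define a where "a = c powi (- k)"
  \<comment> \<open>Keeps the points (1, 0) and (1, a) apart, so that their masses are not
    merged.\<close>
  have n: "a \<noteq> 0" using c by (simp add: a_def)
  let ?A = "{(1, 0), (0, 1), (1, a)} :: (real \<times> real) set"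
  let ?f = "\<lambda>x::real \<times> real. if x = (1, 0) then u else if x = (0, 1) then v else w"
  have m: "(\<lambda>x::real \<times> real. iexp (z1 * fst x + z2 * snd x) - 1) \<in> borel_measurable borel"
    by (intro borel_measurable_continuous_onI continuous_intros)
  have "(CLINT x|biv_levy_measure k c u v w. iexp (z1 * fst x + z2 * snd x) - 1) =
     (CLINT x|point_measure ?A ?f. iexp (z1 * fst x + z2 * snd x) - 1)"
    unfolding biv_levy_measure_def a_def[symmetric] by (subst integral_distr[OF _ m]) (auto simp: measurable_def space_point_measure sets_point_measure)
  also have "\<dots> = (\<Sum>x\<in>?A. ?f x *\<^sub>R (iexp (z1 * fst x + z2 * snd x) - 1))"
    using u by (intro lebesgue_integral_point_measure_finite) auto
  also have "\<dots> = of_real u * (iexp z1 - 1) + of_real v * (iexp z2 - 1) + of_real w * (iexp (z1 + z2 * a) - 1)"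
    using n by (simp add: scaleR_conv_of_real)
  finally show ?thesis by (simp only: a_def)
qed

text \<open>Splits the exponent with masses \<open>u\<close>, \<open>v\<close>, \<open>w\<close>
  into a total rate \<open>s\<close> and a normalized jump law, so that the increments of the
  process become laws of the form \<open>cpois\<close>.\<close>

lemma cpois_char_eq:
  assumes l: "0 < h" and u: "0 \<le> u" "0 \<le> v" "0 \<le> w" "0 < u + v + w" and \<alpha>: "\<alpha> \<noteq> 0"
  defines "s \<equiv> u + v + w"
  shows "(CLINT x|cpois (s * h) (jump_pmf \<alpha> (u / s) (v / s) (w / s)). iexp (z1 * fst x + z2 * snd x)) =
     exp (of_real h * (of_real u * (iexp z1 - 1) + of_real v * (iexp z2 - 1) + of_real w * (iexp (z1 + z2 * \<alpha>) - 1)))"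
proof -
  have s: "0 < s" using u by (simp add: s_def)
  have sum1: "u / s + v / s + w / s = 1" using s by (simp add: s_def flip: add_divide_distrib)
  have "(CLINT x|cpois (s * h) (jump_pmf \<alpha> (u / s) (v / s) (w / s)). iexp (z1 * fst x + z2 * snd x)) =
     exp (of_real (s * h) * ((CLINT x|jump_pmf \<alpha> (u / s) (v / s) (w / s). iexp (z1 * fst x + z2 * snd x)) - 1))"
    using s l by (intro expectation_cpois_mult[where B=1]) (auto simp: algebra_simps simp flip: exp_add)
  also have "(CLINT x|jump_pmf \<alpha> (u / s) (v / s) (w / s). iexp (z1 * fst x + z2 * snd x)) =
     of_real (u / s) * iexp z1 + of_real (v / s) * iexp z2 + of_real (w / s) * iexp (z1 + z2 * \<alpha>)"
    using u s sum1 \<alpha> by (subst expectation_jump_pmf) auto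
  also have "of_real (s * h) * (of_real (u / s) * iexp z1 + of_real (v / s) * iexp z2 + of_real (w / s) * iexp (z1 + z2 * \<alpha>) - 1)
     = of_real h * (of_real u * iexp z1 + of_real v * iexp z2 + of_real w * iexp (z1 + z2 * \<alpha>) - of_real s)"
    using s by (simp add: field_simps)
  finally show ?thesis by (simp add: s_def algebra_simps)
qed

section \<open>The constructed process is a realization\<close>

text \<open>Countable set containing every increment of the constructed process at every sample
  point; it is the carrier \<open>C\<close> for \<open>measure_eqI_countable_char\<close>.\<close>

definition jump_semigroup :: "real \<Rightarrow> (real \<times> real) set" where
  "jump_semigroup \<alpha> = range (\<lambda>(a::nat, b::nat, d::nat). (real a + real d, real b + real d * \<alpha>))"

lemma countable_jump_semigroup: "countable (jump_semigroup \<alpha>)"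
  by (simp add: jump_semigroup_def)

lemma jump_semigroup_0: "0 \<in> jump_semigroup \<alpha>"
  unfolding jump_semigroup_def by (rule range_eqI[of _ _ "(0, 0, 0)"]) (simp add: zero_prod_def)

lemma jump_semigroup_add:
  assumes "x \<in> jump_semigroup \<alpha>" "y \<in> jump_semigroup \<alpha>"
  shows "x + y \<in> jump_semigroup \<alpha>"
proof -
  obtain a b d a' b' d' :: nat where "x = (real a + real d, real b + real d * \<alpha>)" "y = (real a' + real d', real b' + real d' * \<alpha>)"
    using assms unfolding jump_semigroup_def by auto
  then show ?thesis
    unfolding jump_semigroup_def by (intro range_eqI[of _ _ "(a + a', b + b', d + d')"]) (simp add: algebra_simps)
qed

lemma jump_semigroup_sum:
  "(\<And>i. i \<in> A \<Longrightarrow> f i \<in> jump_semigroup \<alpha>) \<Longrightarrow> sum f A \<in> jump_semigroup \<alpha>"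
  by (induction A rule: infinite_finite_induct) (auto simp: jump_semigroup_0 jump_semigroup_add)

lemma jvec_in: "jvec \<alpha> b \<in> jump_semigroup \<alpha>"
  unfolding jvec_def jump_semigroup_def
  using range_eqI[of _ "\<lambda>(a::nat, b::nat, d::nat). (real a + real d, real b + real d * \<alpha>)" "(1, 0, 0)"]
    range_eqI[of _ "\<lambda>(a::nat, b::nat, d::nat). (real a + real d, real b + real d * \<alpha>)" "(0, 1, 0)"]
    range_eqI[of _ "\<lambda>(a::nat, b::nat, d::nat). (real a + real d, real b + real d * \<alpha>)" "(0, 0, 1)"]
  by auto

lemma pproc_diff_in:
  assumes "s \<le> t"
  shows "pproc \<alpha> t \<omega> - pproc \<alpha> s \<omega> \<in> jump_semigroup \<alpha>"
proof -
  obtain N where "t \<le> real N" using real_arch_simple by blast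
  from pproc_diff[OF assms this] show ?thesis
    by (auto intro!: jump_semigroup_sum simp: jvec_in jump_semigroup_0 indicator_def simp del: sum_indicator_scaleR)
qed

definition rate3 :: "real \<Rightarrow> real \<Rightarrow> real \<Rightarrow> nat \<Rightarrow> real" where
  "rate3 u v w j = (if j = 0 then u else if j = 1 then v else w)"

context
  fixes \<alpha> u v w :: real
  assumes u: "0 < u" "0 < v" "0 < w" and \<alpha>: "\<alpha> \<noteq> 0"
begin

abbreviation "PM \<equiv> pt_space (rate3 u v w)"

definition "expo z1 z2 = of_real u * (iexp z1 - 1) + of_real v * (iexp z2 - 1) + of_real w * (iexp (z1 + z2 * \<alpha>) - 1)"

lemma char_increments3:
  assumes t: "0 \<le> t 0" "mono t"
  shows "(CLINT \<omega>|PM. iexp (\<Sum>l<n. z1 l * fst (pproc \<alpha> (t (Suc l)) \<omega> - pproc \<alpha> (t l) \<omega>) +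
              z2 l * snd (pproc \<alpha> (t (Suc l)) \<omega> - pproc \<alpha> (t l) \<omega>))) =
         (\<Prod>l<n. exp (of_real (t (Suc l) - t l) * expo (z1 l) (z2 l)))"
proof -
  have "{..<3::nat} = {0, 1, 2}" by auto
  then have *: "(\<Sum>j<3. of_real (rate3 u v w j) * (iexp (a * fst (jvec \<alpha> j) + b * snd (jvec \<alpha> j)) - 1)) = expo a b" for a b
    by (simp add: rate3_def jvec_def expo_def)
  have "0 < rate3 u v w j" for j using u by (simp add: rate3_def)
  from char_increments[where rate="rate3 u v w" and t=t and n=n and ?z1.0=z1 and \<alpha>=\<alpha> and ?z2.0=z2, OF this t] show ?thesis
    unfolding * .
qed

lemma char_increment1:
  assumes "0 \<le> s" "0 \<le> h"
  shows "(CLINT \<omega>|PM. iexp (z1 * fst (pproc \<alpha> (s + h) \<omega> - pproc \<alpha> s \<omega>) + z2 * snd (pproc \<alpha> (s + h) \<omega> - pproc \<alpha> s \<omega>))) =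
         exp (of_real h * expo z1 z2)"
  using char_increments3[of "\<lambda>n. if n = 0 then s else s + h" "\<lambda>_. z1" "\<lambda>_. z2" 1] assms
  by (simp add: mono_def)

lemma measurable_pproc_diff: "(\<lambda>\<omega>. pproc \<alpha> t \<omega> - pproc \<alpha> s \<omega>) \<in> borel_measurable PM"
  by (intro borel_measurable_diff measurable_pproc)

lemma stationary_pproc:
  assumes "0 \<le> s" "0 \<le> h"
  shows "distr PM borel (\<lambda>\<omega>. pproc \<alpha> (s + h) \<omega> - pproc \<alpha> s \<omega>) = distr PM borel (pproc \<alpha> h)"
proof -
  interpret prob_space PM by (rule prob_space_pt_space)
  note [measurable] = measurable_pproc_diff
  have e: "pproc \<alpha> h = (\<lambda>\<omega>. pproc \<alpha> (0 + h) \<omega> - pproc \<alpha> 0 \<omega>)" by (simp add: pproc_0)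
  have Cb: "jump_semigroup \<alpha> \<in> sets borel" by (rule sets.countable[OF _ countable_jump_semigroup]) auto
  have C: "AE x in distr PM borel (\<lambda>\<omega>. pproc \<alpha> (s + h) \<omega> - pproc \<alpha> s \<omega>). x \<in> jump_semigroup \<alpha>" if "0 \<le> s" for s
    using pproc_diff_in[of s "s + h"] \<open>0 \<le> h\<close> Cb by (subst AE_distr_iff) auto
  show ?thesis unfolding e
  proof (rule measure_eqI_countable_char[where C="jump_semigroup \<alpha>" and I="UNIV :: bool set" and \<phi>="\<lambda>b. if b then fst else snd"])
    show "(CLINT x|distr PM borel (\<lambda>\<omega>. pproc \<alpha> (s + h) \<omega> - pproc \<alpha> s \<omega>). iexp (\<Sum>i\<in>UNIV. z i * (if i then fst else snd) x)) =
       (CLINT x|distr PM borel (\<lambda>\<omega>. pproc \<alpha> (0 + h) \<omega> - pproc \<alpha> 0 \<omega>). iexp (\<Sum>i\<in>UNIV. z i * (if i then fst else snd) x))" for z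
      using char_increment1[of s h "z True" "z False"] char_increment1[of 0 h "z True" "z False"] assms
      by (simp add: integral_distr UNIV_bool add.commute)
    show "x = y" if "\<And>i. i \<in> (UNIV :: bool set) \<Longrightarrow> (if i then fst else snd) x = (if i then fst else snd) y" for x y :: "real \<times> real"
      using that by (rule fst_snd_separate)
  qed (use C[OF assms(1)] C[of 0] countable_jump_semigroup in \<open>auto intro!: prob_space_distr\<close>)
qed

text \<open>The joint characteristic function factorizes over the intervals, hence the law of the
  vector of increments is the product of its marginals. Both measures live on the countable set of
  n-tuples from \<open>jump_semigroup\<close>, whose points are separated by 2n real
  coordinates.\<close>

lemma indep_increments_pproc:
  assumes t: "0 \<le> t 0" "mono t"
  shows "prob_space.indep_vars PM (\<lambda>_. borel) (\<lambda>i \<omega>. pproc \<alpha> (t (Suc i)) \<omega> - pproc \<alpha> (t i) \<omega>) {..<n}"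
proof (cases "n = 0")
  interpret prob_space PM by (rule prob_space_pt_space)
  case True
  then show ?thesis by (simp add: indep_vars_def indep_sets_def)
next
  interpret prob_space PM by (rule prob_space_pt_space)
  case False
  note [measurable] = measurable_pproc_diff
  define X where "X i \<omega> = pproc \<alpha> (t (Suc i)) \<omega> - pproc \<alpha> (t i) \<omega>" for i \<omega>
  have X[measurable]: "X i \<in> borel_measurable PM" for i unfolding X_def by measurable
  have tl: "t l \<le> t (Suc l)" for l using t(2) by (simp add: monoD)
  have t0: "0 \<le> t l" for l using t monoD[OF t(2), of 0 l] by simp
  have XS: "X i \<omega> \<in> jump_semigroup \<alpha>" for i \<omega>
    unfolding X_def by (rule pproc_diff_in) (rule tl)
  have Cb: "jump_semigroup \<alpha> \<in> sets borel" by (rule sets.countable[OF _ countable_jump_semigroup]) auto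
  interpret D: prob_space "distr PM borel (X i)" for i by (rule prob_space_distr) simp
  interpret P: product_prob_space "\<lambda>i. distr PM borel (X i)" "{..<n}" by unfold_locales
  let ?C = "PiE {..<n} (\<lambda>_. jump_semigroup \<alpha>)"
  have "distr PM (PiM {..<n} (\<lambda>_. borel)) (\<lambda>\<omega>. \<lambda>i\<in>{..<n}. X i \<omega>) = PiM {..<n} (\<lambda>i. distr PM borel (X i))"
  proof (rule measure_eqI_countable_char[where C="?C" and I="{..<n} \<times> (UNIV :: bool set)"
        and \<phi>="\<lambda>(i, b) f. if b then fst (f i) else snd (f i)"])
    show "prob_space (distr PM (PiM {..<n} (\<lambda>_. borel)) (\<lambda>\<omega>. \<lambda>i\<in>{..<n}. X i \<omega>))"
      by (rule prob_space_distr) measurable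
    show "prob_space (PiM {..<n} (\<lambda>i. distr PM borel (X i)))" by (rule P.prob_space_axioms)
    show "sets (PiM {..<n} (\<lambda>i. distr PM borel (X i))) = sets (distr PM (PiM {..<n} (\<lambda>_. borel)) (\<lambda>\<omega>. \<lambda>i\<in>{..<n}. X i \<omega>))"
      by (simp cong: sets_PiM_cong)
    show "countable ?C" by (intro countable_PiE countable_jump_semigroup) auto
    have Cs: "?C \<in> sets (PiM {..<n} (\<lambda>_. borel))" by (intro sets_PiM_I_finite Cb) auto
    show "AE x in distr PM (PiM {..<n} (\<lambda>_. borel)) (\<lambda>\<omega>. \<lambda>i\<in>{..<n}. X i \<omega>). x \<in> ?C"
    proof (subst AE_distr_iff)
      have "{x \<in> space (PiM {..<n} (\<lambda>_. borel)). x \<in> ?C} = ?C" using sets.sets_into_space[OF Cs] by auto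
      then show "{x \<in> space (PiM {..<n} (\<lambda>_. borel)). x \<in> ?C} \<in> sets (PiM {..<n} (\<lambda>_. borel))" using Cs by simp
    qed (use XS in \<open>auto simp: PiE_iff\<close>)
    have "AE x in PiM {..<n} (\<lambda>i. distr PM borel (X i)). \<forall>i\<in>{..<n}. x i \<in> jump_semigroup \<alpha>"
    proof (intro AE_finite_allI P.AE_component)
      fix i show "AE x in distr PM borel (X i). x \<in> jump_semigroup \<alpha>"
        using Cb XS by (subst AE_distr_iff) auto
    qed auto
    then show "AE x in PiM {..<n} (\<lambda>i. distr PM borel (X i)). x \<in> ?C"
      using AE_space by eventually_elim (auto simp: space_PiM PiE_iff)
    show "{x} \<in> sets (distr PM (PiM {..<n} (\<lambda>_. borel)) (\<lambda>\<omega>. \<lambda>i\<in>{..<n}. X i \<omega>))" if "x \<in> ?C" for x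
    proof -
      have "{x} = PiE {..<n} (\<lambda>i. {x i})" using that by (intro PiE_singleton[symmetric]) (auto simp: PiE_iff)
      moreover have "PiE {..<n} (\<lambda>i. {x i}) \<in> sets (PiM {..<n} (\<lambda>_. borel))" by (intro sets_PiM_I_finite) auto
      ultimately show ?thesis by simp
    qed
    show "(case i of (i, b) \<Rightarrow> \<lambda>f. if b then fst (f i) else snd (f i)) \<in> borel_measurable (distr PM (PiM {..<n} (\<lambda>_. borel)) (\<lambda>\<omega>. \<lambda>i\<in>{..<n}. X i \<omega>))"
      if "i \<in> {..<n} \<times> (UNIV :: bool set)" for i
      using that by (cases "snd i") (auto simp: split_beta)
    show "x = y" if "x \<in> ?C" "y \<in> ?C"
      and e: "\<And>i. i \<in> {..<n} \<times> (UNIV :: bool set) \<Longrightarrow> (case i of (i, b) \<Rightarrow> \<lambda>f. if b then fst (f i) else snd (f i)) x = (case i of (i, b) \<Rightarrow> \<lambda>f. if b then fst (f i) else snd (f i)) y" for x y :: "nat \<Rightarrow> real \<times> real"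
    proof (rule PiE_ext[OF that(1,2)])
      fix i assume "i \<in> {..<n}"
      then show "x i = y i" using e[of "(i, True)"] e[of "(i, False)"] by (simp add: prod_eq_iff)
    qed
    fix z :: "nat \<times> bool \<Rightarrow> real"
    have s: "(\<Sum>i\<in>{..<n} \<times> UNIV. z i * (case i of (i, b) \<Rightarrow> \<lambda>f. if b then fst (f i) else snd (f i)) x) =
       (\<Sum>l<n. z (l, True) * fst (x l) + z (l, False) * snd (x l))" for x :: "nat \<Rightarrow> real \<times> real"
      by (simp add: sum.cartesian_product' UNIV_bool add.commute)
    have gm[measurable]: "(\<lambda>x. iexp (a * fst x + b * snd x)) \<in> borel_measurable (borel :: (real \<times> real) measure)" for a b
      by measurable
    have "(CLINT x|distr PM (PiM {..<n} (\<lambda>_. borel)) (\<lambda>\<omega>. \<lambda>i\<in>{..<n}. X i \<omega>). iexp (\<Sum>l<n. z (l, True) * fst (x l) + z (l, False) * snd (x l))) =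
       (CLINT \<omega>|PM. iexp (\<Sum>l<n. z (l, True) * fst (X l \<omega>) + z (l, False) * snd (X l \<omega>)))"
      by (subst integral_distr) (auto intro!: Bochner_Integration.integral_cong sum.cong arg_cong[where f=iexp])
    also have "\<dots> = (\<Prod>l<n. exp (of_real (t (Suc l) - t l) * expo (z (l, True)) (z (l, False))))"
      unfolding X_def by (rule char_increments3[OF t])
    also have "\<dots> = (\<Prod>l<n. CLINT x|distr PM borel (X l). iexp (z (l, True) * fst x + z (l, False) * snd x))"
    proof (intro prod.cong refl)
      fix l
      show "exp (of_real (t (Suc l) - t l) * expo (z (l, True)) (z (l, False))) =
         (CLINT x|distr PM borel (X l). iexp (z (l, True) * fst x + z (l, False) * snd x))"
        using char_increment1[of "t l" "t (Suc l) - t l" "z (l, True)" "z (l, False)"] t0[of l] tl[of l]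
        by (simp add: integral_distr X_def)
    qed
    also have "\<dots> = (CLINT x|PiM {..<n} (\<lambda>i. distr PM borel (X i)). \<Prod>l<n. iexp (z (l, True) * fst (x l) + z (l, False) * snd (x l)))"
      by (rule P.product_integral_prod[symmetric]) (auto intro!: D.integrable_iexp)
    also have "\<dots> = (CLINT x|PiM {..<n} (\<lambda>i. distr PM borel (X i)). iexp (\<Sum>l<n. z (l, True) * fst (x l) + z (l, False) * snd (x l)))"
      by (simp add: sum_distrib_left exp_sum)
    finally show "(CLINT x|distr PM (PiM {..<n} (\<lambda>_. borel)) (\<lambda>\<omega>. \<lambda>i\<in>{..<n}. X i \<omega>).
        iexp (\<Sum>i\<in>{..<n} \<times> UNIV. z i * (case i of (i, b) \<Rightarrow> \<lambda>f. if b then fst (f i) else snd (f i)) x)) =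
       (CLINT x|PiM {..<n} (\<lambda>i. distr PM borel (X i)). iexp (\<Sum>i\<in>{..<n} \<times> UNIV. z i * (case i of (i, b) \<Rightarrow> \<lambda>f. if b then fst (f i) else snd (f i)) x))"
      unfolding s .
  qed auto
  then show ?thesis using False unfolding X_def[symmetric]
    by (subst indep_vars_iff_distr_eq_PiM) auto
qed

lemma levy_process_pproc: "levy_process PM (\<lambda>t \<omega>. pproc \<alpha> t \<omega>)"
  unfolding levy_process_def
  using pure_jump_pproc indep_increments_pproc stationary_pproc
  by (auto simp: prob_space_pt_space pproc_0 pure_jump_def)

end

lemma realizes_pproc:
  assumes c: "1 < c" and p: "0 < p" "0 < q" "0 < r" "p + q + r = 1"
  shows "realizes k c p q r (pt_space (rate3 p q r))
     (\<lambda>t \<omega>. fst (pproc (c powi (- k)) t \<omega>)) (\<lambda>t \<omega>. snd (pproc (c powi (- k)) t \<omega>))"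
proof -
  let ?a = "c powi (- k)"
  have a: "?a \<noteq> 0" using c by simp
  have "biv_compound_poisson k c p q r (pt_space (rate3 p q r)) (\<lambda>t \<omega>. fst (pproc ?a t \<omega>)) (\<lambda>t \<omega>. snd (pproc ?a t \<omega>))"
    unfolding biv_compound_poisson_def
  proof (intro conjI allI impI ballI)
    show "levy_process (pt_space (rate3 p q r)) (\<lambda>t \<omega>. (fst (pproc ?a t \<omega>), snd (pproc ?a t \<omega>)))"
      using levy_process_pproc[OF p(1-3) a] by simp
    show "pure_jump (\<lambda>t. (fst (pproc ?a t \<omega>), snd (pproc ?a t \<omega>)))" for \<omega>
      using pure_jump_pproc by simp
    fix t z1 z2 :: real assume "0 \<le> t"
    then show "(CLINT \<omega>|pt_space (rate3 p q r). iexp (z1 * fst (pproc ?a t \<omega>) + z2 * snd (pproc ?a t \<omega>))) =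
      exp (of_real t * (CLINT x|biv_levy_measure k c p q r. iexp (z1 * fst x + z2 * snd x) - 1))"
      using char_increment1[OF p(1-3) a, of 0 t z1 z2] biv_levy_integral[of c p q r k z1 z2] c p
      by (simp add: pproc_0 expo_def[OF p(1-3) a])
  qed
  then show ?thesis unfolding realizes_def using p by (intro exI[of _ p] exI[of _ q] exI[of _ r]) auto
qed

section \<open>Pure jump paths\<close>

lemma cadlag_left_lim:
  assumes "cadlag f" "0 < s"
  shows "(f \<longlongrightarrow> left_lim f s) (at_left s)"
proof -
  obtain l where l: "(f \<longlongrightarrow> l) (at_left s)" using assms by (auto simp: cadlag_def)
  then have "left_lim f s = l" unfolding left_lim_def by (intro tendsto_Lim) auto
  with l show ?thesis by simp
qed

lemma left_lim_eqI: "(f \<longlongrightarrow> l) (at_left s) \<Longrightarrow> left_lim f (s::real) = l"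
  unfolding left_lim_def by (intro tendsto_Lim) auto

text \<open>Applied to the two projections. A component may stay constant at a jump of the pair, so
  its jump times are only a subset of those of the pair.\<close>

lemma pure_jump_bounded_linear:
  assumes f: "pure_jump f" and h: "bounded_linear h"
  shows "pure_jump (\<lambda>t. h (f t))"
    and "0 < s \<Longrightarrow> left_lim (\<lambda>t. h (f t)) s = h (left_lim f s)"
    and "0 < s \<Longrightarrow> jump (\<lambda>t. h (f t)) s = h (jump f s)"
proof -
  interpret bounded_linear h by fact
  have cf: "cadlag f" using f by (simp add: pure_jump_def)
  show l: "left_lim (\<lambda>t. h (f t)) s = h (left_lim f s)" if "0 < s" for s
    by (intro left_lim_eqI tendsto cadlag_left_lim cf that)
  show j: "jump (\<lambda>t. h (f t)) s = h (jump f s)" if "0 < s" for s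
    using l[OF that] by (simp add: jump_def diff)
  have c: "cadlag (\<lambda>t. h (f t))"
    unfolding cadlag_def
  proof (intro conjI allI impI)
    fix t :: real assume "0 \<le> t"
    then show "continuous (at_right t) (\<lambda>t. h (f t))"
      using cf by (auto simp: cadlag_def continuous_within intro: tendsto)
  next
    fix t :: real assume "0 < t"
    then show "\<exists>l. ((\<lambda>t. h (f t)) \<longlongrightarrow> l) (at_left t)"
      using cadlag_left_lim[OF cf] tendsto by blast
  qed
  have sub: "jump_times (\<lambda>t. h (f t)) \<subseteq> jump_times f"
    using j by (auto simp: jump_times_def zero)
  show "pure_jump (\<lambda>t. h (f t))"
    unfolding pure_jump_def
  proof (intro conjI allI impI c)
    fix t :: real assume t: "0 \<le> t"
    have fin: "finite (jump_times f \<inter> {..t})" and ft: "f t = (\<Sum>s\<in>jump_times f \<inter> {..t}. jump f s)"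
      using f t by (auto simp: pure_jump_def)
    show "finite (jump_times (\<lambda>t. h (f t)) \<inter> {..t})" by (rule finite_subset[OF _ fin]) (use sub in auto)
    have "h (f t) = (\<Sum>s\<in>jump_times f \<inter> {..t}. jump (\<lambda>t. h (f t)) s)"
      unfolding ft sum by (intro sum.cong) (auto simp: jump_times_def j)
    also have "\<dots> = (\<Sum>s\<in>jump_times (\<lambda>t. h (f t)) \<inter> {..t}. jump (\<lambda>t. h (f t)) s)"
      by (intro sum.mono_neutral_right fin) (use sub in \<open>auto simp: jump_times_def\<close>)
    finally show "h (f t) = (\<Sum>s\<in>jump_times (\<lambda>t. h (f t)) \<inter> {..t}. jump (\<lambda>t. h (f t)) s)" .
  qed
qed

context
  fixes f :: "real \<Rightarrow> 'b::real_normed_vector"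
  assumes f: "pure_jump f"
begin

lemma pure_jump_finite: "finite (jump_times f \<inter> {..t})"
proof (cases "0 \<le> t")
  case False
  then have "jump_times f \<inter> {..t} = {}" by (auto simp: jump_times_def)
  then show ?thesis by simp
qed (use f in \<open>simp add: pure_jump_def\<close>)

lemma pure_jump_const:
  assumes "0 \<le> a" "a \<le> b" "jump_times f \<inter> {a<..b} = {}"
  shows "f b = f a"
proof -
  have "jump_times f \<inter> {..b} = jump_times f \<inter> {..a}" using assms by force
  then show ?thesis using f assms by (simp add: pure_jump_def)
qed

lemma pure_jump_left_lim:
  assumes "0 \<le> a" "a < b" "jump_times f \<inter> {a<..<b} = {}"
  shows "left_lim f b = f a"
proof (rule left_lim_eqI, rule tendsto_eventually)
  have "eventually (\<lambda>t. a < t) (at_left b)" by (rule order_tendstoD(1)[OF tendsto_ident_at assms(2)])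
  moreover have "eventually (\<lambda>t. t < b) (at_left b)" by (auto simp: eventually_at_filter)
  ultimately show "eventually (\<lambda>t. f t = f a) (at_left b)"
  proof eventually_elim
    case (elim t)
    then show ?case using assms by (intro pure_jump_const) auto
  qed
qed

lemma pure_jump_step:
  assumes "0 \<le> a" "a < b" "jump_times f \<inter> {a<..<b} = {}"
  shows "jump f b = f b - f a"
  unfolding jump_def pure_jump_left_lim[OF assms] ..

lemma pure_jump_gap:
  obtains e where "0 < e" "jump_times f \<inter> {t<..t + e} = {}"
proof -
  have "finite (jump_times f \<inter> {t<..t + 1})"
    by (rule finite_subset[OF _ pure_jump_finite[of "t + 1"]]) auto
  then have "eventually (\<lambda>s. \<forall>x\<in>jump_times f \<inter> {t<..t + 1}. s < x) (at_right t)"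
    by (intro eventually_ball_finite) (auto intro: order_tendstoD(2)[OF tendsto_ident_at])
  moreover have "eventually (\<lambda>s. s < t + 1) (at_right t)"
    by (rule order_tendstoD(2)[OF tendsto_ident_at]) simp
  moreover have "eventually (\<lambda>s. t < s) (at_right t)" by (rule eventually_at_right_less)
  ultimately have "eventually (\<lambda>s. t < s \<and> jump_times f \<inter> {t<..s} = {}) (at_right t)"
  proof eventually_elim
    case (elim s)
    then have "x \<notin> jump_times f \<inter> {t<..s}" for x by (auto dest!: bspec[of _ _ x])
    with elim show ?case by blast
  qed
  then obtain s where "t < s" "jump_times f \<inter> {t<..s} = {}"
    using eventually_happens' trivial_limit_at_right_real by blast
  then show ?thesis using that[of "s - t"] by simp
qed

text \<open>The infimum is attained because only finitely many jumps lie before any given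
  one.\<close>

lemma pure_jump_first:
  assumes "jump_times f \<noteq> {}"
  shows "Inf (jump_times f) \<in> jump_times f" "\<And>s. s \<in> jump_times f \<Longrightarrow> Inf (jump_times f) \<le> s"
proof -
  obtain t where t: "t \<in> jump_times f" using assms by blast
  let ?S = "jump_times f \<inter> {..t}"
  have S: "finite ?S" "?S \<noteq> {}" using pure_jump_finite t by auto
  have le: "Min ?S \<le> s" if "s \<in> jump_times f" for s
    using S that by (cases "s \<le> t") (auto intro: Min_le order_trans[OF Min_le[of ?S t]] simp: t)
  have "Inf (jump_times f) = Min ?S"
    using Min_in[OF S] le by (intro cInf_eq_minimum) auto
  then show "Inf (jump_times f) \<in> jump_times f" "\<And>s. s \<in> jump_times f \<Longrightarrow> Inf (jump_times f) \<le> s"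
    using Min_in[OF S] le by auto
qed

end

section \<open>Realizations of the process\<close>

lemma set_walk_nonneg:
  fixes J :: "(real \<times> real) pmf"
  assumes "\<And>x. x \<in> set_pmf J \<Longrightarrow> 0 \<le> fst x \<and> 0 \<le> snd x"
  shows "x \<in> set_pmf (walk J k) \<Longrightarrow> 0 \<le> fst x \<and> 0 \<le> snd x"
proof (induction k arbitrary: x)
  case (Suc k)
  then obtain y z where "x = y + z" "y \<in> set_pmf J" "z \<in> set_pmf (walk J k)" by auto
  with assms[of y] Suc.IH[of z] show ?case by simp
qed simp

text \<open>An arbitrary realization, not the constructed one. The results of this locale rest on
  the increments over grid cells and on the pure jump paths.\<close>

locale realization =
  fixes k :: int and c u v w :: real and M :: "'a measure" and N L :: "real \<Rightarrow> 'a \<Rightarrow> real"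
  assumes c1: "1 < c" and u0: "0 < u" and v0: "0 < v" and w0: "0 < w"
    and realization: "biv_compound_poisson k c u v w M N L"
begin

definition al :: real where "al = c powi (- k)"
definition tot :: real where "tot = u + v + w"
abbreviation "J \<equiv> jump_pmf al (u / tot) (v / tot) (w / tot)"

lemma al0: "0 < al" using c1 by (simp add: al_def)
lemma tot0: "0 < tot" using u0 v0 w0 by (simp add: tot_def)
lemma sum1: "u / tot + v / tot + w / tot = 1" using tot0 by (simp add: tot_def flip: add_divide_distrib)

lemma levy: "levy_process M (\<lambda>t \<omega>. (N t \<omega>, L t \<omega>))"
  and pure: "\<omega> \<in> space M \<Longrightarrow> pure_jump (\<lambda>t. (N t \<omega>, L t \<omega>))"
  and char_NL: "0 \<le> t \<Longrightarrow> (CLINT \<omega>|M. iexp (z1 * N t \<omega> + z2 * L t \<omega>)) =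
        exp (of_real t * (CLINT x|biv_levy_measure k c u v w. iexp (z1 * fst x + z2 * snd x) - 1))"
  using realization by (auto simp: biv_compound_poisson_def)

sublocale prob_space M
  using levy by (simp add: levy_process_def)

lemma measurable_NL: "0 \<le> t \<Longrightarrow> (\<lambda>\<omega>. (N t \<omega>, L t \<omega>)) \<in> borel_measurable M"
  using levy by (simp add: levy_process_def)

lemma measurable_N: "0 \<le> t \<Longrightarrow> N t \<in> borel_measurable M"
  and measurable_L: "0 \<le> t \<Longrightarrow> L t \<in> borel_measurable M"
  using measurable_compose[OF measurable_NL measurable_fst_snd(1)]
    measurable_compose[OF measurable_NL measurable_fst_snd(2)] by auto

lemma NL_0: "\<omega> \<in> space M \<Longrightarrow> N 0 \<omega> = 0" "\<omega> \<in> space M \<Longrightarrow> L 0 \<omega> = 0"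
  using levy by (auto simp: levy_process_def zero_prod_def)

lemma pure_N: "\<omega> \<in> space M \<Longrightarrow> pure_jump (\<lambda>t. N t \<omega>)"
  and pure_L: "\<omega> \<in> space M \<Longrightarrow> pure_jump (\<lambda>t. L t \<omega>)"
  and jump_NL: "\<omega> \<in> space M \<Longrightarrow> 0 < s \<Longrightarrow> jump (\<lambda>t. (N t \<omega>, L t \<omega>)) s = (jump (\<lambda>t. N t \<omega>) s, jump (\<lambda>t. L t \<omega>) s)"
  using pure_jump_bounded_linear[OF pure bounded_linear_fst] pure_jump_bounded_linear[OF pure bounded_linear_snd]
  by (auto simp: prod_eq_iff)

lemma jump_times_NL:
  assumes "\<omega> \<in> space M"
  shows "jump_times (\<lambda>t. N t \<omega>) \<subseteq> jump_times (\<lambda>t. (N t \<omega>, L t \<omega>))"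
    "jump_times (\<lambda>t. L t \<omega>) \<subseteq> jump_times (\<lambda>t. (N t \<omega>, L t \<omega>))"
  using jump_NL[OF assms] by (auto simp: jump_times_def zero_prod_def)

definition incr :: "real \<Rightarrow> nat \<Rightarrow> 'a \<Rightarrow> real \<times> real" where
  "incr h i \<omega> = (N (real (Suc i) * h) \<omega> - N (real i * h) \<omega>, L (real (Suc i) * h) \<omega> - L (real i * h) \<omega>)"

lemma incr_indep:
  assumes "0 < h"
  shows "indep_vars (\<lambda>_. borel) (incr h) {..<n}"
proof -
  have "mono (\<lambda>i. real i * h)" using assms by (auto simp: mono_def)
  then show ?thesis using levy unfolding levy_process_def
    by (auto simp: incr_def[abs_def] dest!: spec[of _ n] spec[of _ "\<lambda>i. real i * h"])
qed

lemma measurable_incr: "0 < h \<Longrightarrow> incr h i \<in> borel_measurable M"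
  using incr_indep[of h "Suc i"] by (simp add: indep_vars_def)

text \<open>Stationarity moves the cell to the origin, where the prescribed characteristic function
  fixes the law.\<close>

lemma distr_incr:
  assumes h: "0 < h"
  shows "distr M borel (incr h i) = distr (measure_pmf (cpois (tot * h) J)) borel (\<lambda>x. x)"
proof -
  have "distr M borel (incr h i) = distr M borel (\<lambda>\<omega>. (N (real i * h + h) \<omega>, L (real i * h + h) \<omega>) - (N (real i * h) \<omega>, L (real i * h) \<omega>))"
    by (simp add: incr_def[abs_def] algebra_simps)
  also have "\<dots> = distr M borel (\<lambda>\<omega>. (N h \<omega>, L h \<omega>))"
    using levy h by (auto simp: levy_process_def)
  also have "\<dots> = distr (measure_pmf (cpois (tot * h) J)) borel (\<lambda>x. x)"
  proof (intro distr_pair_eq_pmfI prob_space_axioms measurable_NL)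
    fix z1 z2
    have "(CLINT \<omega>|M. iexp (z1 * fst (N h \<omega>, L h \<omega>) + z2 * snd (N h \<omega>, L h \<omega>))) =
       exp (of_real h * (of_real u * (iexp z1 - 1) + of_real v * (iexp z2 - 1) + of_real w * (iexp (z1 + z2 * al) - 1)))"
      unfolding fst_conv snd_conv char_NL[OF less_imp_le[OF h]] al_def
      using c1 u0 v0 w0 by (subst biv_levy_integral) auto
    also have "\<dots> = (CLINT x|cpois (tot * h) J. iexp (z1 * fst x + z2 * snd x))"
      unfolding tot_def using h u0 v0 w0 al0 by (intro cpois_char_eq[symmetric]) auto
    finally show "(CLINT \<omega>|M. iexp (z1 * fst (N h \<omega>, L h \<omega>) + z2 * snd (N h \<omega>, L h \<omega>))) =
       (CLINT x|cpois (tot * h) J. iexp (z1 * fst x + z2 * snd x))" .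
  qed (use h in simp)
  finally show ?thesis .
qed

lemma expectation_incr:
  fixes F :: "real \<times> real \<Rightarrow> complex"
  assumes h: "0 < h" and F: "F \<in> borel_measurable borel"
  shows "(CLINT \<omega>|M. F (incr h i \<omega>)) = (CLINT x|cpois (tot * h) J. F x)"
proof -
  have "(CLINT \<omega>|M. F (incr h i \<omega>)) = (CLINT x|distr M borel (incr h i). F x)"
    by (rule integral_distr[symmetric, OF measurable_incr[OF h] F])
  also have "\<dots> = (CLINT x|cpois (tot * h) J. F x)"
    unfolding distr_incr[OF h] by (rule integral_distr) (use F in auto)
  finally show ?thesis .
qed

text \<open>Generator of the process (N, L), evaluated at the origin.\<close>

definition gen :: "(real \<times> real \<Rightarrow> complex) \<Rightarrow> complex" where
  "gen F = of_real u * F (1, 0) + of_real v * F (0, 1) + of_real w * F (1, al) - of_real tot * F 0"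

lemma generator_incr:
  fixes F :: "real \<times> real \<Rightarrow> complex"
  assumes h: "0 < h" and F: "F \<in> borel_measurable borel" and B: "\<And>x. norm (F x) \<le> B"
  shows "norm ((CLINT \<omega>|M. F (incr h i \<omega>)) - F 0 - of_real h * gen F) \<le> 3 * B * (tot * h)\<^sup>2"
proof -
  have "of_real (tot * h) * ((CLINT x|J. F x) - F 0) = of_real h * gen F"
  proof -
    have "(CLINT x|J. F x) = of_real (u / tot) * F (1, 0) + of_real (v / tot) * F (0, 1) + of_real (w / tot) * F (1, al)"
      by (rule expectation_jump_pmf[OF _ _ _ sum1]) (use tot0 al0 u0 v0 w0 in auto)
    also have "\<dots> = (of_real u * F (1, 0) + of_real v * F (0, 1) + of_real w * F (1, al)) / of_real tot"
      by (simp add: add_divide_distrib)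
    finally show ?thesis using tot0 by (simp add: gen_def field_simps)
  qed
  moreover have "0 < tot * h" using tot0 h by simp
  ultimately show ?thesis
    unfolding expectation_incr[OF h F] using expectation_cpois_generator[of "tot * h" F B J, OF _ B] by metis
qed

text \<open>Monotonicity of \<open>N\<close> and \<open>L\<close> is not part of the definition of a
  realization. It is read off, almost surely, from the law of the increments, which is carried by
  walks with nonnegative steps.\<close>

lemma AE_incr_nonneg:
  assumes h: "0 < h"
  shows "AE \<omega> in M. 0 \<le> fst (incr h i \<omega>) \<and> 0 \<le> snd (incr h i \<omega>)"
proof -
  note [measurable] = measurable_incr[OF h]
  have J: "0 \<le> fst x \<and> 0 \<le> snd x" if "x \<in> set_pmf J" for x
    using that set_jump_pmf[of "u / tot" "v / tot" "w / tot" al] sum1 al0 u0 v0 w0 tot0 by force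
  have "AE x in distr (measure_pmf (cpois (tot * h) J)) borel (\<lambda>x. x). 0 \<le> fst x \<and> 0 \<le> snd x"
    using set_walk_nonneg[of J, OF J] by (subst AE_distr_iff) (auto simp: AE_measure_pmf_iff cpois_def)
  then have "AE x in distr M borel (incr h i). 0 \<le> fst x \<and> 0 \<le> snd x" unfolding distr_incr[OF h] .
  then show ?thesis by (subst (asm) AE_distr_iff) auto
qed

lemma nn_integral_incr_le:
  assumes h: "0 < h"
  shows "(\<integral>\<^sup>+\<omega>. ennreal (snd (incr h i \<omega>)) \<partial>M) \<le> ennreal (h * (v + w * al))"
proof -
  note [measurable] = measurable_incr[OF h]
  have "(\<integral>\<^sup>+\<omega>. ennreal (snd (incr h i \<omega>)) \<partial>M) = (\<integral>\<^sup>+x. ennreal (snd x) \<partial>distr M borel (incr h i))"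
    by (subst nn_integral_distr) auto
  also have "\<dots> = (\<integral>\<^sup>+x. ennreal (snd x) \<partial>cpois (tot * h) J)"
    unfolding distr_incr[OF h] by (subst nn_integral_distr) auto
  also have "\<dots> \<le> ennreal (tot * h) * (\<integral>\<^sup>+x. ennreal (snd x) \<partial>J)"
  proof (rule nn_integral_cpois_le)
    \<comment> \<open>\<open>ennreal\<close> cuts off negative values, so additivity is weakened to
      subadditivity.\<close>
    show "ennreal (snd (x + y)) \<le> ennreal (snd x) + ennreal (snd y)" for x y :: "real \<times> real"
    proof -
      have "ennreal (snd (x + y)) \<le> ennreal (max 0 (snd x) + max 0 (snd y))" by (intro ennreal_leI) auto
      also have "\<dots> = ennreal (snd x) + ennreal (snd y)" by (subst ennreal_plus) (auto simp: ennreal_max_0)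
      finally show ?thesis .
    qed
  qed (use tot0 h in auto)
  also have "\<dots> = ennreal (h * (v + w * al))"
  proof -
    have "(\<integral>\<^sup>+x. ennreal (snd x) \<partial>J) = ennreal (u / tot) * ennreal (snd (1::real, 0::real)) + ennreal (v / tot) * ennreal (snd (0::real, 1::real))
        + ennreal (w / tot) * ennreal (snd (1::real, al))"
      by (rule nn_integral_jump_pmf[OF _ _ _ sum1]) (use tot0 al0 u0 v0 w0 in auto)
    also have "\<dots> = ennreal ((v + w * al) / tot)"
      using tot0 al0 v0 w0 by (simp add: add_divide_distrib flip: ennreal_mult ennreal_plus)
    finally show ?thesis using tot0 h al0 v0 w0 by (simp flip: ennreal_mult)
  qed
  finally show ?thesis .
qed

lemma sum_incr:
  assumes "\<omega> \<in> space M"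
  shows "(\<Sum>i<m. fst (incr h i \<omega>)) = N (real m * h) \<omega>" "(\<Sum>i<m. snd (incr h i \<omega>)) = L (real m * h) \<omega>"
  using NL_0[OF assms] sum_lessThan_telescope[of "\<lambda>i. N (real i * h) \<omega>" m] sum_lessThan_telescope[of "\<lambda>i. L (real i * h) \<omega>" m]
  by (simp_all add: incr_def del: of_nat_Suc)

end

context realization
begin

definition hs :: "nat \<Rightarrow> real" where "hs n = 1 / real (Suc n)"

lemma hs0: "0 < hs n" by (simp add: hs_def)

lemma hs_lim: "hs \<longlonglongrightarrow> 0"
  unfolding hs_def[abs_def] using LIMSEQ_inverse_real_of_nat by (simp add: inverse_eq_divide)

lemma generator_lim:
  fixes F :: "real \<times> real \<Rightarrow> complex"
  assumes F: "F \<in> borel_measurable borel" and B: "\<And>x. norm (F x) \<le> B"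
  shows "(\<lambda>n. ((CLINT \<omega>|M. F (incr (hs n) 0 \<omega>)) - F 0) / of_real (hs n)) \<longlonglongrightarrow> gen F"
proof -
  define X where "X n = (CLINT \<omega>|M. F (incr (hs n) 0 \<omega>))" for n
  have bd: "norm ((X n - F 0) / of_real (hs n) - gen F) \<le> 3 * B * tot\<^sup>2 * hs n" for n
  proof -
    have "norm (X n - F 0 - of_real (hs n) * gen F) \<le> 3 * B * (tot * hs n)\<^sup>2"
      unfolding X_def by (rule generator_incr[OF hs0 F B])
    then have "norm (X n - F 0 - of_real (hs n) * gen F) / hs n \<le> 3 * B * (tot * hs n)\<^sup>2 / hs n"
      using hs0[of n] by (intro divide_right_mono) auto
    moreover have "norm (X n - F 0 - of_real (hs n) * gen F) / hs n = norm ((X n - F 0 - of_real (hs n) * gen F) / of_real (hs n))"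
      using hs0[of n] by (simp add: norm_divide)
    moreover have "(X n - F 0 - of_real (hs n) * gen F) / of_real (hs n) = (X n - F 0) / of_real (hs n) - gen F"
      using hs0[of n] by (simp add: diff_divide_distrib)
    moreover have "3 * B * (tot * hs n)\<^sup>2 / hs n = 3 * B * tot\<^sup>2 * hs n"
      using hs0[of n] by (simp add: power2_eq_square)
    ultimately show ?thesis by metis
  qed
  have "(\<lambda>n. (X n - F 0) / of_real (hs n) - gen F) \<longlonglongrightarrow> 0"
  proof (rule Lim_null_comparison[OF always_eventually[OF allI[OF bd]]])
    show "(\<lambda>n. 3 * B * tot\<^sup>2 * hs n) \<longlonglongrightarrow> 0" by (rule tendsto_mult_right_zero[OF hs_lim])
  qed
  then show ?thesis unfolding X_def by (rule LIM_zero_cancel)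
qed

subsection \<open>The law of \<open>L\<close> at the first jump of \<open>N\<close>\<close>

definition fh :: "real \<Rightarrow> 'a \<Rightarrow> nat" where
  "fh h \<omega> = (LEAST i. fst (incr h i \<omega>) \<noteq> 0)"

text \<open>Grid version of \<open>L\<close> at the first jump of \<open>N\<close>: the value at the
  right end of the first cell in which \<open>N\<close> changes. The default 0 agrees with
  \<open>first_jump_time\<close>, which picks \<open>L\<close> at time 0 on a path where
  \<open>N\<close> never jumps.\<close>

definition L_hit :: "real \<Rightarrow> 'a \<Rightarrow> real" where
  "L_hit h \<omega> = (if \<exists>i. fst (incr h i \<omega>) \<noteq> 0 then L (real (Suc (fh h \<omega>)) * h) \<omega> else 0)"

lemma L_hit_eventually:
  assumes \<omega>: "\<omega> \<in> space M"
  shows "eventually (\<lambda>n. L_hit (hs n) \<omega> = L (first_jump_time N \<omega>) \<omega>) sequentially"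
proof (cases "jump_times (\<lambda>t. N t \<omega>) = {}")
  case True
  have "N t \<omega> = 0" if "0 \<le> t" for t
    using pure_jump_const[OF pure_N[OF \<omega>] order_refl that] True NL_0[OF \<omega>] by simp
  then have "fst (incr (hs n) i \<omega>) = 0" for n i using less_imp_le[OF hs0[of n]] by (simp add: incr_def)
  then show ?thesis using True NL_0[OF \<omega>] by (simp add: L_hit_def first_jump_time_def)
next
  case False
  define T where "T = Inf (jump_times (\<lambda>t. N t \<omega>))"
  have T: "T \<in> jump_times (\<lambda>t. N t \<omega>)" "\<And>s. s \<in> jump_times (\<lambda>t. N t \<omega>) \<Longrightarrow> T \<le> s"
    unfolding T_def using pure_jump_first[OF pure_N[OF \<omega>] False] by auto
  have T0: "0 < T" using T(1) by (simp add: jump_times_def)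
  have N0: "N t \<omega> = 0" if "0 \<le> t" "t < T" for t
  proof -
    have "jump_times (\<lambda>t. N t \<omega>) \<inter> {0<..t} = {}" using T(2) that by force
    then show ?thesis using pure_jump_const[OF pure_N[OF \<omega>] order_refl that(1)] NL_0[OF \<omega>] by simp
  qed
  have "jump_times (\<lambda>t. N t \<omega>) \<inter> {0<..<T} = {}" using T(2) by force
  from pure_jump_step[OF pure_N[OF \<omega>] order_refl T0 this] have NT: "N T \<omega> \<noteq> 0"
    using T(1) NL_0[OF \<omega>] by (simp add: jump_times_def)
  \<comment> \<open>Neither component moves for a short while after \<open>T\<close>. Once the mesh
    is below \<open>e\<close>, the first grid point at or after \<open>T\<close> shows the values at
    \<open>T\<close>.\<close>
  obtain e where e: "0 < e" "jump_times (\<lambda>t. (N t \<omega>, L t \<omega>)) \<inter> {T<..T + e} = {}"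
    using pure_jump_gap[OF pure[OF \<omega>]] by blast
  have const: "N t \<omega> = N T \<omega>" "L t \<omega> = L T \<omega>" if "T \<le> t" "t \<le> T + e" for t
  proof -
    have "jump_times (\<lambda>t. (N t \<omega>, L t \<omega>)) \<inter> {T<..t} = {}" using e(2) that by force
    then have "(N t \<omega>, L t \<omega>) = (N T \<omega>, L T \<omega>)"
      using pure_jump_const[OF pure[OF \<omega>], of T t] T0 that by simp
    then show "N t \<omega> = N T \<omega>" "L t \<omega> = L T \<omega>" by auto
  qed
  have "eventually (\<lambda>n. hs n < e) sequentially" using order_tendstoD(2)[OF hs_lim e(1)] .
  then show ?thesis
  proof eventually_elim
    case (elim n)
    let ?h = "hs n"
    have h: "0 < ?h" by (rule hs0)
    \<comment> \<open>\<open>real m * ?h\<close> is the first grid point not before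
      \<open>T\<close>; the first jump lies in the cell with index m - 1.\<close>
    define m where "m = nat \<lceil>T / ?h\<rceil>"
    have c: "0 < \<lceil>T / ?h\<rceil>" using T0 h by simp
    then have rm: "real m = of_int \<lceil>T / ?h\<rceil>" by (simp add: m_def)
    have "T / ?h \<le> real m" "real m < T / ?h + 1" unfolding rm by linarith+
    then have m1: "T \<le> real m * ?h" "real m * ?h < T + ?h" using h by (simp_all add: field_simps)
    obtain i where i: "m = Suc i" using c by (cases m) (auto simp: m_def)
    have ih: "real i * ?h < T" using m1 unfolding i by (simp add: algebra_simps)
    have Ni: "fst (incr ?h i \<omega>) \<noteq> 0"
    proof -
      have "N (real i * ?h) \<omega> = 0" using ih h by (intro N0) auto
      moreover have "N (real (Suc i) * ?h) \<omega> = N T \<omega>" using m1 elim unfolding i by (intro const) auto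
      ultimately show ?thesis using NT by (simp add: incr_def)
    qed
    have Nj: "fst (incr ?h j \<omega>) = 0" if "j < i" for j
    proof -
      have "real (Suc j) * ?h \<le> real i * ?h" using that h by (intro mult_right_mono) auto
      then have l1: "real (Suc j) * ?h < T" using ih by linarith
      have "real j * ?h \<le> real (Suc j) * ?h" using h by (intro mult_right_mono) auto
      then have l2: "real j * ?h < T" using l1 by linarith
      have "N (real (Suc j) * ?h) \<omega> = 0" by (rule N0[OF _ l1]) (use h in simp)
      moreover have "N (real j * ?h) \<omega> = 0" by (rule N0[OF _ l2]) (use h in simp)
      ultimately have "N (real (Suc j) * ?h) \<omega> = 0" "N (real j * ?h) \<omega> = 0" .
      then show ?thesis by (simp add: incr_def)
    qed
    have "fh ?h \<omega> = i" unfolding fh_def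
    proof (rule Least_equality)
      show "i \<le> y" if "fst (incr ?h y \<omega>) \<noteq> 0" for y using that Nj[of y] by (meson not_le)
    qed (rule Ni)
    then have "L_hit ?h \<omega> = L (real m * ?h) \<omega>" using Ni by (auto simp: L_hit_def i)
    also have "\<dots> = L T \<omega>" using m1 elim by (intro const) auto
    finally show ?case using False by (simp add: first_jump_time_def T_def)
  qed
qed

lemma measurable_L_hit:
  assumes h: "0 < h"
  shows "L_hit h \<in> borel_measurable M"
proof -
  note [measurable] = measurable_incr[OF h]
  have "fh h \<in> measurable M (count_space UNIV)" unfolding fh_def[abs_def] by measurable
  then have [measurable]: "(\<lambda>\<omega>. L (real (Suc (fh h \<omega>)) * h) \<omega>) \<in> borel_measurable M"
    by (rule measurable_compose_countable[rotated]) (use h in \<open>auto intro!: measurable_L\<close>)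
  show ?thesis unfolding L_hit_def[abs_def] by measurable
qed

lemma measurable_rho: "(\<lambda>\<omega>. L (first_jump_time N \<omega>) \<omega>) \<in> borel_measurable M"
  by (rule borel_measurable_LIMSEQ_real[of M "\<lambda>n. L_hit (hs n)"])
     (auto intro: tendsto_eventually[OF L_hit_eventually] measurable_L_hit[OF hs0])

text \<open>\<open>Y0\<close> and \<open>Y1\<close> split the exponential of a cell according to
  whether \<open>N\<close> stays put or moves; a first hit in cell i is a product of i factors
  \<open>Y0\<close> and one factor \<open>Y1\<close>.\<close>

definition Y0 :: "real \<Rightarrow> real \<times> real \<Rightarrow> complex" where
  "Y0 z x = (if fst x = 0 then iexp (z * snd x) else 0)"

definition Y1 :: "real \<Rightarrow> real \<times> real \<Rightarrow> complex" where
  "Y1 z x = (if fst x \<noteq> 0 then iexp (z * snd x) else 0)"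

lemma measurable_Y[measurable]: "Y0 z \<in> borel_measurable borel" "Y1 z \<in> borel_measurable borel"
  unfolding Y0_def[abs_def] Y1_def[abs_def] by measurable

lemma norm_Y: "norm (Y0 z x) \<le> 1" "norm (Y1 z x) \<le> 1"
  by (auto simp: Y0_def Y1_def)

lemma integrable_incr:
  fixes F :: "real \<times> real \<Rightarrow> complex"
  assumes h: "0 < h" and F: "F \<in> borel_measurable borel" and B: "\<And>x. norm (F x) \<le> B"
  shows "integrable M (\<lambda>\<omega>. F (incr h i \<omega>))"
  using B measurable_compose[OF measurable_incr[OF h] F] by (intro integrable_const_bound[where B=B]) auto

lemma prod_incr:
  fixes G :: "nat \<Rightarrow> real \<times> real \<Rightarrow> complex"
  assumes h: "0 < h" and G: "\<And>i. G i \<in> borel_measurable borel" and B: "\<And>i x. norm (G i x) \<le> 1"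
  shows "(CLINT \<omega>|M. \<Prod>i<n. G i (incr h i \<omega>)) = (\<Prod>i<n. CLINT \<omega>|M. G i (incr h 0 \<omega>))"
    and "integrable M (\<lambda>\<omega>. \<Prod>i<n. G i (incr h i \<omega>))"
proof -
  have i: "indep_vars (\<lambda>_. borel) (\<lambda>i \<omega>. G i (incr h i \<omega>)) {..<n}"
    by (rule indep_vars_compose2[OF incr_indep[OF h] G])
  have "(CLINT \<omega>|M. \<Prod>i<n. G i (incr h i \<omega>)) = (\<Prod>i<n. CLINT \<omega>|M. G i (incr h i \<omega>))"
    by (rule indep_vars_lebesgue_integral[OF _ i]) (auto intro: integrable_incr[OF h G B])
  then show "(CLINT \<omega>|M. \<Prod>i<n. G i (incr h i \<omega>)) = (\<Prod>i<n. CLINT \<omega>|M. G i (incr h 0 \<omega>))"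
    by (simp only: expectation_incr[OF h G])
  show "integrable M (\<lambda>\<omega>. \<Prod>i<n. G i (incr h i \<omega>))"
    by (rule indep_vars_integrable[OF _ i]) (auto intro: integrable_incr[OF h G B])
qed

text \<open>Decomposition by the first cell in which \<open>N\<close> moves: by independence the
  i-th term has expectation a^i b, and these form a geometric series. The remainder is controlled by
  the probability of no hit among the first n cells.\<close>

lemma expectation_L_hit:
  assumes h: "0 < h" and a1: "norm (CLINT \<omega>|M. Y0 0 (incr h 0 \<omega>)) < 1"
  shows "(CLINT \<omega>|M. iexp (z * L_hit h \<omega>)) =
     (CLINT \<omega>|M. Y1 z (incr h 0 \<omega>)) / (1 - (CLINT \<omega>|M. Y0 z (incr h 0 \<omega>)))"
proof -
  let ?a = "\<lambda>z. CLINT \<omega>|M. Y0 z (incr h 0 \<omega>)" and ?b = "CLINT \<omega>|M. Y1 z (incr h 0 \<omega>)"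
  note [measurable] = measurable_incr[OF h] measurable_L_hit[OF h]
  define S where "S i \<omega> = (\<Prod>j<Suc i. (if j < i then Y0 z else Y1 z) (incr h j \<omega>))" for i \<omega>
  have ES: "expectation (S i) = ?a z ^ i * ?b" and iS: "integrable M (S i)" for i
  proof -
    have m: "(if j < i then Y0 z else Y1 z) \<in> borel_measurable borel" "norm ((if j < i then Y0 z else Y1 z) x) \<le> 1" for j x
      using norm_Y by auto
    show "integrable M (S i)" unfolding S_def by (rule prod_incr(2)[OF h m])
    have "expectation (S i) = (\<Prod>j<Suc i. CLINT \<omega>|M. (if j < i then Y0 z else Y1 z) (incr h 0 \<omega>))"
      unfolding S_def by (rule prod_incr(1)[OF h m])
    then show "expectation (S i) = ?a z ^ i * ?b" by simp
  qed
  \<comment> \<open>Indicator that \<open>N\<close> is unchanged over the first n cells, written as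
    a product so that independence gives its mean.\<close>
  define Q where "Q n \<omega> = (\<Prod>j<n. Y0 0 (incr h j \<omega>))" for n \<omega>
  have EQ: "expectation (Q n) = ?a 0 ^ n" and iQ: "integrable M (Q n)" for n
  proof -
    show "expectation (Q n) = ?a 0 ^ n"
      unfolding Q_def using prod_incr(1)[OF h, of "\<lambda>_. Y0 0" n] norm_Y by simp
    show "integrable M (Q n)"
      unfolding Q_def using prod_incr(2)[OF h, of "\<lambda>_. Y0 0" n] norm_Y by simp
  qed
  have Qr: "Q n \<omega> = (if \<exists>i<n. fst (incr h i \<omega>) \<noteq> 0 then 0 else 1)" for n \<omega>
    by (auto simp: Q_def Y0_def)
  have Ssum: "(\<Sum>i<n. S i \<omega>) = (if \<exists>i<n. fst (incr h i \<omega>) \<noteq> 0 then iexp (z * L_hit h \<omega>) else 0)"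
    if \<omega>: "\<omega> \<in> space M" for n \<omega>
  proof (cases "\<exists>i. fst (incr h i \<omega>) \<noteq> 0")
    case True
    then have m: "fst (incr h (fh h \<omega>) \<omega>) \<noteq> 0" unfolding fh_def by (rule LeastI_ex)
    have lt: "fst (incr h j \<omega>) = 0" if "j < fh h \<omega>" for j using not_less_Least[OF that[unfolded fh_def]] by blast
    have Si: "S i \<omega> = (if i = fh h \<omega> then iexp (z * L_hit h \<omega>) else 0)" for i
    proof (cases i "fh h \<omega>" rule: linorder_cases)
      case less
      then have "Y1 z (incr h i \<omega>) = 0" using lt by (simp add: Y1_def)
      then show ?thesis using less by (simp add: S_def)
    next
      case equal
      have "S i \<omega> = (\<Prod>j<Suc i. iexp (z * snd (incr h j \<omega>)))"
        unfolding S_def using equal lt m by (intro prod.cong) (auto simp: Y0_def Y1_def less_Suc_eq)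
      also have "\<dots> = iexp (z * (\<Sum>j<Suc i. snd (incr h j \<omega>)))"
        by (simp add: sum_distrib_left exp_sum distrib_left exp_add)
      also have "\<dots> = iexp (z * L_hit h \<omega>)"
        unfolding sum_incr(2)[OF \<omega>] using True equal by (simp add: L_hit_def)
      finally show ?thesis using equal by simp
    next
      case greater
      then have "Y0 z (incr h (fh h \<omega>) \<omega>) = 0" using m by (simp add: Y0_def)
      then have "S i \<omega> = 0" unfolding S_def using greater by (intro prod_zero) (auto intro!: bexI[of _ "fh h \<omega>"])
      then show ?thesis using greater by simp
    qed
    have "(\<exists>i<n. fst (incr h i \<omega>) \<noteq> 0) \<longleftrightarrow> fh h \<omega> < n"
      using m lt by (meson le_less_trans not_le)
    then show ?thesis by (simp add: Si)
  next
    case False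
    then show ?thesis by (simp add: S_def Y1_def)
  qed
  have bd: "norm ((CLINT \<omega>|M. iexp (z * L_hit h \<omega>)) - (\<Sum>i<n. ?a z ^ i * ?b)) \<le> norm (?a 0) ^ n" for n
  proof -
    have "(CLINT \<omega>|M. iexp (z * L_hit h \<omega>)) - (\<Sum>i<n. ?a z ^ i * ?b) = (CLINT \<omega>|M. iexp (z * L_hit h \<omega>) - (\<Sum>i<n. S i \<omega>))"
      using iS by (subst Bochner_Integration.integral_diff) (auto simp: ES intro!: integrable_iexp)
    also have "\<dots> = (CLINT \<omega>|M. iexp (z * L_hit h \<omega>) * Q n \<omega>)"
      by (intro Bochner_Integration.integral_cong) (auto simp: Ssum Qr)
    also have "norm \<dots> \<le> (LINT \<omega>|M. norm (iexp (z * L_hit h \<omega>) * Q n \<omega>))" by (rule integral_norm_bound)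
    also have "\<dots> = (LINT \<omega>|M. Re (Q n \<omega>))"
      by (intro Bochner_Integration.integral_cong) (auto simp: Qr norm_mult)
    also have "\<dots> = Re (?a 0 ^ n)" using iQ by (simp add: EQ[symmetric])
    also have "\<dots> \<le> norm (?a 0) ^ n" by (metis complex_Re_le_cmod norm_power)
    finally show ?thesis .
  qed
  have az: "norm (?a z) < 1"
  proof -
    have "norm (?a z) \<le> (LINT \<omega>|M. norm (Y0 z (incr h 0 \<omega>)))" by (rule integral_norm_bound)
    also have "\<dots> = (LINT \<omega>|M. Re (Y0 0 (incr h 0 \<omega>)))"
      by (intro Bochner_Integration.integral_cong) (auto simp: Y0_def)
    also have "\<dots> = Re (?a 0)" using integrable_incr[OF h measurable_Y(1) norm_Y(1)] by simp
    also have "\<dots> \<le> norm (?a 0)" by (rule complex_Re_le_cmod)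
    finally show ?thesis using a1 by simp
  qed
  have "(\<lambda>n. norm (?a 0) ^ n) \<longlonglongrightarrow> 0" using a1 by (intro LIMSEQ_power_zero) simp
  then have l: "(\<lambda>n. (CLINT \<omega>|M. iexp (z * L_hit h \<omega>)) - (\<Sum>i<n. ?a z ^ i * ?b)) \<longlonglongrightarrow> 0"
    by (rule Lim_null_comparison[OF always_eventually[OF allI[OF bd]]])
  have "(\<lambda>n. \<Sum>i<n. ?a z ^ i * ?b) \<longlonglongrightarrow> (CLINT \<omega>|M. iexp (z * L_hit h \<omega>))"
    using tendsto_diff[OF tendsto_const[of "CLINT \<omega>|M. iexp (z * L_hit h \<omega>)"] l] by simp
  moreover have "(\<lambda>n. \<Sum>i<n. ?a z ^ i * ?b) \<longlonglongrightarrow> 1 / (1 - ?a z) * ?b"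
    using sums_mult2[OF geometric_sums[OF az], of ?b] unfolding sums_def .
  ultimately have "(CLINT \<omega>|M. iexp (z * L_hit h \<omega>)) = 1 / (1 - ?a z) * ?b" by (rule LIMSEQ_unique)
  then show ?thesis by simp
qed

text \<open>Dividing numerator and denominator of the discrete formula by the mesh turns them into
  difference quotients, whose limits are given by the generator applied to \<open>Y1\<close> and
  \<open>Y0\<close>.\<close>

theorem char_rho:
  "char (distr M borel (\<lambda>\<omega>. L (first_jump_time N \<omega>) \<omega>)) z =
     (of_real u + of_real w * iexp (al * z)) / (of_real tot - of_real v * iexp z)"
proof -
  let ?a = "\<lambda>z n. CLINT \<omega>|M. Y0 z (incr (hs n) 0 \<omega>)" and ?b = "\<lambda>n. CLINT \<omega>|M. Y1 z (incr (hs n) 0 \<omega>)"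
  have g0: "gen (Y0 z) = of_real v * iexp z - of_real tot" for z by (simp add: gen_def Y0_def)
  have g1: "gen (Y1 z) = of_real u + of_real w * iexp (al * z)" by (simp add: gen_def Y1_def mult.commute)
  have la: "(\<lambda>n. (?a z n - 1) / of_real (hs n)) \<longlonglongrightarrow> of_real v * iexp z - of_real tot" for z
    using generator_lim[OF measurable_Y(1) norm_Y(1), of z] unfolding g0 by (simp add: Y0_def)
  have lb: "(\<lambda>n. ?b n / of_real (hs n)) \<longlonglongrightarrow> of_real u + of_real w * iexp (al * z)"
    using generator_lim[OF measurable_Y(2) norm_Y(2), of z] unfolding g1 by (simp add: Y1_def)
  \<comment> \<open>The discrete formula asks that \<open>N\<close> stay put in a cell with
    probability below 1. The derivative of this probability at mesh 0 is v - tot = -(u + w) <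
    0.\<close>
  have ev: "eventually (\<lambda>n. norm (?a 0 n) < 1) sequentially"
  proof -
    have "(\<lambda>n. Re ((?a 0 n - 1) / of_real (hs n))) \<longlonglongrightarrow> Re (of_real v * iexp 0 - of_real tot)"
      using la[of 0] by (intro tendsto_Re) simp
    moreover have "Re (of_real v * iexp 0 - of_real tot) < 0" using u0 w0 by (simp add: tot_def)
    ultimately have "eventually (\<lambda>n. Re ((?a 0 n - 1) / of_real (hs n)) < 0) sequentially"
      by (rule order_tendstoD(2))
    then show ?thesis
    proof eventually_elim
      case (elim n)
      have "Y0 0 x = of_real (if fst x = 0 then 1 else 0)" for x by (simp add: Y0_def)
      then have "?a 0 n = of_real (LINT \<omega>|M. (if fst (incr (hs n) 0 \<omega>) = 0 then 1 else 0))"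
        by (simp only: integral_complex_of_real)
      moreover have "0 \<le> (LINT \<omega>|M. (if fst (incr (hs n) 0 \<omega>) = 0 then 1 else 0 :: real))" by simp
      ultimately have "norm (?a 0 n) = Re (?a 0 n)" by simp
      moreover have "Re (?a 0 n) < 1" using elim hs0[of n] by (simp add: divide_less_0_iff)
      ultimately show ?case by simp
    qed
  qed
  have den: "of_real tot - of_real v * iexp z \<noteq> 0"
  proof
    assume "of_real tot - of_real v * iexp z = 0"
    then have "norm (of_real tot :: complex) = norm (of_real v * iexp z)" by simp
    then have "\<bar>tot\<bar> = \<bar>v\<bar>" by (simp add: norm_mult)
    then show False using u0 v0 w0 by (simp add: tot_def)
  qed
  have "(\<lambda>n. (?b n / of_real (hs n)) / - ((?a z n - 1) / of_real (hs n))) \<longlonglongrightarrow>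
     (of_real u + of_real w * iexp (al * z)) / - (of_real v * iexp z - of_real tot)"
    using den by (intro tendsto_divide tendsto_minus la lb) auto
  moreover have "eventually (\<lambda>n. (?b n / of_real (hs n)) / - ((?a z n - 1) / of_real (hs n)) = (CLINT \<omega>|M. iexp (z * L_hit (hs n) \<omega>))) sequentially"
    using ev
  proof eventually_elim
    case (elim n)
    have "(?b n / of_real (hs n)) / - ((?a z n - 1) / of_real (hs n)) = ?b n / (1 - ?a z n)"
    proof -
      have "- ((?a z n - 1) / of_real (hs n)) = (1 - ?a z n) / of_real (hs n)" by (simp add: diff_divide_distrib)
      then show ?thesis using hs0[of n] by (simp del: minus_diff_eq)
    qed
    then show ?case using expectation_L_hit[OF hs0 elim] by simp
  qed
  ultimately have l1: "(\<lambda>n. CLINT \<omega>|M. iexp (z * L_hit (hs n) \<omega>)) \<longlonglongrightarrow>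
     (of_real u + of_real w * iexp (al * z)) / - (of_real v * iexp z - of_real tot)"
    by (rule Lim_transform_eventually)
  have "(\<lambda>n. CLINT \<omega>|M. iexp (z * L_hit (hs n) \<omega>)) \<longlonglongrightarrow> (CLINT \<omega>|M. iexp (z * L (first_jump_time N \<omega>) \<omega>))"
  proof (rule integral_dominated_convergence[where w="\<lambda>_. 1"])
    note [measurable] = measurable_rho measurable_L_hit[OF hs0]
    show "(\<lambda>\<omega>. iexp (z * L (first_jump_time N \<omega>) \<omega>)) \<in> borel_measurable M" by measurable
    show "(\<lambda>\<omega>. iexp (z * L_hit (hs n) \<omega>)) \<in> borel_measurable M" for n by measurable
    show "AE \<omega> in M. (\<lambda>n. iexp (z * L_hit (hs n) \<omega>)) \<longlonglongrightarrow> iexp (z * L (first_jump_time N \<omega>) \<omega>)"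
      by (rule AE_I2) (intro tendsto_intros tendsto_eventually[OF L_hit_eventually])
  qed auto
  from LIMSEQ_unique[OF this l1] show ?thesis
    by (simp add: char_def integral_distr[OF measurable_rho])
qed

end

context realization
begin

subsection \<open>Riemann sums for the exponential integral\<close>

definition Ih :: "real \<Rightarrow> nat \<Rightarrow> 'a \<Rightarrow> real" where
  "Ih h m \<omega> = (\<Sum>i<m. c powr (- N (real i * h) \<omega>) * snd (incr h i \<omega>))"

text \<open>Once the mesh is below the smallest distance between jump times up to \<open>t\<close>,
  a cell contains at most one jump: its left endpoint shows the left limit of \<open>N\<close>, and
  its increment of \<open>L\<close> is that jump. So the Riemann sum equals the integral exactly.
  The last clause, that each jump of \<open>L\<close> is a grid increment, will give the
  nonnegativity of the jumps.\<close>

lemma Ih_path: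
  assumes \<omega>: "\<omega> \<in> space M" and t: "0 \<le> t"
  obtains \<delta> where "0 < \<delta>"
    "\<And>h m. 0 < h \<Longrightarrow> h < \<delta> \<Longrightarrow> real m * h = t \<Longrightarrow> Ih h m \<omega> = exp_integral c N L t \<omega>"
    "\<And>h m s. 0 < h \<Longrightarrow> h < \<delta> \<Longrightarrow> real m * h = t \<Longrightarrow> s \<in> jump_times (\<lambda>t. L t \<omega>) \<Longrightarrow> s \<le> t \<Longrightarrow>
        \<exists>i<m. snd (incr h i \<omega>) = jump (\<lambda>t. L t \<omega>) s"
proof -
  let ?Z = "\<lambda>t. (N t \<omega>, L t \<omega>)"
  define S where "S = jump_times ?Z \<inter> {..t}"
  define g where "g s = c powr (- left_lim (\<lambda>t. N t \<omega>) s) * jump (\<lambda>t. L t \<omega>) s" for s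
  have fS: "finite S" unfolding S_def by (rule pure_jump_finite[OF pure[OF \<omega>]])
  \<comment> \<open>The element 1 keeps \<open>D\<close> nonempty when there are fewer than two jump
    times.\<close>
  define D where "D = insert 1 ((\<lambda>p. \<bar>fst p - snd p\<bar>) ` (S \<times> S - {p. fst p = snd p}))"
  have fD: "finite D" unfolding D_def using fS by (intro finite.insertI finite_imageI finite_Diff finite_cartesian_product)
  define \<delta> where "\<delta> = Min D"
  have "\<delta> \<in> D" unfolding \<delta>_def using fD by (intro Min_in) (auto simp: D_def)
  then have \<delta>0: "0 < \<delta>" by (auto simp: D_def)
  have \<delta>S: "s = s'" if "s \<in> S" "s' \<in> S" "\<bar>s - s'\<bar> < \<delta>" for s s'
  proof (rule ccontr)
    assume "s \<noteq> s'"
    then have "(s, s') \<in> S \<times> S - {p. fst p = snd p}" using that(1,2) by simp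
    from imageI[OF this, of "\<lambda>p. \<bar>fst p - snd p\<bar>"] have "\<bar>s - s'\<bar> \<in> D" unfolding D_def fst_conv snd_conv by (rule insertI2)
    then have "\<delta> \<le> \<bar>s - s'\<bar>" unfolding \<delta>_def using fD by (rule Min_le[rotated])
    with that(3) show False by linarith
  qed
  have S0: "0 < s" if "s \<in> S" for s using that by (simp add: S_def jump_times_def)
  have expi: "exp_integral c N L t \<omega> = (\<Sum>s\<in>S. g s)"
    unfolding exp_integral_def g_def
  proof (rule sum.mono_neutral_left[OF fS])
    show "jump_times (\<lambda>t. L t \<omega>) \<inter> {..t} \<subseteq> S" using jump_times_NL(2)[OF \<omega>] by (auto simp: S_def)
    show "\<forall>s\<in>S - jump_times (\<lambda>t. L t \<omega>) \<inter> {..t}. c powr (- left_lim (\<lambda>t. N t \<omega>) s) * jump (\<lambda>t. L t \<omega>) s = 0"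
      using S0 by (auto simp: jump_times_def S_def)
  qed
  have cell: "c powr (- N (real i * h) \<omega>) * snd (incr h i \<omega>) = (\<Sum>s\<in>S \<inter> {real i * h<..real (Suc i) * h}. g s)"
    "s \<in> S \<inter> {real i * h<..real (Suc i) * h} \<Longrightarrow> snd (incr h i \<omega>) = jump (\<lambda>t. L t \<omega>) s"
    if h: "0 < h" "h < \<delta>" "real m * h = t" and i: "i < m" for h m i s
  proof -
    let ?a = "real i * h" and ?b = "real (Suc i) * h"
    have a0: "0 \<le> ?a" using h(1) by simp
    have ba: "?b - ?a = h" by (simp add: algebra_simps)
    then have ab: "?a < ?b" "?b - ?a < \<delta>" using h(1,2) by linarith+
    have "?b \<le> real m * h" using i h(1) by (intro mult_right_mono) auto
    then have bt: "?b \<le> t" unfolding h(3) .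
    have step: "snd (incr h i \<omega>) = jump (\<lambda>t. L t \<omega>) s \<and> left_lim (\<lambda>t. N t \<omega>) s = N ?a \<omega> \<and> S \<inter> {?a<..?b} = {s}"
      if s: "s \<in> S \<inter> {?a<..?b}" for s
    proof -
      have one: "s' = s" if "s' \<in> S \<inter> {?a<..?b}" for s'
        using that s ab by (intro \<delta>S) auto
      have Ss: "S \<inter> {?a<..?b} = {s}" by (rule equalityI) (use s one in blast)+
      have e1: "jump_times ?Z \<inter> {?a<..<s} = {}"
      proof (rule equals0I)
        fix x assume x: "x \<in> jump_times ?Z \<inter> {?a<..<s}"
        with s bt have "x \<in> S \<inter> {?a<..?b}" by (simp add: S_def)
        from one[OF this] x show False by simp
      qed
      have e2: "jump_times ?Z \<inter> {s<..?b} = {}"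
      proof (rule equals0I)
        fix x assume x: "x \<in> jump_times ?Z \<inter> {s<..?b}"
        with s bt have "x \<in> S \<inter> {?a<..?b}" by (simp add: S_def)
        from one[OF this] x show False by simp
      qed
      have dm: "A \<inter> C = {}" if "A \<subseteq> B" "B \<inter> C = {}" for A B C :: "real set" using that by blast
      note eL = dm[OF jump_times_NL(2)[OF \<omega>] e1] dm[OF jump_times_NL(2)[OF \<omega>] e2]
      note eN = dm[OF jump_times_NL(1)[OF \<omega>] e1]
      have as: "?a < s" "s \<le> ?b" using s by auto
      have "left_lim (\<lambda>t. N t \<omega>) s = N ?a \<omega>" by (rule pure_jump_left_lim[OF pure_N[OF \<omega>] a0 as(1) eN])
      moreover have "jump (\<lambda>t. L t \<omega>) s = L s \<omega> - L ?a \<omega>" by (rule pure_jump_step[OF pure_L[OF \<omega>] a0 as(1) eL(1)])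
      moreover have "L ?b \<omega> = L s \<omega>" by (rule pure_jump_const[OF pure_L[OF \<omega>] _ as(2) eL(2)]) (use a0 as in simp)
      ultimately show ?thesis using Ss by (simp add: incr_def)
    qed
    show "s \<in> S \<inter> {?a<..?b} \<Longrightarrow> snd (incr h i \<omega>) = jump (\<lambda>t. L t \<omega>) s" by (rule conjunct1[OF step])
    show "c powr (- N ?a \<omega>) * snd (incr h i \<omega>) = (\<Sum>s\<in>S \<inter> {?a<..?b}. g s)"
    proof (cases "S \<inter> {?a<..?b} = {}")
      case True
      have "jump_times ?Z \<inter> {?a<..?b} \<subseteq> S \<inter> {?a<..?b}" using bt by (auto simp: S_def)
      then have "jump_times ?Z \<inter> {?a<..?b} = {}" unfolding True by blast
      then have "jump_times (\<lambda>t. L t \<omega>) \<inter> {?a<..?b} = {}" using jump_times_NL(2)[OF \<omega>] by blast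
      then have "L ?b \<omega> = L ?a \<omega>" using ab by (intro pure_jump_const[OF pure_L[OF \<omega>] a0]) auto
      then show ?thesis using True by (simp add: incr_def)
    next
      case False
      then obtain s where "s \<in> S \<inter> {?a<..?b}" by blast
      from step[OF this] show ?thesis by (simp add: g_def)
    qed
  qed
  have part: "(\<Sum>i<m. \<Sum>s\<in>S \<inter> {real i * h<..real (Suc i) * h}. g s) = (\<Sum>s\<in>S \<inter> {0<..real m * h}. g s)" if h: "0 < h" for h m
  proof (induction m)
    case (Suc m)
    have "real m * h \<le> real (Suc m) * h" "0 \<le> real m * h" using h by (auto intro!: mult_right_mono)
    then have u: "S \<inter> {0<..real (Suc m) * h} = (S \<inter> {0<..real m * h}) \<union> (S \<inter> {real m * h<..real (Suc m) * h})" by auto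
    show ?case unfolding u sum.lessThan_Suc Suc using fS by (subst sum.union_disjoint) auto
  qed simp
  have St: "S \<inter> {0<..t} = S" using S0 by (auto simp: S_def)
  show ?thesis
  proof (rule that[OF \<delta>0])
    fix h m assume h: "0 < h" "h < \<delta>" "real m * h = t"
    have "Ih h m \<omega> = (\<Sum>i<m. \<Sum>s\<in>S \<inter> {real i * h<..real (Suc i) * h}. g s)"
      unfolding Ih_def using cell(1)[OF h] by (intro sum.cong) auto
    then show "Ih h m \<omega> = exp_integral c N L t \<omega>" using part[OF h(1)] h(3) expi St by simp
    fix s assume s: "s \<in> jump_times (\<lambda>t. L t \<omega>)" "s \<le> t"
    then have sS: "s \<in> S" using jump_times_NL[OF \<omega>] by (auto simp: S_def)
    \<comment> \<open>Cells are open on the left and closed on the right, hence the ceiling minus 1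
      as the index of the cell containing \<open>s\<close>.\<close>
    define i where "i = nat (\<lceil>s / h\<rceil> - 1)"
    have s0: "0 < s / h" using S0[OF sS] h(1) by simp
    then have "1 \<le> \<lceil>s / h\<rceil>" by linarith
    then have ri: "real i = of_int \<lceil>s / h\<rceil> - 1" by (simp add: i_def)
    have "real i < s / h" "s / h \<le> real (Suc i)" using ri by (simp_all) linarith+
    then have si: "real i * h < s" "s \<le> real (Suc i) * h" using h(1) by (simp_all add: field_simps)
    have "real i * h < real m * h" unfolding h(3) using si s by linarith
    then have im: "i < m" using h(1) by simp
    with cell(2)[OF h im, of s] si sS show "\<exists>i<m. snd (incr h i \<omega>) = jump (\<lambda>t. L t \<omega>) s" by auto
  qed
qed

lemma Ih_lim:
  assumes \<omega>: "\<omega> \<in> space M" and t: "0 < t"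
  shows "(\<lambda>j. Ih (t / real (Suc j)) (Suc j) \<omega>) \<longlonglongrightarrow> exp_integral c N L t \<omega>"
proof -
  obtain \<delta> where \<delta>: "0 < \<delta>" "\<And>h m. 0 < h \<Longrightarrow> h < \<delta> \<Longrightarrow> real m * h = t \<Longrightarrow> Ih h m \<omega> = exp_integral c N L t \<omega>"
    using Ih_path[OF \<omega> less_imp_le[OF t]] by metis
  have "(\<lambda>j. t * inverse (real (Suc j))) \<longlonglongrightarrow> 0"
    by (rule tendsto_mult_right_zero[OF LIMSEQ_inverse_real_of_nat])
  then have "eventually (\<lambda>j. t * inverse (real (Suc j)) < \<delta>) sequentially" by (rule order_tendstoD(2)[OF _ \<delta>(1)])
  then have "eventually (\<lambda>j. Ih (t / real (Suc j)) (Suc j) \<omega> = exp_integral c N L t \<omega>) sequentially"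
  proof eventually_elim
    case (elim j)
    then show ?case using t by (intro \<delta>(2)) (auto simp: divide_inverse)
  qed
  then show ?thesis by (rule tendsto_eventually)
qed

lemma measurable_Ih: "0 < h \<Longrightarrow> Ih h m \<in> borel_measurable M"
proof -
  assume h: "0 < h"
  have [measurable]: "(\<lambda>\<omega>. snd (incr h i \<omega>)) \<in> borel_measurable M" for i
    by (rule measurable_compose[OF measurable_incr[OF h] measurable_fst_snd(2)])
  have cN: "(\<lambda>x. c powr (- x)) \<in> borel_measurable borel" by measurable
  have "(\<lambda>\<omega>. c powr (- N (real i * h) \<omega>)) \<in> borel_measurable M" for i
    using h by (intro measurable_compose[OF measurable_N cN]) simp
  then show ?thesis unfolding Ih_def[abs_def] by measurable
qed

lemma exp_integral_0: "t \<le> 0 \<Longrightarrow> exp_integral c N L t \<omega> = 0"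
proof -
  assume "t \<le> 0"
  then have "jump_times (\<lambda>t. L t \<omega>) \<inter> {..t} = {}" by (auto simp: jump_times_def)
  then show ?thesis by (simp add: exp_integral_def)
qed

lemma measurable_exp_integral: "(\<lambda>\<omega>. exp_integral c N L t \<omega>) \<in> borel_measurable M"
proof (cases "0 < t")
  case True
  show ?thesis
  proof (rule borel_measurable_LIMSEQ_real)
    show "(\<lambda>j. Ih (t / real (Suc j)) (Suc j) \<omega>) \<longlonglongrightarrow> exp_integral c N L t \<omega>" if "\<omega> \<in> space M" for \<omega>
      by (rule Ih_lim[OF that True])
    show "Ih (t / real (Suc j)) (Suc j) \<in> borel_measurable M" for j
      by (rule measurable_Ih) (use True in simp)
  qed
next
  case False
  then show ?thesis by (simp add: exp_integral_0)
qed


lemma exp_integral_right: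
  assumes \<omega>: "\<omega> \<in> space M"
  obtains q :: rat where "t < of_rat q" "exp_integral c N L (of_rat q) \<omega> = exp_integral c N L t \<omega>"
proof -
  obtain e where e: "0 < e" "jump_times (\<lambda>t. L t \<omega>) \<inter> {t<..t + e} = {}"
    using pure_jump_gap[OF pure_L[OF \<omega>]] by blast
  obtain q where q: "t < of_rat q" "of_rat q < t + e" using of_rat_dense[of t "t + e"] e by auto
  have "jump_times (\<lambda>t. L t \<omega>) \<inter> {..of_rat q} = jump_times (\<lambda>t. L t \<omega>) \<inter> {..t}"
  proof -
    have "x \<le> t" if "x \<in> jump_times (\<lambda>t. L t \<omega>)" "x \<le> of_rat q" for x
    proof (rule ccontr)
      assume "\<not> x \<le> t"
      then have "x \<in> jump_times (\<lambda>t. L t \<omega>) \<inter> {t<..t + e}" using that q by simp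
      with e(2) show False by simp
    qed
    then show ?thesis using q(1) by force
  qed
  then show ?thesis using that[OF q(1)] by (simp add: exp_integral_def)
qed

text \<open>Cauchy criterion over rational times and errors 1/(k + 1): countably many conditions, so
  the set of convergence is measurable. Rational times suffice because the integral is constant on a
  short interval to the right of any time.\<close>

definition conv_pred :: "'a \<Rightarrow> bool" where
  "conv_pred \<omega> \<longleftrightarrow> (\<forall>k::nat. \<exists>n::nat. \<forall>p q::rat. real n \<le> of_rat p \<longrightarrow> real n \<le> of_rat q \<longrightarrow>
     \<bar>exp_integral c N L (of_rat p) \<omega> - exp_integral c N L (of_rat q) \<omega>\<bar> < 1 / real (Suc k))"

lemma conv_pred_iff:
  assumes \<omega>: "\<omega> \<in> space M"
  shows "conv_pred \<omega> \<longleftrightarrow> (\<exists>l. ((\<lambda>t. exp_integral c N L t \<omega>) \<longlongrightarrow> l) at_top)"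
proof
  let ?I = "\<lambda>t. exp_integral c N L t \<omega>"
  assume P: "conv_pred \<omega>"
  have C: "\<exists>n::nat. \<forall>s t. real n \<le> s \<longrightarrow> real n \<le> t \<longrightarrow> \<bar>?I s - ?I t\<bar> < e" if e: "0 < e" for e
  proof -
    obtain k where k: "1 / real (Suc k) < e" using e nat_approx_posE by blast
    obtain n :: nat where n: "\<And>p q::rat. real n \<le> of_rat p \<Longrightarrow> real n \<le> of_rat q \<Longrightarrow> \<bar>?I (of_rat p) - ?I (of_rat q)\<bar> < 1 / real (Suc k)"
      using P unfolding conv_pred_def by blast
    have "\<bar>?I s - ?I t\<bar> < e" if "real n \<le> s" "real n \<le> t" for s t
    proof -
      obtain p where p: "s < of_rat p" "?I (of_rat p) = ?I s" using exp_integral_right[OF \<omega>] by metis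
      obtain q where q: "t < of_rat q" "?I (of_rat q) = ?I t" using exp_integral_right[OF \<omega>] by metis
      show ?thesis using n[of p q] p q k that by simp
    qed
    then show ?thesis by blast
  qed
  have "Cauchy (\<lambda>n. ?I (real n))"
    unfolding Cauchy_def dist_real_def
  proof (intro allI impI)
    fix e :: real assume "0 < e"
    from C[OF this] obtain n :: nat where "\<And>s t. real n \<le> s \<Longrightarrow> real n \<le> t \<Longrightarrow> \<bar>?I s - ?I t\<bar> < e" by blast
    then show "\<exists>Ma. \<forall>m\<ge>Ma. \<forall>n\<ge>Ma. \<bar>?I (real m) - ?I (real n)\<bar> < e" by (intro exI[of _ n]) auto
  qed
  then obtain l where l: "(\<lambda>n. ?I (real n)) \<longlonglongrightarrow> l" using Cauchy_convergent convergent_def by blast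
  have "(?I \<longlongrightarrow> l) at_top"
  proof (rule tendstoI)
    fix e :: real assume e: "0 < e"
    from C[of "e/2"] e obtain n :: nat where n: "\<And>s t. real n \<le> s \<Longrightarrow> real n \<le> t \<Longrightarrow> \<bar>?I s - ?I t\<bar> < e / 2" by auto
    from l e have "eventually (\<lambda>m. dist (?I (real m)) l < e / 2) sequentially" by (intro tendstoD) auto
    then have "eventually (\<lambda>m. dist (?I (real m)) l < e / 2 \<and> n \<le> m) sequentially"
      using eventually_ge_at_top by (rule eventually_conj)
    then obtain m where m: "dist (?I (real m)) l < e / 2" "n \<le> m" by (auto simp: eventually_sequentially)
    have "dist (?I t) l < e" if "real n \<le> t" for t
      using n[OF that, of "real m"] m by (simp add: dist_real_def abs_if split: if_splits)
    then show "eventually (\<lambda>t. dist (?I t) l < e) at_top" using eventually_at_top_linorder by blast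
  qed
  then show "\<exists>l. (?I \<longlongrightarrow> l) at_top" by blast
next
  let ?I = "\<lambda>t. exp_integral c N L t \<omega>"
  assume "\<exists>l. (?I \<longlongrightarrow> l) at_top"
  then obtain l where l: "(?I \<longlongrightarrow> l) at_top" by blast
  show "conv_pred \<omega>" unfolding conv_pred_def
  proof
    fix k :: nat
    have "eventually (\<lambda>t. dist (?I t) l < 1 / real (Suc k) / 2) at_top" by (rule tendstoD[OF l]) simp
    then obtain b where b: "\<And>t. b \<le> t \<Longrightarrow> dist (?I t) l < 1 / real (Suc k) / 2" by (auto simp: eventually_at_top_linorder)
    obtain n where "b \<le> real n" using real_arch_simple by blast
    then have bn: "dist (?I t) l < 1 / real (Suc k) / 2" if "real n \<le> t" for t using b[of t] that by linarith
    have "\<bar>?I (of_rat p) - ?I (of_rat q)\<bar> < 1 / real (Suc k)" if "real n \<le> of_rat p" "real n \<le> of_rat q" for p q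
      using dist_triangle_half_l[OF bn[OF that(1)] bn[OF that(2)]] by (simp only: dist_real_def)
    then show "\<exists>n::nat. \<forall>p q::rat. real n \<le> of_rat p \<longrightarrow> real n \<le> of_rat q \<longrightarrow> \<bar>?I (of_rat p) - ?I (of_rat q)\<bar> < 1 / real (Suc k)"
      by blast
  qed
qed

lemma measurable_mu: "(\<lambda>\<omega>. Lim at_top (\<lambda>t. exp_integral c N L t \<omega>)) \<in> borel_measurable M"
proof -
  note [measurable] = measurable_exp_integral
  have [measurable]: "Measurable.pred M conv_pred" unfolding conv_pred_def[abs_def] by measurable
  have [measurable]: "(\<lambda>\<omega>. lim (\<lambda>n. exp_integral c N L (real n) \<omega>)) \<in> borel_measurable M"
    by (rule borel_measurable_lim_metric) measurable
  \<comment> \<open>Without convergence \<open>Lim\<close> is the description of an unsatisfiable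
    predicate, the same real number at all such sample points. So the limit is measurable without
    removing a null set.\<close>
  have e: "Lim at_top (\<lambda>t. exp_integral c N L t \<omega>) =
     (if conv_pred \<omega> then lim (\<lambda>n. exp_integral c N L (real n) \<omega>) else (THE l::real. False))"
    if \<omega>: "\<omega> \<in> space M" for \<omega>
  proof (cases "conv_pred \<omega>")
    case True
    then obtain l where l: "((\<lambda>t. exp_integral c N L t \<omega>) \<longlongrightarrow> l) at_top" using conv_pred_iff[OF \<omega>] by blast
    then have "Lim at_top (\<lambda>t. exp_integral c N L t \<omega>) = l" by (intro tendsto_Lim) auto
    moreover have "lim (\<lambda>n. exp_integral c N L (real n) \<omega>) = l"
      by (rule limI[OF filterlim_compose[OF l filterlim_real_sequentially]])
    ultimately show ?thesis using True by simp
  next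
    case False
    then have "(\<lambda>l. ((\<lambda>t. exp_integral c N L t \<omega>) \<longlongrightarrow> l) at_top) = (\<lambda>l. False)"
      using conv_pred_iff[OF \<omega>] by auto
    then show ?thesis using False by (simp add: Topological_Spaces.Lim_def)
  qed
  have "(\<lambda>\<omega>. if conv_pred \<omega> then lim (\<lambda>n. exp_integral c N L (real n) \<omega>) else (THE l::real. False)) \<in> borel_measurable M"
    by measurable
  then show ?thesis by (subst measurable_cong[OF e]) auto
qed

end

section \<open>Auxiliary facts: exponentials, monotone limits, independent pairs\<close>

lemma norm_iexp_diff_le: "norm (iexp a - iexp b) \<le> \<bar>a - b\<bar>"
proof -
  have "iexp a - iexp b = iexp b * (iexp (a - b) - 1)"
    by (simp add: algebra_simps flip: exp_add)
  then have "norm (iexp a - iexp b) = norm (iexp (a - b) - 1)" by (simp add: norm_mult)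
  also have "\<dots> \<le> \<bar>a - b\<bar>" using iexp_approx1[of "a - b" 0] by simp
  finally show ?thesis .
qed

lemma mono_bounded_tendsto_at_top:
  fixes f :: "real \<Rightarrow> real"
  assumes f: "mono f" and B: "\<And>t. f t \<le> B"
  obtains l where "(f \<longlongrightarrow> l) at_top"
proof
  have bdd: "bdd_above (range f)" by (rule bdd_aboveI2) (rule B)
  show "(f \<longlongrightarrow> (SUP t. f t)) at_top"
  proof (rule order_tendstoI)
    fix a assume "a < (SUP t. f t)"
    then obtain t0 where "a < f t0" using less_cSUP_iff[OF _ bdd] by auto
    then show "eventually (\<lambda>t. a < f t) at_top"
      using f by (intro eventually_at_top_linorderI[of t0]) (meson less_le_trans monoD)
  next
    fix a assume "(SUP t. f t) < a"
    then show "eventually (\<lambda>t. f t < a) at_top"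
      using cSUP_upper[OF _ bdd] by (intro always_eventually allI) (meson UNIV_I le_less_trans)
  qed
qed

lemma (in prob_space) expectation_indep_pair:
  fixes G :: "'b \<times> 'b \<Rightarrow> complex"
  assumes ind: "indep_var S X T Y" and G: "G \<in> borel_measurable (S \<Otimes>\<^sub>M T)" and B: "\<And>x. norm (G x) \<le> B"
  shows "(CLINT \<omega>|M. G (X \<omega>, Y \<omega>)) = (CLINT \<omega>|M. (CLINT \<omega>'|M. G (X \<omega>, Y \<omega>')))"
proof -
  have X[measurable]: "random_variable S X" and Y[measurable]: "random_variable T Y"
    and D: "distr M S X \<Otimes>\<^sub>M distr M T Y = distr M (S \<Otimes>\<^sub>M T) (\<lambda>x. (X x, Y x))"
    using ind unfolding indep_var_distribution_eq by auto
  note [measurable] = G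
  interpret X: prob_space "distr M S X" by (rule prob_space_distr) fact
  interpret Y: prob_space "distr M T Y" by (rule prob_space_distr) fact
  interpret XY: pair_prob_space "distr M S X" "distr M T Y" ..
  have int: "integrable (distr M S X \<Otimes>\<^sub>M distr M T Y) G"
    by (rule XY.integrable_const_bound[where B=B]) (use B in auto)
  have "(CLINT \<omega>|M. G (X \<omega>, Y \<omega>)) = (CLINT p|distr M (S \<Otimes>\<^sub>M T) (\<lambda>x. (X x, Y x)). G p)"
    by (subst integral_distr) auto
  also have "\<dots> = (CLINT x|distr M S X. CLINT y|distr M T Y. G (x, y))"
    unfolding D[symmetric] by (rule XY.integral_fst'[OF int, symmetric])
  also have "\<dots> = (CLINT x|distr M S X. CLINT \<omega>'|M. G (x, Y \<omega>'))"
    by (intro Bochner_Integration.integral_cong refl) (subst integral_distr, auto)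
  also have "\<dots> = (CLINT \<omega>|M. (CLINT \<omega>'|M. G (X \<omega>, Y \<omega>')))"
  proof (subst integral_distr[OF X])
    have "(\<lambda>x. CLINT y|distr M T Y. G (x, y)) \<in> borel_measurable S" by measurable
    then show "(\<lambda>x. CLINT \<omega>'|M. G (x, Y \<omega>')) \<in> borel_measurable S"
      by (rule measurable_cong[THEN iffD1, rotated]) (subst integral_distr, auto)
  qed simp
  finally show ?thesis .
qed

section \<open>Recursion for the Riemann sums in the number of cells\<close>

context realization
begin

text \<open>The Riemann sum as a function of the sequence of increments. Here the first cell can be
  split off: what remains is the same sum for the shifted sequence, discounted by
  \<open>c powr (- fst (d 0))\<close>. This self-similarity is the source of the functional equation
  for \<mu>.\<close>

definition Phi :: "nat \<Rightarrow> (nat \<Rightarrow> real \<times> real) \<Rightarrow> real" where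
  "Phi m d = (\<Sum>i<m. c powr (- (\<Sum>j<i. fst (d j))) * snd (d i))"

lemma Phi_Suc: "Phi (Suc m) d = snd (d 0) + c powr (- fst (d 0)) * Phi m (\<lambda>i. d (Suc i))"
proof -
  have "Phi (Suc m) d = snd (d 0) + (\<Sum>i<m. c powr (- (\<Sum>j<Suc i. fst (d j))) * snd (d (Suc i)))"
    using c1 unfolding Phi_def by (subst sum.lessThan_Suc_shift) simp
  also have "(\<Sum>i<m. c powr (- (\<Sum>j<Suc i. fst (d j))) * snd (d (Suc i))) = c powr (- fst (d 0)) * Phi m (\<lambda>i. d (Suc i))"
    unfolding Phi_def sum_distrib_left
  proof (rule sum.cong[OF refl])
    fix i
    have "- (\<Sum>j<Suc i. fst (d j)) = - fst (d 0) + - (\<Sum>j<i. fst (d (Suc j)))"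
      by (subst sum.lessThan_Suc_shift) simp
    then show "c powr (- (\<Sum>j<Suc i. fst (d j))) * snd (d (Suc i)) =
        c powr (- fst (d 0)) * (c powr (- (\<Sum>j<i. fst (d (Suc j)))) * snd (d (Suc i)))"
      by (simp only: powr_add mult.assoc)
  qed
  finally show ?thesis .
qed

lemma Ih_Phi: "\<omega> \<in> space M \<Longrightarrow> Ih h m \<omega> = Phi m (\<lambda>i. incr h i \<omega>)"
  by (simp add: Ih_def Phi_def sum_incr)

text \<open>The second variable is paired with a constant 0 because \<open>indep_var\<close> takes
  two variables of the same type.\<close>

lemma indep_incr_Phi:
  assumes h: "0 < h"
  shows "indep_var borel (incr h a) borel (\<lambda>\<omega>. (Phi m (\<lambda>i. incr h (Suc a + i) \<omega>), 0))"
proof -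
  let ?A = "{a}" and ?B = "{Suc a..<Suc a + m}"
  have ind: "indep_var (PiM ?A (\<lambda>_. borel)) (\<lambda>\<omega>. restrict (\<lambda>i. incr h i \<omega>) ?A) (PiM ?B (\<lambda>_. borel)) (\<lambda>\<omega>. restrict (\<lambda>i. incr h i \<omega>) ?B)"
    by (rule indep_var_restrict[OF incr_indep[OF h, of "Suc a + m"]]) auto
  have m1: "(\<lambda>f. f a) \<in> measurable (PiM ?A (\<lambda>_. borel)) borel" by (rule measurable_component_singleton) simp
  have comp: "(\<lambda>f. f (Suc a + i)) \<in> measurable (PiM ?B (\<lambda>_. borel)) borel" if "i < m" for i
    by (rule measurable_component_singleton) (use that in simp)
  have m2: "(\<lambda>f. Phi m (\<lambda>i. f (Suc a + i))) \<in> measurable (PiM ?B (\<lambda>_. borel :: (real \<times> real) measure)) borel"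
    unfolding Phi_def
  proof (rule borel_measurable_sum)
    fix i assume "i \<in> {..<m}"
    then have i: "i < m" by simp
    have f: "(\<lambda>f. fst (f (Suc a + j))) \<in> borel_measurable (PiM ?B (\<lambda>_. borel :: (real \<times> real) measure))" if "j < m" for j
      by (rule measurable_compose[OF comp[OF that] measurable_fst_snd(1)])
    have s: "(\<lambda>f. snd (f (Suc a + i))) \<in> borel_measurable (PiM ?B (\<lambda>_. borel :: (real \<times> real) measure))"
      by (rule measurable_compose[OF comp[OF i] measurable_fst_snd(2)])
    have "(\<lambda>f. \<Sum>j<i. fst (f (Suc a + j))) \<in> borel_measurable (PiM ?B (\<lambda>_. borel :: (real \<times> real) measure))"
      using i by (intro borel_measurable_sum f) auto
    moreover have "(\<lambda>x. c powr (- x)) \<in> borel_measurable borel" by measurable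
    ultimately have "(\<lambda>f. c powr (- (\<Sum>j<i. fst (f (Suc a + j))))) \<in> borel_measurable (PiM ?B (\<lambda>_. borel :: (real \<times> real) measure))"
      by (rule measurable_compose)
    then show "(\<lambda>f. c powr (- (\<Sum>j<i. fst (f (Suc a + j)))) * snd (f (Suc a + i))) \<in> borel_measurable (PiM ?B (\<lambda>_. borel :: (real \<times> real) measure))"
      using s by (rule borel_measurable_times)
  qed
  have m3: "(\<lambda>f. (Phi m (\<lambda>i. f (Suc a + i)), 0)) \<in> measurable (PiM ?B (\<lambda>_. borel :: (real \<times> real) measure)) (borel :: (real \<times> real) measure)"
    by (intro borel_measurable_Pair m2 borel_measurable_const)
  have "Phi m (\<lambda>i. restrict (\<lambda>i. incr h i \<omega>) ?B (Suc a + i)) = Phi m (\<lambda>i. incr h (Suc a + i) \<omega>)" for \<omega>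
    unfolding Phi_def by (intro sum.cong refl arg_cong2[where f="(*)"] arg_cong2[where f="(powr)"] arg_cong[where f=uminus]) auto
  with indep_var_compose[OF ind m1 m3] show ?thesis by (simp add: comp_def)
qed

definition psi :: "real \<Rightarrow> nat \<Rightarrow> real \<Rightarrow> complex" where
  "psi h m z = (CLINT \<omega>|M. iexp (z * Ih h m \<omega>))"

lemma psi_char: "0 < h \<Longrightarrow> psi h m = char (distr M borel (Ih h m))"
  by (rule ext) (simp add: psi_def char_def integral_distr[OF measurable_Ih])

lemma norm_psi: "0 < h \<Longrightarrow> norm (psi h m z) \<le> 1"
  by (simp add: psi_char real_distribution.cmod_char_le_1[OF real_distribution_distr] measurable_Ih)

lemma measurable_psi: "0 < h \<Longrightarrow> psi h m \<in> borel_measurable borel"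
  unfolding psi_char by (intro real_distribution.char_measurable real_distribution_distr measurable_Ih)

definition stepF :: "(real \<Rightarrow> complex) \<Rightarrow> real \<Rightarrow> real \<times> real \<Rightarrow> complex" where
  "stepF f z x = iexp (z * snd x) * f (c powr (- fst x) * z)"

lemma measurable_stepF: "f \<in> borel_measurable borel \<Longrightarrow> stepF f z \<in> borel_measurable borel"
proof -
  assume f: "f \<in> borel_measurable borel"
  have "(\<lambda>x. c powr (- x) * z) \<in> borel_measurable borel" by measurable
  from measurable_compose[OF measurable_compose[OF measurable_fst_snd(1) this] f]
  have [measurable]: "(\<lambda>x::real \<times> real. f (c powr (- fst x) * z)) \<in> borel_measurable borel" .
  have [measurable]: "(\<lambda>x::real \<times> real. iexp (z * snd x)) \<in> borel_measurable borel"
    by (intro borel_measurable_continuous_onI continuous_intros)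
  show ?thesis unfolding stepF_def[abs_def] by measurable
qed

lemma norm_stepF: "(\<And>z. norm (f z) \<le> 1) \<Longrightarrow> norm (stepF f z x) \<le> 1"
  by (simp add: stepF_def norm_mult)

text \<open>Splitting off the first cell leaves a sum that starts one cell later. Independence of
  the starting cell and the recursion in \<open>m\<close> are therefore obtained in one
  induction.\<close>

lemma psi_shift:
  assumes h: "0 < h"
  shows "(CLINT \<omega>|M. iexp (z * Phi m (\<lambda>i. incr h (a + i) \<omega>))) = psi h m z"
    and "psi h (Suc m) z = (CLINT \<omega>|M. stepF (psi h m) z (incr h 0 \<omega>))"
proof -
  have psi0: "psi h m z = (CLINT \<omega>|M. iexp (z * Phi m (\<lambda>i. incr h (0 + i) \<omega>)))" for m z
    unfolding psi_def by (intro Bochner_Integration.integral_cong refl) (simp add: Ih_Phi)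
  have step: "(CLINT \<omega>|M. iexp (z * Phi (Suc m) (\<lambda>i. incr h (a + i) \<omega>))) = (CLINT \<omega>|M. stepF (psi h m) z (incr h 0 \<omega>))"
    if IH: "\<And>a z. (CLINT \<omega>|M. iexp (z * Phi m (\<lambda>i. incr h (a + i) \<omega>))) = psi h m z" for m a z
  proof -
    define G where "G p = iexp (z * snd (fst p) + c powr (- fst (fst p)) * z * fst (snd p))" for p :: "(real \<times> real) \<times> (real \<times> real)"
    have Gm: "G \<in> borel_measurable (borel \<Otimes>\<^sub>M borel)"
      unfolding G_def[abs_def] by measurable
    have e: "iexp (z * Phi (Suc m) (\<lambda>i. incr h (a + i) \<omega>)) = G (incr h a \<omega>, (Phi m (\<lambda>i. incr h (Suc a + i) \<omega>), 0))" for \<omega>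
      by (simp add: Phi_Suc G_def algebra_simps)
    have "(CLINT \<omega>|M. iexp (z * Phi (Suc m) (\<lambda>i. incr h (a + i) \<omega>))) =
       (CLINT \<omega>|M. (CLINT \<omega>'|M. G (incr h a \<omega>, (Phi m (\<lambda>i. incr h (Suc a + i) \<omega>'), 0))))"
      unfolding e by (rule expectation_indep_pair[OF indep_incr_Phi[OF h] Gm, where B=1]) (simp add: G_def)
    also have "\<dots> = (CLINT \<omega>|M. stepF (psi h m) z (incr h a \<omega>))"
    proof (intro Bochner_Integration.integral_cong refl)
      fix \<omega>
      have "(CLINT \<omega>'|M. G (incr h a \<omega>, (Phi m (\<lambda>i. incr h (Suc a + i) \<omega>'), 0))) =
        (CLINT \<omega>'|M. iexp (z * snd (incr h a \<omega>)) * iexp (c powr (- fst (incr h a \<omega>)) * z * Phi m (\<lambda>i. incr h (Suc a + i) \<omega>')))"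
        by (simp only: G_def iexp_add fst_conv snd_conv)
      also have "\<dots> = stepF (psi h m) z (incr h a \<omega>)"
        by (simp only: integral_mult_right_zero IH stepF_def)
      finally show "(CLINT \<omega>'|M. G (incr h a \<omega>, (Phi m (\<lambda>i. incr h (Suc a + i) \<omega>'), 0))) = stepF (psi h m) z (incr h a \<omega>)" .
    qed
    also have "\<dots> = (CLINT \<omega>|M. stepF (psi h m) z (incr h 0 \<omega>))"
      using h by (simp only: expectation_incr measurable_stepF measurable_psi)
    finally show ?thesis .
  qed
  have all: "(CLINT \<omega>|M. iexp (z * Phi m (\<lambda>i. incr h (a + i) \<omega>))) = psi h m z" for m a z
  proof (induction m arbitrary: a z)
    case 0
    show ?case by (simp add: psi0 Phi_def)
  next
    case (Suc m)
    show ?case unfolding psi0 using step[OF Suc, of z a] step[OF Suc, of z 0] by simp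
  qed
  show "(CLINT \<omega>|M. iexp (z * Phi m (\<lambda>i. incr h (a + i) \<omega>))) = psi h m z" by (rule all)
  show "psi h (Suc m) z = (CLINT \<omega>|M. stepF (psi h m) z (incr h 0 \<omega>))"
    unfolding psi0[of "Suc m"] by (rule step[OF all])
qed

text \<open>The generator applied to \<open>stepF f z\<close>. The equation Aop f z = 0 is the
  functional equation for the characteristic function of \<mu>, cleared of denominators.\<close>

definition Aop :: "(real \<Rightarrow> complex) \<Rightarrow> real \<Rightarrow> complex" where
  "Aop f z = of_real u * f (z / c) + of_real v * (iexp z * f z) + of_real w * (iexp (z * al) * f (z / c)) - of_real tot * f z"

lemma gen_stepF: "gen (stepF f z) = Aop f z"
  using c1 by (simp add: gen_def stepF_def Aop_def powr_minus_divide)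

text \<open>Discount over one cell. The cutoff at 0 bounds it everywhere and changes it only on a
  null set, the increments of \<open>N\<close> being nonnegative almost surely.\<close>

definition Wt :: "real \<times> real \<Rightarrow> real" where
  "Wt x = c powr (- max 0 (fst x))"

lemma Wt_bounds: "0 \<le> Wt x" "Wt x \<le> 1"
proof -
  show "0 \<le> Wt x" by (simp add: Wt_def)
  have "c powr (- max 0 (fst x)) \<le> c powr 0" using c1 by (intro powr_mono) auto
  then show "Wt x \<le> 1" using c1 by (simp add: Wt_def)
qed

lemma measurable_Wt[measurable]: "Wt \<in> borel_measurable borel"
  unfolding Wt_def[abs_def] by measurable

text \<open>\<open>kap h\<close> is the mean discount over one cell, equal to 1 - eta h up to
  O(h^2); \<open>ell\<close> is the mean growth rate of \<open>L\<close>.\<close>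

definition kap :: "real \<Rightarrow> real" where "kap h = (LINT \<omega>|M. Wt (incr h 0 \<omega>))"
definition eta :: real where "eta = (u + w) * (1 - 1 / c)"
definition ell :: real where "ell = v + w * al"

lemma eta0: "0 < eta" using u0 w0 c1 by (simp add: eta_def)
lemma ell0: "0 < ell" using v0 w0 al0 by (simp add: ell_def add_pos_pos)

lemma kap_bounds:
  assumes h: "0 < h"
  shows "0 \<le> kap h" "kap h \<le> 1 - h * eta + 3 * tot\<^sup>2 * h\<^sup>2"
proof -
  show "0 \<le> kap h" unfolding kap_def by (simp add: Wt_bounds)
  have m: "(\<lambda>x. complex_of_real (Wt x)) \<in> borel_measurable borel" by measurable
  have n: "norm (complex_of_real (Wt x)) \<le> 1" for x using Wt_bounds[of x] by simp
  have g: "gen (\<lambda>x. of_real (Wt x)) = of_real (- eta)"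
    using c1 by (simp add: gen_def Wt_def eta_def tot_def powr_minus_divide field_simps)
  have W0: "Wt 0 = 1" using c1 by (simp add: Wt_def)
  have "norm (complex_of_real (kap h) - 1 - of_real h * of_real (- eta)) \<le> 3 * 1 * (tot * h)\<^sup>2"
    using generator_incr[OF h m n, of 0] unfolding g W0 kap_def integral_complex_of_real by simp
  moreover have "complex_of_real (kap h) - 1 - of_real h * of_real (- eta) = of_real (kap h - 1 + h * eta)" by simp
  ultimately have "\<bar>kap h - 1 + h * eta\<bar> \<le> 3 * (tot * h)\<^sup>2" by (simp only: norm_of_real mult_1_right)
  then show "kap h \<le> 1 - h * eta + 3 * tot\<^sup>2 * h\<^sup>2" by (simp add: power_mult_distrib abs_le_iff)
qed

lemma kap_eq: "0 < h \<Longrightarrow> (\<integral>\<^sup>+\<omega>. ennreal (Wt (incr h i \<omega>)) \<partial>M) = ennreal (kap h)"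
proof -
  assume h: "0 < h"
  have 1: "(\<integral>\<^sup>+\<omega>. ennreal (Wt (incr h i \<omega>)) \<partial>M) = (\<integral>\<^sup>+x. ennreal (Wt x) \<partial>cpois (tot * h) J)" for i
  proof -
    have "(\<integral>\<^sup>+\<omega>. ennreal (Wt (incr h i \<omega>)) \<partial>M) = (\<integral>\<^sup>+x. ennreal (Wt x) \<partial>distr M borel (incr h i))"
      by (rule nn_integral_distr[OF measurable_incr[OF h], symmetric]) measurable
    then show ?thesis unfolding distr_incr[OF h] by (subst (asm) nn_integral_distr) auto
  qed
  have "integrable M (\<lambda>\<omega>. Wt (incr h 0 \<omega>))"
    using Wt_bounds measurable_compose[OF measurable_incr[OF h] measurable_Wt]
    by (intro integrable_const_bound[where B=1]) auto
  then show ?thesis unfolding 1[of i] 1[of 0, symmetric] kap_def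
    by (intro nn_integral_eq_integral) (auto simp: Wt_bounds)
qed

lemma Ih_Suc_AE:
  assumes h: "0 < h"
  shows "AE \<omega> in M. Ih h (Suc m) \<omega> - Ih h m \<omega> = (\<Prod>j<m. Wt (incr h j \<omega>)) * snd (incr h m \<omega>) \<and> 0 \<le> snd (incr h m \<omega>)"
proof -
  have "AE \<omega> in M. \<forall>i. 0 \<le> fst (incr h i \<omega>) \<and> 0 \<le> snd (incr h i \<omega>)"
    using AE_incr_nonneg[OF h] by (simp add: AE_all_countable)
  then show ?thesis using AE_space
  proof eventually_elim
    case (elim \<omega>)
    have "c powr (- N (real m * h) \<omega>) = c powr (\<Sum>j<m. - fst (incr h j \<omega>))"
      using elim by (simp add: sum_incr(1)[symmetric] sum_negf)
    also have "\<dots> = (\<Prod>j<m. Wt (incr h j \<omega>))"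
      using c1 elim by (simp add: powr_sum Wt_def)
    finally show ?case using elim by (simp add: Ih_def)
  qed
qed

text \<open>The new term of the Riemann sum is almost surely a product of m discounts and one
  increment of \<open>L\<close>, all independent, so its mean factorizes.\<close>

lemma nn_Ih_Suc:
  assumes h: "0 < h"
  shows "(\<integral>\<^sup>+\<omega>. ennreal (Ih h (Suc m) \<omega> - Ih h m \<omega>) \<partial>M) \<le> ennreal (kap h ^ m * (h * ell))"
proof -
  define Y where "Y j x = ennreal (if j < m then Wt x else snd x)" for j :: nat and x
  have Ym: "Y j \<in> borel_measurable borel" for j unfolding Y_def[abs_def] by measurable
  have ind: "indep_vars (\<lambda>_. borel) (\<lambda>j \<omega>. Y j (incr h j \<omega>)) {..<Suc m}"
    by (rule indep_vars_compose2[OF incr_indep[OF h] Ym])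
  have "(\<integral>\<^sup>+\<omega>. ennreal (Ih h (Suc m) \<omega> - Ih h m \<omega>) \<partial>M) = (\<integral>\<^sup>+\<omega>. (\<Prod>j<Suc m. Y j (incr h j \<omega>)) \<partial>M)"
  proof (rule nn_integral_cong_AE)
    show "AE \<omega> in M. ennreal (Ih h (Suc m) \<omega> - Ih h m \<omega>) = (\<Prod>j<Suc m. Y j (incr h j \<omega>))"
      using Ih_Suc_AE[OF h, of m]
    proof eventually_elim
      case (elim \<omega>)
      have "(\<Prod>j<m. Y j (incr h j \<omega>)) = ennreal (\<Prod>j<m. Wt (incr h j \<omega>))"
        by (simp add: Y_def prod_ennreal Wt_bounds)
      then show ?case using elim by (simp add: Y_def ennreal_mult prod_nonneg Wt_bounds)
    qed
  qed
  also have "\<dots> = (\<Prod>j<Suc m. \<integral>\<^sup>+\<omega>. Y j (incr h j \<omega>) \<partial>M)"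
    by (rule indep_vars_nn_integral[OF _ ind]) auto
  also have "\<dots> = ennreal (kap h) ^ m * (\<integral>\<^sup>+\<omega>. ennreal (snd (incr h m \<omega>)) \<partial>M)"
    by (simp add: Y_def kap_eq[OF h])
  also have "\<dots> \<le> ennreal (kap h) ^ m * ennreal (h * ell)"
    unfolding ell_def by (intro mult_left_mono nn_integral_incr_le h) simp
  also have "\<dots> = ennreal (kap h ^ m * (h * ell))"
    using kap_bounds(1)[OF h] h ell0 by (simp add: ennreal_mult ennreal_power)
  finally show ?thesis .
qed

lemma psi_diff:
  assumes h: "0 < h"
  shows "norm (psi h (Suc m) z - psi h m z) \<le> \<bar>z\<bar> * (kap h ^ m * (h * ell))"
proof -
  note [measurable] = measurable_Ih[OF h]
  let ?d = "\<lambda>\<omega>. iexp (z * Ih h (Suc m) \<omega>) - iexp (z * Ih h m \<omega>)"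
  have i: "integrable M (\<lambda>\<omega>. iexp (z * Ih h m \<omega>))" for m by (intro integrable_iexp) measurable
  have id: "integrable M ?d" by (intro Bochner_Integration.integrable_diff i)
  have "psi h (Suc m) z - psi h m z = (CLINT \<omega>|M. ?d \<omega>)"
    unfolding psi_def by (rule Bochner_Integration.integral_diff[symmetric]) (rule i)+
  then have "norm (psi h (Suc m) z - psi h m z) \<le> (LINT \<omega>|M. norm (?d \<omega>))" by (simp only: integral_norm_bound)
  moreover have "ennreal (LINT \<omega>|M. norm (?d \<omega>)) \<le> ennreal (\<bar>z\<bar> * (kap h ^ m * (h * ell)))"
  proof -
    have "ennreal (LINT \<omega>|M. norm (?d \<omega>)) = (\<integral>\<^sup>+\<omega>. ennreal (norm (?d \<omega>)) \<partial>M)"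
      by (rule nn_integral_eq_integral[symmetric]) (use id in auto)
    also have "\<dots> \<le> (\<integral>\<^sup>+\<omega>. ennreal \<bar>z\<bar> * ennreal (Ih h (Suc m) \<omega> - Ih h m \<omega>) \<partial>M)"
    proof (rule nn_integral_mono_AE)
      show "AE \<omega> in M. ennreal (norm (?d \<omega>)) \<le> ennreal \<bar>z\<bar> * ennreal (Ih h (Suc m) \<omega> - Ih h m \<omega>)"
        using Ih_Suc_AE[OF h, of m]
      proof eventually_elim
        case (elim \<omega>)
        then have p: "0 \<le> Ih h (Suc m) \<omega> - Ih h m \<omega>" by (simp add: prod_nonneg Wt_bounds)
        have "norm (?d \<omega>) \<le> \<bar>z * Ih h (Suc m) \<omega> - z * Ih h m \<omega>\<bar>" by (rule norm_iexp_diff_le)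
        also have "\<dots> = \<bar>z\<bar> * (Ih h (Suc m) \<omega> - Ih h m \<omega>)" using p by (simp add: abs_mult flip: right_diff_distrib)
        finally show ?case using p by (simp only: ennreal_leI flip: ennreal_mult[OF abs_ge_zero p])
      qed
    qed
    also have "\<dots> = ennreal \<bar>z\<bar> * (\<integral>\<^sup>+\<omega>. ennreal (Ih h (Suc m) \<omega> - Ih h m \<omega>) \<partial>M)"
      by (rule nn_integral_cmult) measurable
    also have "\<dots> \<le> ennreal \<bar>z\<bar> * ennreal (kap h ^ m * (h * ell))"
      by (intro mult_left_mono nn_Ih_Suc h) simp
    also have "\<dots> = ennreal (\<bar>z\<bar> * (kap h ^ m * (h * ell)))"
      using kap_bounds(1)[OF h] h ell0 by (intro ennreal_mult[symmetric]) auto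
    finally show ?thesis .
  qed
  then have "(LINT \<omega>|M. norm (?d \<omega>)) \<le> \<bar>z\<bar> * (kap h ^ m * (h * ell))"
    using kap_bounds(1)[OF h] h ell0 by (subst (asm) ennreal_le_iff) auto
  ultimately show ?thesis by (rule order_trans)
qed

text \<open>Heart of the argument for \<mu>. By the recursion, adding one cell changes
  \<open>psi h m\<close> by h Aop (psi h m) up to O(h^2); on the other hand the added term has mean
  at most h ell kap^m. Comparing the two and dividing by h, the functional equation holds up to
  terms of order kap^m and h.\<close>

lemma Aop_psi:
  assumes h: "0 < h"
  shows "norm (Aop (psi h m) z) \<le> \<bar>z\<bar> * kap h ^ m * ell + 3 * tot\<^sup>2 * h"
proof -
  let ?D = "psi h (Suc m) z - psi h m z"
  have s0: "stepF (psi h m) z 0 = psi h m z" using c1 by (simp add: stepF_def)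
  have g: "norm (?D - of_real h * Aop (psi h m) z) \<le> 3 * 1 * (tot * h)\<^sup>2"
    unfolding psi_shift(2)[OF h] gen_stepF[symmetric] s0[symmetric]
    using generator_incr[OF h measurable_stepF[OF measurable_psi[OF h, of m], of z] norm_stepF[OF norm_psi[OF h, of m]], where i=0]
    by (simp add: s0)
  have "h * norm (Aop (psi h m) z) = norm (?D - (?D - of_real h * Aop (psi h m) z))"
    using h by (simp add: norm_mult)
  also have "\<dots> \<le> norm ?D + norm (?D - of_real h * Aop (psi h m) z)" by (rule norm_triangle_ineq4)
  also have "\<dots> \<le> \<bar>z\<bar> * (kap h ^ m * (h * ell)) + 3 * (tot * h)\<^sup>2"
    using psi_diff[OF h, of m z] g by simp
  also have "\<dots> = h * (\<bar>z\<bar> * kap h ^ m * ell + 3 * tot\<^sup>2 * h)" by (simp add: algebra_simps power2_eq_square)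
  finally show ?thesis using h by simp
qed

end

section \<open>From the Riemann sums to the integral, and on to infinite time\<close>

context realization
begin

definition ft :: "real \<Rightarrow> real \<Rightarrow> complex" where
  "ft t z = (CLINT \<omega>|M. iexp (z * exp_integral c N L t \<omega>))"

lemma psi_lim:
  assumes t: "0 < t"
  shows "(\<lambda>j. psi (t / real (Suc j)) (Suc j) z) \<longlonglongrightarrow> ft t z"
  unfolding psi_def ft_def
proof (rule integral_dominated_convergence[where w="\<lambda>_. 1"])
  have h: "0 < t / real (Suc j)" for j using t by simp
  have m: "(\<lambda>x. iexp (z * x)) \<in> borel_measurable borel"
    by (intro borel_measurable_continuous_onI continuous_intros)
  show "(\<lambda>\<omega>. iexp (z * exp_integral c N L t \<omega>)) \<in> borel_measurable M"
    by (rule measurable_compose[OF measurable_exp_integral m])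
  show "(\<lambda>\<omega>. iexp (z * Ih (t / real (Suc j)) (Suc j) \<omega>)) \<in> borel_measurable M" for j
    by (rule measurable_compose[OF measurable_Ih[OF h] m])
  show "AE \<omega> in M. (\<lambda>j. iexp (z * Ih (t / real (Suc j)) (Suc j) \<omega>)) \<longlonglongrightarrow> iexp (z * exp_integral c N L t \<omega>)"
    by (rule AE_I2) (intro tendsto_intros Ih_lim t)
qed auto

lemma hj_lim: "(\<lambda>j. t / real (Suc j)) \<longlonglongrightarrow> 0"
  using tendsto_mult_right_zero[OF LIMSEQ_inverse_real_of_nat, of t] by (simp add: divide_inverse)

lemma tendsto_Aop:
  assumes "\<And>z. (\<lambda>j. f j z) \<longlonglongrightarrow> g z"
  shows "(\<lambda>j. Aop (f j) z) \<longlonglongrightarrow> Aop g z"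
  unfolding Aop_def by (intro tendsto_intros assms)

text \<open>With j + 1 cells of length t/(j + 1) the factor kap^(j + 1) is at most exp (- t eta)
  times a correction that tends to 1 with the mesh.\<close>

lemma Aop_ft:
  assumes t: "0 < t"
  shows "norm (Aop (ft t) z) \<le> \<bar>z\<bar> * exp (- (t * eta)) * ell"
proof (rule LIMSEQ_le)
  let ?h = "\<lambda>j. t / real (Suc j)"
  show "(\<lambda>j. norm (Aop (psi (?h j) (Suc j)) z)) \<longlonglongrightarrow> norm (Aop (ft t) z)"
    by (intro tendsto_norm tendsto_Aop psi_lim t)
  have "(\<lambda>j. \<bar>z\<bar> * exp (- (t * eta) + 3 * tot\<^sup>2 * t * ?h j) * ell + 3 * tot\<^sup>2 * ?h j) \<longlonglongrightarrow>
     \<bar>z\<bar> * exp (- (t * eta) + 3 * tot\<^sup>2 * t * 0) * ell + 3 * tot\<^sup>2 * 0"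
    by (intro tendsto_intros hj_lim)
  then show "(\<lambda>j. \<bar>z\<bar> * exp (- (t * eta) + 3 * tot\<^sup>2 * t * ?h j) * ell + 3 * tot\<^sup>2 * ?h j) \<longlonglongrightarrow> \<bar>z\<bar> * exp (- (t * eta)) * ell"
    by simp
  show "\<exists>n0. \<forall>j\<ge>n0. norm (Aop (psi (?h j) (Suc j)) z) \<le> \<bar>z\<bar> * exp (- (t * eta) + 3 * tot\<^sup>2 * t * ?h j) * ell + 3 * tot\<^sup>2 * ?h j"
  proof (intro exI[of _ 0] allI impI)
    fix j
    define h where "h = ?h j"
    have h: "0 < h" using t by (simp add: h_def)
    have mh: "real (Suc j) * h = t" by (simp add: h_def)
    have "kap h ^ Suc j \<le> exp (- h * eta + 3 * tot\<^sup>2 * h\<^sup>2) ^ Suc j"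
    proof (intro power_mono kap_bounds(1) h)
      show "kap h \<le> exp (- h * eta + 3 * tot\<^sup>2 * h\<^sup>2)"
        by (rule order_trans[OF _ exp_ge_add_one_self]) (use kap_bounds(2)[OF h] in simp)
    qed
    also have "\<dots> = exp (real (Suc j) * (- h * eta + 3 * tot\<^sup>2 * h\<^sup>2))" by (rule exp_of_nat_mult[symmetric])
    also have "real (Suc j) * (- h * eta + 3 * tot\<^sup>2 * h\<^sup>2) = - ((real (Suc j) * h) * eta) + 3 * tot\<^sup>2 * (real (Suc j) * h) * h"
      by (simp add: algebra_simps power2_eq_square)
    finally have "kap h ^ Suc j \<le> exp (- (t * eta) + 3 * tot\<^sup>2 * t * h)" unfolding mh .
    then have "\<bar>z\<bar> * kap h ^ Suc j * ell \<le> \<bar>z\<bar> * exp (- (t * eta) + 3 * tot\<^sup>2 * t * h) * ell"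
      using ell0 by (intro mult_right_mono mult_left_mono) auto
    with Aop_psi[OF h, of "Suc j" z]
    show "norm (Aop (psi (?h j) (Suc j)) z) \<le> \<bar>z\<bar> * exp (- (t * eta) + 3 * tot\<^sup>2 * t * ?h j) * ell + 3 * tot\<^sup>2 * ?h j"
      unfolding h_def[symmetric] by linarith
  qed
qed

lemma ennreal_sum_le: "ennreal (\<Sum>i\<in>A. f i) \<le> (\<Sum>i\<in>A. ennreal (f i))"
proof (induction A rule: infinite_finite_induct)
  case (insert x A)
  have "ennreal (f x + sum f A) \<le> ennreal (max 0 (f x) + max 0 (sum f A))" by (intro ennreal_leI) auto
  also have "\<dots> = ennreal (f x) + ennreal (sum f A)" by (subst ennreal_plus) (auto simp: ennreal_max_0)
  also have "\<dots> \<le> ennreal (f x) + (\<Sum>i\<in>A. ennreal (f i))" using insert by (intro add_left_mono)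
  finally show ?case using insert by simp
qed auto

text \<open>For a small mesh kap is at most 1 - h eta / 2, and the geometric series in kap gives a
  bound independent of the mesh and of the number of cells.\<close>

lemma nn_Ih:
  assumes h: "0 < h" and small: "3 * tot\<^sup>2 * h \<le> eta / 2"
  shows "(\<integral>\<^sup>+\<omega>. ennreal (Ih h m \<omega>) \<partial>M) \<le> ennreal (2 * ell / eta)"
proof -
  note [measurable] = measurable_Ih[OF h]
  have "h * (3 * tot\<^sup>2 * h) \<le> h * (eta / 2)" using small h by (intro mult_left_mono) auto
  then have k: "kap h \<le> 1 - h * eta / 2" using kap_bounds(2)[OF h] by (simp add: power2_eq_square algebra_simps)
  have he: "0 < h * eta / 2" using h eta0 by simp
  have k1: "kap h < 1" using k he by linarith
  have "Ih h m \<omega> = (\<Sum>i<m. Ih h (Suc i) \<omega> - Ih h i \<omega>)" for \<omega> by (simp add: Ih_def)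
  then have "(\<integral>\<^sup>+\<omega>. ennreal (Ih h m \<omega>) \<partial>M) \<le> (\<integral>\<^sup>+\<omega>. (\<Sum>i<m. ennreal (Ih h (Suc i) \<omega> - Ih h i \<omega>)) \<partial>M)"
    by (intro nn_integral_mono) (metis ennreal_sum_le)
  also have "\<dots> = (\<Sum>i<m. \<integral>\<^sup>+\<omega>. ennreal (Ih h (Suc i) \<omega> - Ih h i \<omega>) \<partial>M)"
    by (rule nn_integral_sum) measurable
  also have "\<dots> \<le> (\<Sum>i<m. ennreal (kap h ^ i * (h * ell)))"
    by (intro sum_mono nn_Ih_Suc h)
  also have "\<dots> = ennreal ((\<Sum>i<m. kap h ^ i) * (h * ell))"
    using kap_bounds(1)[OF h] h ell0 by (simp add: sum_ennreal sum_distrib_right)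
  also have "\<dots> \<le> ennreal (2 * ell / eta)"
  proof (rule ennreal_leI)
    have "(\<Sum>i<m. kap h ^ i) = (1 - kap h ^ m) / (1 - kap h)"
      using k1 by (subst sum_gp_strict) auto
    also have "\<dots> \<le> 1 / (h * eta / 2)"
      using k he k1 kap_bounds(1)[OF h] by (intro frac_le) auto
    finally have "(\<Sum>i<m. kap h ^ i) * (h * ell) \<le> 1 / (h * eta / 2) * (h * ell)"
      using h ell0 by (intro mult_right_mono) auto
    also have "\<dots> = 2 * ell / eta" using h eta0 by (simp add: field_simps)
    finally show "(\<Sum>i<m. kap h ^ i) * (h * ell) \<le> 2 * ell / eta" .
  qed
  finally show ?thesis .
qed

text \<open>Fatou's lemma carries the uniform bound from the Riemann sums to the integral.\<close>

lemma nn_exp_integral: "(\<integral>\<^sup>+\<omega>. ennreal (exp_integral c N L t \<omega>) \<partial>M) \<le> ennreal (2 * ell / eta)"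
proof (cases "0 < t")
  case False
  then show ?thesis by (simp add: exp_integral_0)
next
  case t: True
  let ?h = "\<lambda>j. t / real (Suc j)"
  have h: "0 < ?h j" for j using t by simp
  have "(\<integral>\<^sup>+\<omega>. ennreal (exp_integral c N L t \<omega>) \<partial>M) = (\<integral>\<^sup>+\<omega>. liminf (\<lambda>j. ennreal (Ih (?h j) (Suc j) \<omega>)) \<partial>M)"
    by (intro nn_integral_cong lim_imp_Liminf[symmetric] tendsto_ennrealI Ih_lim t) auto
  also have "\<dots> \<le> liminf (\<lambda>j. \<integral>\<^sup>+\<omega>. ennreal (Ih (?h j) (Suc j) \<omega>) \<partial>M)"
    by (rule nn_integral_liminf) (intro measurable_compose[OF measurable_Ih[OF h]] measurable_ennreal)
  also have "\<dots> \<le> ennreal (2 * ell / eta)"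
  proof -
    have "(\<lambda>j. 3 * tot\<^sup>2 * ?h j) \<longlonglongrightarrow> 0" by (rule tendsto_mult_right_zero[OF hj_lim])
    then have "eventually (\<lambda>j. 3 * tot\<^sup>2 * ?h j < eta / 2) sequentially"
      by (rule order_tendstoD(2)) (use eta0 in simp)
    then have "eventually (\<lambda>j. (\<integral>\<^sup>+\<omega>. ennreal (Ih (?h j) (Suc j) \<omega>) \<partial>M) \<le> ennreal (2 * ell / eta)) sequentially"
      by eventually_elim (intro nn_Ih h less_imp_le)
    then show ?thesis by (intro Liminf_le) auto
  qed
  finally show ?thesis .
qed

text \<open>Up to an integer horizon each jump of \<open>L\<close> is an increment over a cell of a
  sufficiently fine grid, and the cells of all these countably many grids have nonnegative
  increments almost surely.\<close>

lemma AE_jump_nonneg: "AE \<omega> in M. \<forall>s\<in>jump_times (\<lambda>t. L t \<omega>). 0 \<le> jump (\<lambda>t. L t \<omega>) s"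
proof -
  have "AE \<omega> in M. \<forall>(n::nat) (j::nat) (i::nat). 0 \<le> snd (incr (real (Suc n) / real (Suc j)) i \<omega>)"
    unfolding AE_all_countable
  proof (intro allI)
    fix n j i :: nat
    have "0 < real (Suc n) / real (Suc j)" by simp
    from AE_incr_nonneg[OF this, of i]
    show "AE \<omega> in M. 0 \<le> snd (incr (real (Suc n) / real (Suc j)) i \<omega>)" by eventually_elim simp
  qed
  then show ?thesis using AE_space
  proof eventually_elim
    case (elim \<omega>)
    show ?case
    proof
      fix s assume s: "s \<in> jump_times (\<lambda>t. L t \<omega>)"
      obtain n where n: "s \<le> real n" using real_arch_simple by blast
      let ?t = "real (Suc n)"
      have t: "0 < ?t" "s \<le> ?t" using n by auto
      obtain \<delta> where \<delta>: "0 < \<delta>"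
        "\<And>h m s. 0 < h \<Longrightarrow> h < \<delta> \<Longrightarrow> real m * h = ?t \<Longrightarrow> s \<in> jump_times (\<lambda>t. L t \<omega>) \<Longrightarrow> s \<le> ?t \<Longrightarrow>
           \<exists>i<m. snd (incr h i \<omega>) = jump (\<lambda>t. L t \<omega>) s"
        using Ih_path[OF elim(2) less_imp_le[OF t(1)]] by metis
      have "eventually (\<lambda>j. ?t / real (Suc j) < \<delta>) sequentially" by (rule order_tendstoD(2)[OF hj_lim \<delta>(1)])
      then obtain j where j: "?t / real (Suc j) < \<delta>" by (auto simp: eventually_sequentially)
      have "0 < ?t / real (Suc j)" "real (Suc j) * (?t / real (Suc j)) = ?t" by simp_all
      from \<delta>(2)[OF this(1) j this(2) s t(2)]
      obtain i where "snd (incr (?t / real (Suc j)) i \<omega>) = jump (\<lambda>t. L t \<omega>) s" by blast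
      then show "0 \<le> jump (\<lambda>t. L t \<omega>) s" using elim(1) by metis
    qed
  qed
qed

lemma mono_exp_integral:
  assumes \<omega>: "\<omega> \<in> space M" and j: "\<forall>s\<in>jump_times (\<lambda>t. L t \<omega>). 0 \<le> jump (\<lambda>t. L t \<omega>) s"
  shows "mono (\<lambda>t. exp_integral c N L t \<omega>)"
proof (rule monoI)
  fix s t :: real assume st: "s \<le> t"
  show "exp_integral c N L s \<omega> \<le> exp_integral c N L t \<omega>"
    unfolding exp_integral_def
  proof (rule sum_mono2)
    show "finite (jump_times (\<lambda>t. L t \<omega>) \<inter> {..t})" by (rule pure_jump_finite[OF pure_L[OF \<omega>]])
    show "jump_times (\<lambda>t. L t \<omega>) \<inter> {..s} \<subseteq> jump_times (\<lambda>t. L t \<omega>) \<inter> {..t}" using st by auto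
    show "0 \<le> c powr (- left_lim (\<lambda>t. N t \<omega>) b) * jump (\<lambda>t. L t \<omega>) b"
      if "b \<in> jump_times (\<lambda>t. L t \<omega>) \<inter> {..t} - jump_times (\<lambda>t. L t \<omega>) \<inter> {..s}" for b
      using that j by (intro mult_nonneg_nonneg) auto
  qed
qed

text \<open>Almost every path of the integral is nondecreasing, and the means are bounded; by
  monotone convergence the supremum has finite mean, hence is finite almost surely.\<close>

lemma AE_exp_integral_converges:
  "AE \<omega> in M. (\<lambda>n. exp_integral c N L (real n) \<omega>) \<longlonglongrightarrow> Lim at_top (\<lambda>t. exp_integral c N L t \<omega>)"
proof -
  let ?e = "\<lambda>n \<omega>. ennreal (exp_integral c N L (real n) \<omega>)"
  have em: "?e n \<in> borel_measurable M" for n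
    by (rule measurable_compose[OF measurable_exp_integral measurable_ennreal])
  have mono: "AE \<omega> in M. mono (\<lambda>t. exp_integral c N L t \<omega>)"
    using AE_jump_nonneg AE_space by eventually_elim (rule mono_exp_integral)
  have "(\<integral>\<^sup>+\<omega>. (SUP n. ?e n \<omega>) \<partial>M) = (SUP n. \<integral>\<^sup>+\<omega>. ?e n \<omega> \<partial>M)"
  proof (rule nn_integral_monotone_convergence_SUP_AE[OF _ em])
    show "AE \<omega> in M. ?e n \<omega> \<le> ?e (Suc n) \<omega>" for n
      using mono by eventually_elim (intro ennreal_leI, erule monoD, simp)
  qed
  also have "\<dots> \<le> ennreal (2 * ell / eta)" by (intro SUP_least nn_exp_integral)
  finally have "(\<integral>\<^sup>+\<omega>. (SUP n. ?e n \<omega>) \<partial>M) < \<top>" by (rule le_less_trans) (rule ennreal_less_top)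
  then have "(\<integral>\<^sup>+\<omega>. (SUP n. ?e n \<omega>) \<partial>M) \<noteq> \<infinity>" by auto
  moreover have "(\<lambda>\<omega>. SUP n. ?e n \<omega>) \<in> borel_measurable M" by (rule borel_measurable_SUP) (simp, rule em)
  ultimately have "AE \<omega> in M. (SUP n. ?e n \<omega>) \<noteq> \<infinity>" by (intro nn_integral_PInf_AE)
  then show ?thesis using mono
  proof eventually_elim
    case (elim \<omega>)
    let ?I = "\<lambda>t. exp_integral c N L t \<omega>"
    obtain B where B: "(SUP n. ?e n \<omega>) = ennreal B" "0 \<le> B"
      using elim(1) by (cases "SUP n. ?e n \<omega>") auto
    have bn: "?I (real n) \<le> B" for n
    proof -
      have "?e n \<omega> \<le> ennreal B" unfolding B(1)[symmetric] by (rule SUP_upper) simp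
      then show ?thesis using B(2) by (simp add: ennreal_le_iff)
    qed
    have "?I t \<le> B" for t
    proof -
      obtain n where "t \<le> real n" using real_arch_simple by blast
      then show ?thesis using bn[of n] monoD[OF elim(2), of t "real n"] by linarith
    qed
    then obtain l where l: "(?I \<longlongrightarrow> l) at_top" using mono_bounded_tendsto_at_top[OF elim(2)] by metis
    then have "Lim at_top ?I = l" by (intro tendsto_Lim) auto
    then show ?case using filterlim_compose[OF l filterlim_real_sequentially] by simp
  qed
qed

text \<open>The defect of the functional equation at time t is at most a multiple of exp (- t eta)
  and vanishes as t grows through the integers.\<close>

theorem char_mu:
  defines "g \<equiv> char (distr M borel (\<lambda>\<omega>. Lim at_top (\<lambda>t. exp_integral c N L t \<omega>)))"
  shows "g z * (of_real tot - of_real v * iexp z) = (of_real u + of_real w * iexp (al * z)) * g (z / c)"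
proof -
  have lim: "(\<lambda>n. ft (real (Suc n)) z) \<longlonglongrightarrow> g z" for z
  proof (rule LIMSEQ_Suc)
    have m: "(\<lambda>x. iexp (z * x)) \<in> borel_measurable borel"
      by (intro borel_measurable_continuous_onI continuous_intros)
    have "(\<lambda>n. CLINT \<omega>|M. iexp (z * exp_integral c N L (real n) \<omega>)) \<longlonglongrightarrow>
       (CLINT \<omega>|M. iexp (z * Lim at_top (\<lambda>t. exp_integral c N L t \<omega>)))"
    proof (rule integral_dominated_convergence[where w="\<lambda>_. 1"])
      show "AE \<omega> in M. (\<lambda>n. iexp (z * exp_integral c N L (real n) \<omega>)) \<longlonglongrightarrow> iexp (z * Lim at_top (\<lambda>t. exp_integral c N L t \<omega>))"
        using AE_exp_integral_converges by eventually_elim (intro tendsto_intros)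
      show "(\<lambda>\<omega>. iexp (z * Lim at_top (\<lambda>t. exp_integral c N L t \<omega>))) \<in> borel_measurable M"
        by (rule measurable_compose[OF measurable_mu m])
      show "(\<lambda>\<omega>. iexp (z * exp_integral c N L (real n) \<omega>)) \<in> borel_measurable M" for n
        by (rule measurable_compose[OF measurable_exp_integral m])
    qed auto
    then show "(\<lambda>n. ft (real n) z) \<longlonglongrightarrow> g z"
      by (simp add: g_def char_def integral_distr[OF measurable_mu] ft_def)
  qed
  have "(\<lambda>n. norm (Aop (ft (real (Suc n))) z)) \<longlonglongrightarrow> norm (Aop g z)"
    by (intro tendsto_norm tendsto_Aop lim)
  moreover have "(\<lambda>n. \<bar>z\<bar> * exp (- (real (Suc n) * eta)) * ell) \<longlonglongrightarrow> 0"
  proof -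
    have "(\<lambda>n. exp (- eta) ^ n) \<longlonglongrightarrow> 0" using eta0 by (intro LIMSEQ_power_zero) simp
    then have "(\<lambda>n. exp (- eta) ^ Suc n) \<longlonglongrightarrow> 0" by (rule LIMSEQ_Suc)
    then have "(\<lambda>n. exp (- (real (Suc n) * eta))) \<longlonglongrightarrow> 0"
      by (simp only: exp_of_nat_mult[symmetric] mult_minus_right)
    from tendsto_mult_left_zero[OF tendsto_mult_right_zero[OF this]] show ?thesis .
  qed
  ultimately have "norm (Aop g z) \<le> 0"
    by (rule LIMSEQ_le) (intro exI[of _ 0] allI impI Aop_ft, simp)
  then have "Aop g z = 0" by simp
  then show ?thesis by (simp add: Aop_def algebra_simps)
qed

end

section \<open>Symmetrization and infinite divisibility\<close>

lemma Re_iexp: "Re (iexp t) = cos t" and Im_iexp: "Im (iexp t) = sin t"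
  by (simp_all flip: cis_conv_exp)

lemma char_convolution:
  assumes "real_distribution \<sigma>" "real_distribution \<tau>"
  shows "real_distribution (\<sigma> \<star> \<tau>)" "char (\<sigma> \<star> \<tau>) z = char \<sigma> z * char \<tau> z"
proof -
  interpret \<sigma>: real_distribution \<sigma> by fact
  interpret \<tau>: real_distribution \<tau> by fact
  interpret P: pair_prob_space \<sigma> \<tau> ..
  have m: "(\<lambda>(x, y). x + y :: real) \<in> borel_measurable (\<sigma> \<Otimes>\<^sub>M \<tau>)" by measurable
  show "real_distribution (\<sigma> \<star> \<tau>)"
    unfolding convolution_def by (rule P.real_distribution_distr[OF m])
  have im: "(\<lambda>x. iexp (z * x)) \<in> borel_measurable borel"
    by (intro borel_measurable_continuous_onI continuous_intros)
  have int: "integrable (\<sigma> \<Otimes>\<^sub>M \<tau>) (\<lambda>p. iexp (z * (case p of (x, y) \<Rightarrow> x + y)))"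
    by (rule P.integrable_const_bound[where B=1]) (auto intro!: measurable_compose[OF m im])
  have "char (\<sigma> \<star> \<tau>) z = (CLINT p|\<sigma> \<Otimes>\<^sub>M \<tau>. iexp (z * (case p of (x, y) \<Rightarrow> x + y)))"
    unfolding char_def convolution_def by (rule integral_distr[OF m im])
  also have "\<dots> = (CLINT x|\<sigma>. CLINT y|\<tau>. iexp (z * (x + y)))"
    using P.integral_fst'[OF int] by simp
  also have "\<dots> = char \<sigma> z * char \<tau> z"
    by (simp add: char_def distrib_left exp_add)
  finally show "char (\<sigma> \<star> \<tau>) z = char \<sigma> z * char \<tau> z" .
qed

lemma char_conv_power:
  assumes \<tau>: "real_distribution \<tau>"
  shows "real_distribution (conv_power \<tau> n)" "char (conv_power \<tau> n) z = char \<tau> z ^ n"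
proof -
  have "real_distribution (conv_power \<tau> n) \<and> char (conv_power \<tau> n) z = char \<tau> z ^ n"
  proof (induction n)
    case 0
    have "real_distribution (return borel (0::real))"
      by (auto simp: real_distribution_def real_distribution_axioms_def intro: prob_space_return)
    moreover have "(\<lambda>x. iexp (z * x)) \<in> borel_measurable borel"
      by (intro borel_measurable_continuous_onI continuous_intros)
    ultimately show ?case by (simp add: char_def integral_return)
  next
    case (Suc n)
    then show ?case using char_convolution[OF \<tau>] by simp
  qed
  then show "real_distribution (conv_power \<tau> n)" "char (conv_power \<tau> n) z = char \<tau> z ^ n" by auto
qed

lemma char_reflect:
  assumes "real_distribution \<sigma>"
  shows "real_distribution (distr \<sigma> borel uminus)" "char (distr \<sigma> borel uminus) z = cnj (char \<sigma> z)"
proof -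
  interpret \<sigma>: real_distribution \<sigma> by fact
  have im: "(\<lambda>x. iexp (z * x)) \<in> borel_measurable borel"
    by (intro borel_measurable_continuous_onI continuous_intros)
  show "real_distribution (distr \<sigma> borel uminus)" by (rule \<sigma>.real_distribution_distr) simp
  have "char (distr \<sigma> borel uminus) z = (CLINT x|\<sigma>. iexp (z * - x))"
    unfolding char_def by (rule integral_distr) (use im in auto)
  also have "\<dots> = (CLINT x|\<sigma>. cnj (iexp (z * x)))" by (simp add: exp_cnj)
  also have "\<dots> = cnj (char \<sigma> z)" by (simp add: char_def)
  finally show "char (distr \<sigma> borel uminus) z = cnj (char \<sigma> z)" .
qed

text \<open>Convolution with the reflected law realizes the squared modulus, and Levy uniqueness
  makes the description definite.\<close>

lemma symmetrization:
  assumes \<sigma>: "real_distribution \<sigma>"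
  shows "real_distribution (symmetrization \<sigma>)"
    "char (symmetrization \<sigma>) z = of_real ((cmod (char \<sigma> z))\<^sup>2)"
proof -
  let ?P = "\<lambda>\<tau>. real_distribution \<tau> \<and> (\<forall>z. char \<tau> z = of_real ((cmod (char \<sigma> z))\<^sup>2))"
  have "?P (\<sigma> \<star> distr \<sigma> borel uminus)"
    by (intro conjI allI char_convolution(1)[OF \<sigma> char_reflect(1)[OF \<sigma>]])
       (simp only: char_convolution(2)[OF \<sigma> char_reflect(1)[OF \<sigma>]] char_reflect(2)[OF \<sigma>] complex_norm_square)
  moreover have "\<tau> = \<tau>'" if "?P \<tau>" "?P \<tau>'" for \<tau> \<tau>'
    using that by (intro Levy_uniqueness) (auto simp: fun_eq_iff)
  ultimately have "\<exists>!\<tau>. ?P \<tau>" by blast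
  from theI'[OF this] show "real_distribution (symmetrization \<sigma>)"
    "char (symmetrization \<sigma>) z = of_real ((cmod (char \<sigma> z))\<^sup>2)"
    by (auto simp: symmetrization_def)
qed

lemma ID_I:
  assumes \<sigma>: "real_distribution \<sigma>"
    and root: "\<And>n. 1 \<le> n \<Longrightarrow> \<exists>\<tau>. real_distribution \<tau> \<and> (\<forall>z. char \<sigma> z = char \<tau> z ^ n)"
  shows "\<sigma> \<in> ID"
proof -
  have "\<exists>\<tau>. real_distribution \<tau> \<and> \<sigma> = conv_power \<tau> n" if n: "1 \<le> n" for n
  proof -
    obtain \<tau> where \<tau>: "real_distribution \<tau>" "\<And>z. char \<sigma> z = char \<tau> z ^ n" using root[OF n] by blast
    then have "\<sigma> = conv_power \<tau> n"
      by (intro Levy_uniqueness \<sigma> char_conv_power(1)) (simp_all add: fun_eq_iff char_conv_power(2))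
    with \<tau> show ?thesis by blast
  qed
  with \<sigma> show ?thesis by (simp add: ID_def infinitely_divisible_def)
qed

text \<open>The trigonometric polynomial \<open>(1 - cos 2\<pi>x) (1 + cos \<beta>x)\<close> is nonnegative and vanishes at \<open>0\<close>, so it
  has a nonnegative integral with respect to the Levy measure of an infinitely divisible distribution.
  That measure is reached as the limit of the roots, whose symmetrizations avoid any choice of a
  branch of the logarithm.\<close>

lemma ID_trig_ineq:
  assumes \<sigma>: "\<sigma> \<in> ID" and ch: "\<And>z. char \<sigma> z = of_real (\<phi> z)" and \<phi>: "\<And>z. 0 < \<phi> z"
  shows "0 \<le> - ln (\<phi> (2 * pi)) + ln (\<phi> \<beta>) - ln (\<phi> (2 * pi + \<beta>)) / 2 - ln (\<phi> (2 * pi - \<beta>)) / 2"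
proof -
  \<comment> \<open>For e = 2/n this is the integral of the test polynomial against the symmetrized
    n-th root, whose characteristic function is \<open>\<phi> z powr e\<close>. As G 0 = 0, the
    quotient G e / e tends to the derivative at 0, the claimed combination of logarithms.\<close>
  define G where "G e = 1 - \<phi> (2 * pi) powr e + \<phi> \<beta> powr e - \<phi> (2 * pi + \<beta>) powr e / 2 - \<phi> (2 * pi - \<beta>) powr e / 2" for e
  have G0: "0 \<le> G (2 / real n)" if n: "1 \<le> n" for n :: nat
  proof -
    obtain \<tau> where \<tau>: "real_distribution \<tau>" "\<sigma> = conv_power \<tau> n"
      using \<sigma> n by (auto simp: ID_def infinitely_divisible_def)
    interpret S: real_distribution "symmetrization \<tau>" by (rule symmetrization(1)[OF \<tau>(1)])
    have chS: "char (symmetrization \<tau>) z = of_real (\<phi> z powr (2 / real n))" for z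
    proof -
      have "of_real (\<phi> z) = char \<tau> z ^ n" using ch[of z] char_conv_power(2)[OF \<tau>(1)] \<tau>(2) by simp
      then have "norm (complex_of_real (\<phi> z)) = norm (char \<tau> z) ^ n" by (simp add: norm_power)
      then have e: "\<phi> z = norm (char \<tau> z) ^ n" using \<phi>[of z] by simp
      then have p: "0 < norm (char \<tau> z)" using \<phi>[of z] n by (cases "char \<tau> z = 0") (auto simp: power_0_left)
      have "\<phi> z powr (2 / real n) = (norm (char \<tau> z) powr real n) powr (2 / real n)"
        using e p by (simp add: powr_realpow)
      also have "\<dots> = norm (char \<tau> z) powr 2" using n by (simp add: powr_powr)
      also have "\<dots> = (norm (char \<tau> z))\<^sup>2" using p by (simp add: powr_numeral)
      finally show ?thesis using symmetrization(2)[OF \<tau>(1)] by simp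
    qed
    have cosm: "(\<lambda>x. cos (z * x)) \<in> borel_measurable (symmetrization \<tau>)" for z
      by (intro S.measurable_finite_borel borel_measurable_continuous_onI continuous_intros)
    have ci: "integrable (symmetrization \<tau>) (\<lambda>x. cos (z * x))" for z
      by (rule S.integrable_const_bound[where B=1]) (use cosm in auto)
    have cE: "(LINT x|symmetrization \<tau>. cos (z * x)) = \<phi> z powr (2 / real n)" for z
    proof -
      have "integrable (symmetrization \<tau>) (\<lambda>x. iexp (z * x))"
      proof (rule S.integrable_const_bound[where B=1])
        show "(\<lambda>x. iexp (z * x)) \<in> borel_measurable (symmetrization \<tau>)"
          by (intro S.measurable_finite_borel borel_measurable_continuous_onI continuous_intros)
      qed auto
      then have "(LINT x|symmetrization \<tau>. Re (iexp (z * x))) = Re (char (symmetrization \<tau>) z)"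
        unfolding char_def by (rule integral_Re)
      then show ?thesis unfolding chS Re_iexp Re_complex_of_real .
    qed
    have id: "(1 - cos (2 * pi * x)) * (1 + cos (\<beta> * x)) =
       1 - cos (2 * pi * x) + cos (\<beta> * x) - cos ((2 * pi + \<beta>) * x) / 2 - cos ((2 * pi - \<beta>) * x) / 2" for x
    proof -
      have "cos ((2 * pi + \<beta>) * x) = cos (2 * pi * x) * cos (\<beta> * x) - sin (2 * pi * x) * sin (\<beta> * x)"
        "cos ((2 * pi - \<beta>) * x) = cos (2 * pi * x) * cos (\<beta> * x) + sin (2 * pi * x) * sin (\<beta> * x)"
        by (simp_all only: distrib_right left_diff_distrib cos_add cos_diff)
      then show ?thesis by (simp add: field_simps)
    qed
    have "0 \<le> (LINT x|symmetrization \<tau>. (1 - cos (2 * pi * x)) * (1 + cos (\<beta> * x)))"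
    proof (rule Bochner_Integration.integral_nonneg)
      fix x
      show "0 \<le> (1 - cos (2 * pi * x)) * (1 + cos (\<beta> * x))"
        using cos_le_one[of "2 * pi * x"] cos_ge_minus_one[of "\<beta> * x"] by (intro mult_nonneg_nonneg) linarith+
    qed
    also have "\<dots> = G (2 / real n)"
      unfolding id G_def using ci S.prob_space by (simp add: cE)
    finally show ?thesis .
  qed
  have d: "((\<lambda>e. x powr e) has_real_derivative ln x) (at 0)" if "0 < x" for x :: real
  proof -
    have "((\<lambda>e. exp (e * ln x)) has_real_derivative ln x) (at 0)"
      by (auto intro!: derivative_eq_intros)
    then show ?thesis using that by (simp add: powr_def)
  qed
  have dG: "(G has_real_derivative (- ln (\<phi> (2 * pi)) + ln (\<phi> \<beta>) - ln (\<phi> (2 * pi + \<beta>)) / 2 - ln (\<phi> (2 * pi - \<beta>)) / 2)) (at 0)"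
    unfolding G_def[abs_def] by (rule derivative_eq_intros d \<phi> refl | simp)+
  have Gz: "G 0 = 0" using \<phi> by (simp add: G_def less_imp_neq[THEN not_sym])
  have l0: "filterlim (\<lambda>n. 2 / real (Suc n)) (at 0) sequentially"
  proof (rule filterlim_atI)
    show "(\<lambda>n. 2 / real (Suc n)) \<longlonglongrightarrow> 0"
      using tendsto_mult_right_zero[OF LIMSEQ_inverse_real_of_nat, of 2] by (simp add: divide_inverse)
  qed simp
  have "((\<lambda>e. G e / e) \<longlongrightarrow> - ln (\<phi> (2 * pi)) + ln (\<phi> \<beta>) - ln (\<phi> (2 * pi + \<beta>)) / 2 - ln (\<phi> (2 * pi - \<beta>)) / 2) (at 0)"
    using dG unfolding has_field_derivative_iff by (simp add: Gz)
  from filterlim_compose[OF this l0] show ?thesis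
  proof (rule LIMSEQ_le_const)
    show "\<exists>N. \<forall>n\<ge>N. 0 \<le> G (2 / real (Suc n)) / (2 / real (Suc n))"
    proof (intro exI[of _ 0] allI impI divide_nonneg_nonneg)
      show "0 \<le> G (2 / real (Suc n))" for n by (rule G0) simp
    qed simp_all
  qed
qed

section \<open>Logarithmic series\<close>

text \<open>Closed form of the exponent of the symmetric signed Levy measure with mass x^l / l at l
  and at -l; for negative \<open>x\<close> the masses alternate in sign.\<close>

definition lgs :: "real \<Rightarrow> real \<Rightarrow> real" where
  "lgs x y = 2 * ln (1 - x) - ln (1 - 2 * x * cos y + x\<^sup>2)"

lemma cmod_1_minus: "(cmod (1 - of_real x * iexp y))\<^sup>2 = 1 - 2 * x * cos y + x\<^sup>2"
proof -
  have "(cmod (1 - of_real x * iexp y))\<^sup>2 = (1 - x * cos y)\<^sup>2 + (x * sin y)\<^sup>2"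
    by (simp add: cmod_power2 flip: cis_conv_exp)
  also have "\<dots> = 1 - 2 * x * cos y + x\<^sup>2 * ((sin y)\<^sup>2 + (cos y)\<^sup>2)"
    by (simp add: power_mult_distrib power2_diff sin_squared_eq algebra_simps)
  finally show ?thesis by simp
qed

lemma lgs_pos:
  fixes x :: real
  assumes "\<bar>x\<bar> < 1"
  shows "0 < 1 - 2 * x * cos y + x\<^sup>2"
proof -
  have "of_real x * iexp y \<noteq> 1"
  proof
    assume "of_real x * iexp y = 1"
    then have "norm (of_real x * iexp y) = 1" by simp
    with assms show False by (simp add: norm_mult)
  qed
  then show ?thesis by (simp flip: cmod_1_minus)
qed

text \<open>Twice the real part of the series for -Ln (1 - x exp(i y)), minus the same at y =
  0.\<close>

lemma lgs_sums:
  assumes x: "\<bar>x\<bar> < 1"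
  shows "(\<lambda>n. x ^ Suc n / real (Suc n) * (2 * cos (real (Suc n) * y) - 2)) sums lgs x y"
proof -
  have base: "(\<lambda>n. x ^ Suc n / real (Suc n) * cos (real (Suc n) * y)) sums (- ln (1 - 2 * x * cos y + x\<^sup>2) / 2)" for y
  proof -
    let ?z = "- (of_real x * iexp y)"
    have nz: "norm ?z < 1" using x by (simp add: norm_mult)
    have "(\<lambda>n. (- 1) ^ Suc n / of_nat n * ?z ^ n) sums Ln (1 + ?z)" by (rule Ln_series[OF nz])
    then have "(\<lambda>n. (- 1) ^ Suc (Suc n) / of_nat (Suc n) * ?z ^ Suc n) sums (Ln (1 + ?z) - (- 1) ^ Suc 0 / of_nat 0 * ?z ^ 0)"
      by (subst sums_Suc_iff) simp
    then have "(\<lambda>n. Re ((- 1) ^ Suc (Suc n) / of_nat (Suc n) * ?z ^ Suc n)) sums Re (Ln (1 + ?z))"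
      by (intro sums_Re) simp
    moreover have "Re ((- 1) ^ Suc (Suc n) / of_nat (Suc n) * ?z ^ Suc n) = - (x ^ Suc n / real (Suc n) * cos (real (Suc n) * y))" for n
    proof -
      have "?z ^ Suc n = (- 1) ^ Suc n * of_real (x ^ Suc n) * iexp (real (Suc n) * y)"
        by (simp only: power_minus[of "of_real x * iexp y"] power_mult_distrib of_real_power of_real_mult of_real_of_nat_eq mult.assoc
            exp_of_nat_mult[symmetric] mult.left_commute[of \<i>])
      then have "(- 1) ^ Suc (Suc n) / of_nat (Suc n) * ?z ^ Suc n = of_real (- (x ^ Suc n / real (Suc n))) * iexp (real (Suc n) * y)"
        by (simp del: power_Suc of_nat_Suc add: power_Suc[of "-1::complex" "Suc n"] flip: power_add mult_2)
      then have "Re ((- 1) ^ Suc (Suc n) / of_nat (Suc n) * ?z ^ Suc n) = Re (of_real (- (x ^ Suc n / real (Suc n))) * iexp (real (Suc n) * y))"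
        by (rule arg_cong)
      also have "\<dots> = - (x ^ Suc n / real (Suc n)) * cos (real (Suc n) * y)"
        by (simp only: Re_complex_of_real Im_complex_of_real times_complex.sel Re_iexp mult_zero_left diff_zero)
      finally show ?thesis by simp
    qed
    moreover have "Re (Ln (1 + ?z)) = ln (1 - 2 * x * cos y + x\<^sup>2) / 2"
    proof -
      have p: "0 < cmod (1 + ?z)" using lgs_pos[OF x, of y] by (simp flip: cmod_1_minus)
      then have "Re (Ln (1 + ?z)) = ln (cmod (1 + ?z))" by (intro Re_Ln) auto
      also have "\<dots> = ln ((cmod (1 + ?z))\<^sup>2) / 2" using p by (simp add: ln_realpow)
      also have "(cmod (1 + ?z))\<^sup>2 = 1 - 2 * x * cos y + x\<^sup>2" using cmod_1_minus[of x y] by simp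
      finally show ?thesis .
    qed
    ultimately have "(\<lambda>n. - (x ^ Suc n / real (Suc n) * cos (real (Suc n) * y))) sums (ln (1 - 2 * x * cos y + x\<^sup>2) / 2)"
      by (simp only:)
    from sums_minus[OF this] show ?thesis by simp
  qed
  have "ln (1 - 2 * x * cos 0 + x\<^sup>2) = ln ((1 - x)\<^sup>2)" by (simp add: power2_eq_square algebra_simps)
  also have "\<dots> = 2 * ln (1 - x)" using x by (simp add: ln_realpow)
  finally have l0: "ln (1 - 2 * x * cos 0 + x\<^sup>2) = 2 * ln (1 - x)" .
  have "(\<lambda>n. 2 * (x ^ Suc n / real (Suc n) * cos (real (Suc n) * y)) - 2 * (x ^ Suc n / real (Suc n) * cos (real (Suc n) * 0))) sums
     (2 * (- ln (1 - 2 * x * cos y + x\<^sup>2) / 2) - 2 * (- ln (1 - 2 * x * cos 0 + x\<^sup>2) / 2))"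
    by (intro sums_diff sums_mult base)
  then show ?thesis unfolding l0 by (simp add: lgs_def algebra_simps del: power_Suc of_nat_Suc)
qed

lemma summable_lgs_weight:
  assumes "\<bar>x\<bar> < 1"
  shows "summable (\<lambda>n. \<bar>x\<bar> ^ Suc n / real (Suc n))"
proof (rule summable_comparison_test')
  show "summable (\<lambda>n. \<bar>x\<bar> ^ n)" using assms by (intro summable_geometric) simp
  fix n :: nat
  have "\<bar>x\<bar> ^ Suc n / real (Suc n) \<le> \<bar>x\<bar> ^ Suc n / 1" by (intro divide_left_mono) auto
  also have "\<dots> \<le> \<bar>x\<bar> ^ n" using assms by (simp add: mult_left_le_one_le)
  finally show "norm (\<bar>x\<bar> ^ Suc n / real (Suc n)) \<le> \<bar>x\<bar> ^ n" by simp
qed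

section \<open>Discrete measures\<close>

definition atoms :: "(nat \<Rightarrow> real) \<Rightarrow> (nat \<Rightarrow> real) \<Rightarrow> real measure" where
  "atoms f w = distr (density (count_space UNIV) (\<lambda>n. ennreal (w n))) borel f"

lemma sets_atoms[simp]: "sets (atoms f w) = sets borel"
  by (simp add: atoms_def)

lemma emeasure_atoms_eq_0:
  assumes "A \<in> sets borel" "\<And>n. f n \<notin> A"
  shows "emeasure (atoms f w) A = 0"
proof -
  have "f -` A = {}" using assms(2) by auto
  then show ?thesis using assms(1) by (simp add: atoms_def emeasure_distr)
qed

lemma nn_integral_atoms:
  assumes "g \<in> borel_measurable borel"
  shows "(\<integral>\<^sup>+x. g x \<partial>atoms f w) = (\<Sum>n. ennreal (w n) * g (f n))"
  using assms unfolding atoms_def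
  by (simp add: nn_integral_distr nn_integral_density nn_integral_count_space_nat)

text \<open>Summable weights make the measure finite, which is more than the truncated second moment
  asks for.\<close>

lemma pre_levy_atoms:
  assumes w: "\<And>n. 0 \<le> w n" "summable w" and f: "\<And>n. f n \<noteq> 0"
  shows "pre_levy_measure (atoms f w)"
  unfolding pre_levy_measure_def
proof (intro conjI)
  show "emeasure (atoms f w) {0} = 0" using f by (intro emeasure_atoms_eq_0) auto
  have "(\<integral>\<^sup>+x. ennreal (min (x\<^sup>2) 1) \<partial>atoms f w) = (\<Sum>n. ennreal (w n) * ennreal (min ((f n)\<^sup>2) 1))"
    by (rule nn_integral_atoms) measurable
  also have "\<dots> \<le> (\<Sum>n. ennreal (w n))"
  proof (rule suminf_le)
    fix n
    have "ennreal (w n) * ennreal (min ((f n)\<^sup>2) 1) \<le> ennreal (w n) * 1" by (intro mult_left_mono) auto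
    then show "ennreal (w n) * ennreal (min ((f n)\<^sup>2) 1) \<le> ennreal (w n)" by simp
  qed auto
  also have "\<dots> < \<infinity>" using w by (simp add: suminf_ennreal2)
  finally show "(\<integral>\<^sup>+x. ennreal (min (x\<^sup>2) 1) \<partial>atoms f w) < \<infinity>" .
qed simp

lemma integral_atoms:
  fixes g :: "real \<Rightarrow> complex"
  assumes w: "\<And>n. 0 \<le> w n" "summable w" and g[measurable]: "g \<in> borel_measurable borel" and B: "\<And>x. norm (g x) \<le> B"
  shows "(\<lambda>n. of_real (w n) * g (f n)) sums (CLINT x|atoms f w. g x)"
proof -
  have s: "summable (\<lambda>n. norm (w n *\<^sub>R g (f n)))"
  proof (rule summable_comparison_test')
    show "summable (\<lambda>n. w n * B)" using w(2) by (rule summable_mult2)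
    show "norm (norm (w n *\<^sub>R g (f n))) \<le> w n * B" for n using w(1)[of n] B by (simp add: mult_left_mono)
  qed
  have i: "integrable (count_space UNIV) (\<lambda>n. w n *\<^sub>R g (f n))"
    using s by (simp add: integrable_count_space_nat_iff)
  have "(CLINT x|atoms f w. g x) = (CLINT n|density (count_space UNIV) (\<lambda>n. ennreal (w n)). g (f n))"
    unfolding atoms_def by (rule integral_distr) auto
  also have "\<dots> = (CLINT n|count_space UNIV. w n *\<^sub>R g (f n))"
    by (rule integral_density) (auto simp: w)
  finally show ?thesis using sums_integral_count_space_nat[OF i] by (simp add: scaleR_conv_of_real)
qed

lemma levy_integrand_bounded: "norm (levy_integrand z x) \<le> 2 + \<bar>z\<bar>"
proof -
  have "norm (levy_integrand z x) \<le> norm (iexp (z * x)) + norm (1::complex) + norm (\<i> * complex_of_real (z * x * indicator {-1..1} x))"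
    unfolding levy_integrand_def by (intro order_trans[OF norm_triangle_ineq4] add_right_mono norm_triangle_ineq4)
  also have "norm (\<i> * complex_of_real (z * x * indicator {-1..1} x)) \<le> \<bar>z\<bar>"
    by (cases "x \<in> {-1..1}") (auto simp: norm_mult abs_mult intro!: mult_left_le)
  finally show ?thesis by simp
qed

lemma measurable_levy_integrand: "levy_integrand z \<in> borel_measurable borel"
proof -
  have [measurable]: "(\<lambda>x. iexp (z * x)) \<in> borel_measurable borel"
    by (intro borel_measurable_continuous_onI continuous_intros)
  show ?thesis unfolding levy_integrand_def[abs_def] by measurable
qed

text \<open>The compensating terms at x and -x cancel, which is why the drift can be taken as 0 for
  symmetric measures.\<close>

lemma levy_integrand_pair: "levy_integrand z x + levy_integrand z (- x) = of_real (2 * cos (z * x) - 2)"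
proof -
  have "indicator {-1..1} (- x) = (indicator {-1..1} x :: real)" by (auto simp: indicator_def)
  moreover have "iexp (z * x) + iexp (z * - x) = of_real (2 * cos (z * x))"
  proof -
    have e: "iexp (z * x) = cis (z * x)" "iexp (z * - x) = cis (- (z * x))"
      by (simp_all only: cis_conv_exp mult_minus_right)
    show ?thesis unfolding e by (simp add: complex_eq_iff)
  qed
  ultimately show ?thesis by (simp add: levy_integrand_def)
qed

lemma exp_lgs:
  assumes "\<bar>x\<bar> < 1"
  shows "exp (lgs x y) = (1 - x)\<^sup>2 / (1 - 2 * x * cos y + x\<^sup>2)"
proof -
  have "lgs x y = ln ((1 - x)\<^sup>2) - ln (1 - 2 * x * cos y + x\<^sup>2)"
    using assms by (simp add: lgs_def ln_realpow)
  then show ?thesis using lgs_pos[OF assms, of y] assms by (simp add: exp_diff)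
qed

lemma lgs_minus: "lgs x (- y) = lgs x y"
  and lgs_0: "\<bar>x\<bar> < 1 \<Longrightarrow> lgs x 0 = 0"
  and lgs_2pi: "lgs x (2 * pi + y) = lgs x y"
proof -
  show "lgs x (- y) = lgs x y" by (simp add: lgs_def)
  show "lgs x (2 * pi + y) = lgs x y" by (simp add: lgs_def add.commute[of "2 * pi"])
  assume "\<bar>x\<bar> < 1"
  then show "lgs x 0 = 0" using lgs_sums[of x 0] by (simp add: sums_iff)
qed

section \<open>The symmetrized law of \<rho> is not infinitely divisible\<close>

definition phi :: "real \<Rightarrow> real \<Rightarrow> real \<Rightarrow> real \<Rightarrow> real" where
  "phi q a \<alpha> z = exp (lgs q z - lgs (- a) (\<alpha> * z))"

text \<open>The numerator is p times 1 - (-a) exp(i \<alpha> z), and p (1 + a) = 1 - q supplies the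
  constants that normalize both \<open>lgs\<close> terms to 0 at z = 0.\<close>

lemma phi_eq:
  assumes q: "0 < q" "q < 1" and a: "0 < a" "a < 1" and p: "p + r = 1 - q" "r = a * p"
  shows "(cmod ((of_real p + of_real r * iexp (\<alpha> * z)) / (1 - of_real q * iexp z)))\<^sup>2 = phi q a \<alpha> z"
proof -
  have pe: "p * (1 + a) = 1 - q" using p by (simp add: algebra_simps)
  have e: "of_real p + of_real r * iexp (\<alpha> * z) = of_real p * (1 - of_real (- a) * iexp (\<alpha> * z))"
    using p(2) by (simp add: algebra_simps)
  have "(cmod ((of_real p + of_real r * iexp (\<alpha> * z)) / (1 - of_real q * iexp z)))\<^sup>2 =
     p\<^sup>2 * (1 - 2 * (- a) * cos (\<alpha> * z) + (- a)\<^sup>2) / (1 - 2 * q * cos z + q\<^sup>2)"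
    unfolding e norm_divide norm_mult power_divide power_mult_distrib cmod_1_minus by simp
  also have "\<dots> = ((1 - q)\<^sup>2 / (1 - 2 * q * cos z + q\<^sup>2)) / ((1 - - a)\<^sup>2 / (1 - 2 * (- a) * cos (\<alpha> * z) + (- a)\<^sup>2))"
  proof -
    have "P * X / Y = (P * A / Y) / (A / X)" if "A \<noteq> 0" for P X Y A :: real using that by simp
    moreover have "(1 - q)\<^sup>2 = p\<^sup>2 * (1 - - a)\<^sup>2" by (simp add: pe[symmetric] power_mult_distrib)
    moreover have "(1 - - a)\<^sup>2 \<noteq> 0" using a by simp
    ultimately show ?thesis by metis
  qed
  also have "\<dots> = exp (lgs q z) / exp (lgs (- a) (\<alpha> * z))"
    using q a by (simp add: exp_lgs)
  finally show ?thesis by (simp add: phi_def exp_diff)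
qed

text \<open>With \<beta> = pi / \<alpha> the test polynomial is tuned to the atoms: 1 - cos (2 pi x)
  vanishes at the integers, 1 + cos (\<beta> x) at the odd multiples of \<alpha>. Only the even
  multiples of \<alpha> are left, all with negative mass, and irrationality of \<alpha> keeps the
  polynomial positive there. So its integral is negative.\<close>

lemma not_ID_phi:
  assumes q: "0 < q" "q < 1" and a: "0 < a" "a < 1" and \<alpha>: "0 < \<alpha>" "\<alpha> \<notin> \<rat>"
    and ch: "\<And>z. char \<sigma> z = of_real (phi q a \<alpha> z)"
  shows "\<sigma> \<notin> ID"
proof
  assume "\<sigma> \<in> ID"
  define \<beta> where "\<beta> = pi / \<alpha>"
  let ?y = "2 * pi * \<alpha>"
  have ab: "\<alpha> * \<beta> = pi" using \<alpha> by (simp add: \<beta>_def)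
  have ln_phi: "ln (phi q a \<alpha> z) = lgs q z - lgs (- a) (\<alpha> * z)" for z by (simp add: phi_def)
  have "0 \<le> - ln (phi q a \<alpha> (2 * pi)) + ln (phi q a \<alpha> \<beta>) - ln (phi q a \<alpha> (2 * pi + \<beta>)) / 2 - ln (phi q a \<alpha> (2 * pi - \<beta>)) / 2"
    by (rule ID_trig_ineq[OF \<open>\<sigma> \<in> ID\<close> ch]) (simp add: phi_def)
  also have "\<dots> = lgs (- a) ?y - lgs (- a) pi + lgs (- a) (?y + pi) / 2 + lgs (- a) (?y - pi) / 2"
  proof -
    have e1: "\<alpha> * (2 * pi) = ?y" "\<alpha> * (2 * pi + \<beta>) = ?y + pi" "\<alpha> * (2 * pi - \<beta>) = ?y - pi"
      by (simp_all add: algebra_simps ab)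
    have e2: "lgs q (2 * pi) = 0" "lgs q (2 * pi + \<beta>) = lgs q \<beta>" "lgs q (2 * pi - \<beta>) = lgs q \<beta>"
      using lgs_2pi[of q 0] lgs_2pi[of q \<beta>] lgs_2pi[of q "- \<beta>"] lgs_0[of q] q by (simp_all add: lgs_minus)
    show ?thesis unfolding ln_phi e1 e2 ab by (simp add: diff_divide_distrib)
  qed
  \<comment> \<open>The argument of the second logarithm exceeds that of the first by (2 a sin
    ?y)^2, which is positive because \<alpha> is irrational.\<close>
  also have "\<dots> = ln ((1 - a\<^sup>2)\<^sup>2) - ln ((1 + a\<^sup>2)\<^sup>2 - (2 * a * cos ?y)\<^sup>2)"
  proof -
    have p1: "0 < 1 + 2 * a * cos ?y + a\<^sup>2" "0 < 1 - 2 * a * cos ?y + a\<^sup>2"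
      using lgs_pos[of "- a" ?y] lgs_pos[of a ?y] a by auto
    have l1: "lgs (- a) (?y + pi) = 2 * ln (1 + a) - ln (1 - 2 * a * cos ?y + a\<^sup>2)"
      "lgs (- a) (?y - pi) = 2 * ln (1 + a) - ln (1 - 2 * a * cos ?y + a\<^sup>2)"
      "lgs (- a) ?y = 2 * ln (1 + a) - ln (1 + 2 * a * cos ?y + a\<^sup>2)"
      "lgs (- a) pi = 2 * ln (1 + a) - ln (1 - 2 * a + a\<^sup>2)"
      by (simp_all add: lgs_def cos_diff)
    have l2: "ln ((1 - a\<^sup>2)\<^sup>2) = 2 * ln (1 + a) + ln (1 - 2 * a + a\<^sup>2)"
    proof -
      have "(1 - a\<^sup>2)\<^sup>2 = (1 + a)\<^sup>2 * (1 - 2 * a + a\<^sup>2)" by (simp add: power2_eq_square algebra_simps)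
      moreover have "0 < 1 - 2 * a + a\<^sup>2" using lgs_pos[of a 0] a by simp
      ultimately show ?thesis using a by (simp add: ln_mult ln_realpow)
    qed
    have "(1 + a\<^sup>2)\<^sup>2 - (2 * a * cos ?y)\<^sup>2 = (1 + 2 * a * cos ?y + a\<^sup>2) * (1 - 2 * a * cos ?y + a\<^sup>2)"
      by (simp add: power2_eq_square algebra_simps)
    then have l3: "ln ((1 + a\<^sup>2)\<^sup>2 - (2 * a * cos ?y)\<^sup>2) = ln (1 + 2 * a * cos ?y + a\<^sup>2) + ln (1 - 2 * a * cos ?y + a\<^sup>2)"
      using p1 by (simp add: ln_mult)
    show ?thesis unfolding l1 l2 l3 by simp
  qed
  also have "\<dots> < 0"
  proof -
    have "sin ?y \<noteq> 0"
    proof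
      assume "sin ?y = 0"
      then obtain i :: int where "?y = of_int i * pi" using sin_zero_iff_int2 by blast
      then have "\<alpha> = of_int i / 2" by (simp add: field_simps)
      with \<alpha>(2) show False by simp
    qed
    then have "(cos ?y)\<^sup>2 < 1" using sin_cos_squared_add[of ?y] by (smt (verit) zero_less_power2)
    then have "(2 * a)\<^sup>2 * (cos ?y)\<^sup>2 < (2 * a)\<^sup>2 * 1" using a by (intro mult_strict_left_mono) auto
    then have "(1 - a\<^sup>2)\<^sup>2 < (1 + a\<^sup>2)\<^sup>2 - (2 * a * cos ?y)\<^sup>2"
      by (simp add: power_mult_distrib) (simp add: power2_eq_square algebra_simps)
    moreover have "0 < (1 - a\<^sup>2)\<^sup>2"
    proof -
      have "a\<^sup>2 < 1" using a by (simp add: power_less_one_iff abs_square_less_1)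
      then show ?thesis by simp
    qed
    ultimately have "ln ((1 - a\<^sup>2)\<^sup>2) < ln ((1 + a\<^sup>2)\<^sup>2 - (2 * a * cos ?y)\<^sup>2)"
      by (subst ln_less_cancel_iff) linarith+
    then show ?thesis by linarith
  qed
  finally show False by simp
qed

section \<open>Quasi-infinite divisibility of the symmetrized law of \<rho>\<close>

text \<open>Interleaving keeps a union of two discrete families, such as the atoms at f and at -f,
  indexed by the natural numbers. With a zero sequence in first place it later moves a weight from l
  to 2 l.\<close>

definition comb :: "(nat \<Rightarrow> 'a) \<Rightarrow> (nat \<Rightarrow> 'a) \<Rightarrow> nat \<Rightarrow> 'a" where
  "comb f g n = (if even n then f (n div 2) else g ((n - 1) div 2))"

lemma comb_sums: "f sums x \<Longrightarrow> g sums y \<Longrightarrow> comb f g sums (x + y :: real)"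
  using sums_if[of g y f x] by (simp add: comb_def[abs_def] add.commute)

lemma comb_sums_complex:
  fixes f g :: "nat \<Rightarrow> complex"
  assumes "f sums x" "g sums y"
  shows "comb f g sums (x + y)"
proof -
  have e: "(\<lambda>n. Re (comb f g n)) = comb (\<lambda>n. Re (f n)) (\<lambda>n. Re (g n))"
    "(\<lambda>n. Im (comb f g n)) = comb (\<lambda>n. Im (f n)) (\<lambda>n. Im (g n))"
    by (auto simp: comb_def)
  show ?thesis
    using assms unfolding sums_complex_iff e by (auto intro: comb_sums)
qed

lemma comb_summable: "summable f \<Longrightarrow> summable g \<Longrightarrow> summable (comb f g :: nat \<Rightarrow> real)"
  using comb_sums summable_def by metis

lemma comb_ball: "(\<And>n. P (f n)) \<Longrightarrow> (\<And>n. P (g n)) \<Longrightarrow> P (comb f g n)"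
  by (simp add: comb_def)

lemma integral_atoms_comb:
  fixes g :: "real \<Rightarrow> complex"
  assumes w: "\<And>n. 0 \<le> w n" "summable w" and w': "\<And>n. 0 \<le> w' n" "summable w'"
    and g: "g \<in> borel_measurable borel" "\<And>x. norm (g x) \<le> B"
  shows "(CLINT x|atoms (comb f f') (comb w w'). g x) = (CLINT x|atoms f w. g x) + (CLINT x|atoms f' w'. g x)"
proof -
  have "(\<lambda>n. of_real (comb w w' n) * g (comb f f' n)) sums (CLINT x|atoms (comb f f') (comb w w'). g x)"
    by (rule integral_atoms[OF _ _ g]) (intro comb_ball[where P="\<lambda>x. 0 \<le> x"] w w', intro comb_summable w w')
  moreover have "(\<lambda>n. of_real (comb w w' n) * g (comb f f' n)) = comb (\<lambda>n. of_real (w n) * g (f n)) (\<lambda>n. of_real (w' n) * g (f' n))"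
    by (auto simp: comb_def)
  ultimately show ?thesis
    using comb_sums_complex[OF integral_atoms[OF w g, of f] integral_atoms[OF w' g, of f']] sums_unique2 by metis
qed

lemma integral_atoms_symmetric:
  assumes w: "\<And>n. 0 \<le> w n" "summable w" and s: "(\<lambda>n. w n * (2 * cos (z * f n) - 2)) sums s"
  shows "(CLINT x|atoms (comb f (\<lambda>n. - f n)) (comb w w). levy_integrand z x) = of_real s"
proof -
  note g = measurable_levy_integrand[of z] levy_integrand_bounded[of z]
  have "(\<lambda>n. of_real (w n) * levy_integrand z (f n) + of_real (w n) * levy_integrand z (- f n)) sums
     ((CLINT x|atoms f w. levy_integrand z x) + (CLINT x|atoms (\<lambda>n. - f n) w. levy_integrand z x))"
    by (intro sums_add integral_atoms[OF w g])
  also have "(\<lambda>n. of_real (w n) * levy_integrand z (f n) + of_real (w n) * levy_integrand z (- f n)) =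
     (\<lambda>n. of_real (w n * (2 * cos (z * f n) - 2)))"
    by (simp only: distrib_left[symmetric] levy_integrand_pair of_real_mult)
  finally have "(CLINT x|atoms f w. levy_integrand z x) + (CLINT x|atoms (\<lambda>n. - f n) w. levy_integrand z x) = of_real s"
    using sums_of_real[OF s] by (rule sums_unique2)
  then show ?thesis by (simp only: integral_atoms_comb[OF w w g])
qed

text \<open>The masses -(-a)^l / l at multiples of \<alpha> are positive for odd l
  (\<open>G\<close>) and negative for even l (\<open>H\<close>). So the Jordan parts are
  \<open>F\<close> and \<open>G\<close> with their reflections against \<open>H\<close> with its
  reflection; they are disjoint because \<alpha> is irrational and odd numbers are not even.\<close>

lemma quasi_ID_phi:
  assumes q: "0 < q" "q < 1" and a: "0 < a" "a < 1" and \<alpha>: "0 < \<alpha>" "\<alpha> \<notin> \<rat>"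
    and \<sigma>: "real_distribution \<sigma>" and ch: "\<And>z. char \<sigma> z = of_real (phi q a \<alpha> z)"
  shows "quasi_infinitely_divisible \<sigma>"
proof -
  define F where "F n = real (Suc n)" for n
  define wF where "wF n = q ^ Suc n / real (Suc n)" for n
  define G where "G n = \<alpha> * real (2 * n + 1)" for n
  define wG where "wG n = a ^ (2 * n + 1) / real (2 * n + 1)" for n
  define H where "H n = \<alpha> * real (2 * n + 2)" for n
  define wH where "wH n = a ^ (2 * n + 2) / real (2 * n + 2)" for n
  let ?pm = "\<lambda>f::nat \<Rightarrow> real. comb f (\<lambda>n. - f n)"
  define fp where "fp = comb (?pm F) (?pm G)"
  define wp where "wp = comb (comb wF wF) (comb wG wG)"
  define fn where "fn = ?pm H"
  define wn where "wn = comb wH wH"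
  have w0: "0 \<le> wF n" "0 \<le> wG n" "0 \<le> wH n" for n
    using q a by (auto simp: wF_def wG_def wH_def)
  have sF: "summable wF" using summable_lgs_weight[of q] q by (simp add: wF_def[abs_def])
  have sa: "summable (\<lambda>n. a ^ Suc n / real (Suc n))" using summable_lgs_weight[of a] a by simp
  have sG: "summable wG"
    using summable_reindex[OF sa, of "\<lambda>n. 2 * n"] a by (simp add: wG_def[abs_def] comp_def inj_def)
  have sH: "summable wH"
    using summable_reindex[OF sa, of "\<lambda>n. 2 * n + 1"] a by (simp add: wH_def[abs_def] comp_def inj_def)
  have wp: "0 \<le> wp n" "summable wp" for n
    unfolding wp_def by (intro comb_ball[where P="\<lambda>x. 0 \<le> x"] w0, intro comb_summable sF sG)
  have wn: "0 \<le> wn n" "summable wn" for n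
    unfolding wn_def by (intro comb_ball[where P="\<lambda>x. 0 \<le> x"] w0, intro comb_summable sH)
  have ne: "F n \<noteq> 0" "G n \<noteq> 0" "H n \<noteq> 0" for n using \<alpha> by (auto simp: F_def G_def H_def)
  have fp0: "fp n \<noteq> 0" for n unfolding fp_def by (intro comb_ball[where P="\<lambda>x. x \<noteq> 0"]) (auto simp: ne)
  have fn0: "fn n \<noteq> 0" for n unfolding fn_def by (intro comb_ball[where P="\<lambda>x. x \<noteq> 0"]) (auto simp: ne)
  have FH: "F n \<noteq> H m" "F n \<noteq> - H m" for n m
  proof -
    have "\<alpha> * real (2 * m + 2) \<noteq> real (Suc n)"
    proof
      assume "\<alpha> * real (2 * m + 2) = real (Suc n)"
      then have "\<alpha> = real (Suc n) / real (2 * m + 2)" by (simp add: field_simps)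
      with \<alpha>(2) show False by (metis Rats_divide Rats_of_nat)
    qed
    then show "F n \<noteq> H m" by (metis F_def H_def)
    have "0 < F n" "0 < H m" using \<alpha> by (auto simp: F_def H_def)
    then show "F n \<noteq> - H m" by linarith
  qed
  have GH: "G n \<noteq> H m" "G n \<noteq> - H m" for n m
  proof -
    have "2 * n + 1 \<noteq> 2 * m + 2" by presburger
    then have "real (2 * n + 1) \<noteq> real (2 * m + 2)" by (simp only: of_nat_eq_iff not_False_eq_True)
    then show "G n \<noteq> H m" using \<alpha> by (simp only: G_def H_def mult_cancel_left) simp
    have "0 < G n" "0 < H m" using \<alpha> by (auto simp: G_def H_def)
    then show "G n \<noteq> - H m" by linarith
  qed
  have sing: "mutually_singular (atoms fp wp) (atoms fn wn)"
    unfolding mutually_singular_def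
  proof (intro bexI conjI)
    let ?A = "range fn"
    show A: "?A \<in> sets borel" by (rule sets.countable) auto
    have neq: "x \<noteq> fn m" if "\<And>m. x \<noteq> H m" "\<And>m. x \<noteq> - H m" for x m
      unfolding fn_def using that by (intro comb_ball[where P="\<lambda>y. x \<noteq> y"])
    have "\<forall>m. fp n \<noteq> fn m" for n
      unfolding fp_def
    proof (intro comb_ball[where P="\<lambda>x. \<forall>m. x \<noteq> fn m"] allI neq)
      show "- F n \<noteq> H m" "- F n \<noteq> - H m" "- G n \<noteq> H m" "- G n \<noteq> - H m" for n m
        using FH[of n m] GH[of n m] by linarith+
    qed (rule FH GH)+
    then have "fp n \<notin> ?A" for n by blast
    then show "emeasure (atoms fp wp) ?A = 0" using A by (intro emeasure_atoms_eq_0) auto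
    show "emeasure (atoms fn wn) (- ?A) = 0" using A by (intro emeasure_atoms_eq_0) auto
  qed
  have form: "char \<sigma> z = exp (\<i> * of_real (0 * z) - of_real (0 * z\<^sup>2) +
      ((CLINT x|atoms fp wp. levy_integrand z x) - (CLINT x|atoms fn wn. levy_integrand z x)))" for z
  proof -
    note g = measurable_levy_integrand[of z] levy_integrand_bounded[of z]
    let ?c = "\<lambda>t. 2 * cos (z * t) - 2"
    have s1: "(\<lambda>n. wF n * ?c (F n)) sums lgs q z"
      using lgs_sums[of q z] q by (simp add: wF_def F_def mult.commute)
    have bound: "summable (\<lambda>n. w n * ?c (f n))" if "\<And>n. 0 \<le> w n" "summable w" for w f :: "nat \<Rightarrow> real"
    proof (rule summable_comparison_test')
      show "summable (\<lambda>n. w n * 4)" using that(2) by (rule summable_mult2)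
      show "norm (w n * ?c (f n)) \<le> w n * 4" for n
      proof -
        have "\<bar>?c (f n)\<bar> \<le> 4" using cos_le_one[of "z * f n"] cos_ge_minus_one[of "z * f n"] by linarith
        then have "w n * \<bar>?c (f n)\<bar> \<le> w n * 4" using that(1) by (rule mult_left_mono)
        then show ?thesis using that(1)[of n] by (simp only: real_norm_def abs_mult abs_of_nonneg)
      qed
    qed
    obtain sO where sO: "(\<lambda>n. wG n * ?c (G n)) sums sO" using bound[OF w0(2) sG] by (auto simp: summable_def)
    obtain sE where sE: "(\<lambda>n. wH n * ?c (H n)) sums sE" using bound[OF w0(3) sH] by (auto simp: summable_def)
    have "\<bar>- a\<bar> < 1" using a by simp
    \<comment> \<open>Consecutive terms are paired: one odd and one even multiple of \<alpha>, that
      is one atom from each Jordan part.\<close>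
    from sums_group[OF lgs_sums[OF this, of "\<alpha> * z"], of 2]
    have grp: "(\<lambda>n. \<Sum>k\<in>{n * 2..<n * 2 + 2}. (- a) ^ Suc k / real (Suc k) * (2 * cos (real (Suc k) * (\<alpha> * z)) - 2)) sums lgs (- a) (\<alpha> * z)"
      by simp
    have "(\<Sum>k\<in>{n * 2..<n * 2 + 2}. (- a) ^ Suc k / real (Suc k) * (2 * cos (real (Suc k) * (\<alpha> * z)) - 2)) =
       wH n * ?c (H n) - wG n * ?c (G n)" for n
    proof -
      have set: "{n * 2..<n * 2 + 2} = {2 * n, 2 * n + 1}" by auto
      have e1: "(- a) ^ Suc (2 * n) = - (a ^ (2 * n + 1))" "(- a) ^ Suc (2 * n + 1) = a ^ (2 * n + 2)"
        by simp_all
      have e2: "real (Suc (2 * n)) * (\<alpha> * z) = z * G n" "real (Suc (2 * n + 1)) * (\<alpha> * z) = z * H n"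
        by (simp_all add: G_def H_def algebra_simps)
      have "(\<Sum>k\<in>{n * 2..<n * 2 + 2}. (- a) ^ Suc k / real (Suc k) * (2 * cos (real (Suc k) * (\<alpha> * z)) - 2)) =
        (- a) ^ Suc (2 * n) / real (Suc (2 * n)) * (2 * cos (real (Suc (2 * n)) * (\<alpha> * z)) - 2) +
        (- a) ^ Suc (2 * n + 1) / real (Suc (2 * n + 1)) * (2 * cos (real (Suc (2 * n + 1)) * (\<alpha> * z)) - 2)"
        unfolding set by (subst sum.insert) auto
      also have "\<dots> = wH n * ?c (H n) - wG n * ?c (G n)"
        unfolding e1 e2 by (simp add: wH_def wG_def)
      finally show ?thesis .
    qed
    with grp have "(\<lambda>n. wH n * ?c (H n) - wG n * ?c (G n)) sums lgs (- a) (\<alpha> * z)" by simp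
    from sums_unique2[OF this sums_diff[OF sE sO]] have OE: "lgs (- a) (\<alpha> * z) = sE - sO" .
    have c2: "0 \<le> comb w w n" "summable (comb w w)" if "\<And>n. 0 \<le> w n" "summable w" for w :: "nat \<Rightarrow> real" and n
      using that by (intro comb_ball[where P="\<lambda>x. 0 \<le> x"], auto intro: comb_summable)
    have "(CLINT x|atoms fp wp. levy_integrand z x) = of_real (lgs q z) + of_real sO"
      unfolding fp_def wp_def
      by (simp only: integral_atoms_comb[OF c2[OF w0(1) sF] c2[OF w0(2) sG] g]
          integral_atoms_symmetric[OF w0(1) sF s1] integral_atoms_symmetric[OF w0(2) sG sO])
    moreover have "(CLINT x|atoms fn wn. levy_integrand z x) = of_real sE"
      unfolding fn_def wn_def by (rule integral_atoms_symmetric[OF w0(3) sH sE])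
    ultimately show ?thesis unfolding ch phi_def OE exp_of_real[symmetric] by (simp add: diff_diff_eq2)
  qed
  show ?thesis unfolding quasi_infinitely_divisible_def
    by (rule conjI[OF \<sigma>], rule exI[of _ 0], rule exI[of _ 0], rule exI[of _ "atoms fp wp"], rule exI[of _ "atoms fn wn"])
       (intro conjI allI pre_levy_atoms wp wn fp0 fn0 sing form)
qed

section \<open>Infinite products of compound Poisson laws\<close>

text \<open>Compound Poisson law on the naturals with Levy mass \<open>t * w n\<close> at n + 1. A
  positive \<open>w 0\<close> makes the total mass \<open>W\<close> positive, so that dividing by it
  gives a jump law; the bound on the mean is kept for the convergence of an infinite sum.\<close>

lemma nat_cpois:
  assumes w: "\<And>n. 0 \<le> w n" "0 < w 0" "summable (\<lambda>n. w n * real (Suc n))" and t: "0 < t"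
  obtains X :: "nat pmf" where
    "\<And>y V. (\<lambda>n. of_real (w n) * (iexp (real (Suc n) * y) - 1)) sums V \<Longrightarrow> (CLINT x|X. iexp (real x * y)) = exp (of_real t * V)"
    "(\<integral>\<^sup>+x. ennreal (real x) \<partial>X) \<le> ennreal (t * (\<Sum>n. w n * real (Suc n)))"
proof -
  have sw: "summable w"
  proof (rule summable_comparison_test'[OF w(3)])
    fix n :: nat
    have "w n * 1 \<le> w n * real (Suc n)" using w(1)[of n] by (intro mult_left_mono) auto
    then show "norm (w n) \<le> w n * real (Suc n)" using w(1)[of n] by simp
  qed
  define W where "W = suminf w"
  have W: "0 < W" unfolding W_def using sw w by (intro suminf_pos2[of _ 0]) auto
  have wW: "w sums W" unfolding W_def by (rule summable_sums[OF sw])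
  have one: "(\<integral>\<^sup>+n. ennreal (w n / W) \<partial>count_space UNIV) = 1"
  proof -
    have "(\<lambda>n. w n / W) sums (W / W)" by (rule sums_divide[OF wW])
    then have "(\<Sum>n. ennreal (w n / W)) = ennreal 1" using W w(1) by (intro suminf_ennreal_eq) auto
    then show ?thesis by (simp add: nn_integral_count_space_nat)
  qed
  define J where "J = embed_pmf (\<lambda>n. w n / W)"
  have J: "pmf J n = w n / W" for n
    unfolding J_def by (rule pmf_embed_pmf) (use w(1) W one in auto)
  have tW: "0 < t * W" using t W by simp
  show ?thesis
  proof (rule that[of "cpois (t * W) (map_pmf Suc J)"])
    fix y V assume V: "(\<lambda>n. of_real (w n) * (iexp (real (Suc n) * y) - 1)) sums V"
    let ?E = "CLINT n|J. iexp (real (Suc n) * y)"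
    have "(\<lambda>k. of_real (pmf J k) * iexp (real (Suc k) * y)) sums ?E"
      by (rule expectation_nat_sums[where B=1]) simp
    then have "(\<lambda>k. of_real W * (of_real (pmf J k) * iexp (real (Suc k) * y)) - of_real (w k)) sums (of_real W * ?E - of_real W)"
      by (intro sums_diff sums_mult sums_of_real wW)
    moreover have "of_real W * (of_real (pmf J k) * iexp (real (Suc k) * y)) - of_real (w k) = of_real (w k) * (iexp (real (Suc k) * y) - 1)" for k
      using W by (simp add: J algebra_simps)
    ultimately have VE: "V = of_real W * ?E - of_real W" using V sums_unique2 by auto
    have "(CLINT x|cpois (t * W) (map_pmf Suc J). iexp (real x * y)) = exp (of_real (t * W) * ((CLINT x|map_pmf Suc J. iexp (real x * y)) - 1))"
      by (rule expectation_cpois_mult[OF tW, where B=1]) (auto simp: algebra_simps simp flip: exp_add)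
    also have "(CLINT x|map_pmf Suc J. iexp (real x * y)) = ?E" by simp
    also have "of_real (t * W) * (?E - 1) = of_real t * V" by (simp add: VE algebra_simps)
    finally show "(CLINT x|cpois (t * W) (map_pmf Suc J). iexp (real x * y)) = exp (of_real t * V)" .
  next
    have "(\<integral>\<^sup>+x. ennreal (real x) \<partial>cpois (t * W) (map_pmf Suc J)) \<le> ennreal (t * W) * (\<integral>\<^sup>+x. ennreal (real x) \<partial>map_pmf Suc J)"
      by (rule nn_integral_cpois_le[OF tW]) (auto simp flip: ennreal_plus)
    also have "(\<integral>\<^sup>+x. ennreal (real x) \<partial>map_pmf Suc J) = (\<Sum>n. ennreal (w n * real (Suc n) / W))"
      unfolding nn_integral_map_pmf
      using w(1) W by (simp add: nn_integral_measure_pmf nn_integral_count_space_nat J del: of_nat_Suc flip: ennreal_mult)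
    also have "\<dots> = ennreal ((\<Sum>n. w n * real (Suc n)) / W)"
      using W w(1) by (intro suminf_ennreal_eq sums_divide summable_sums w(3)) auto
    also have "ennreal (t * W) * \<dots> = ennreal (t * (\<Sum>n. w n * real (Suc n)))"
    proof -
      have s0: "0 \<le> (\<Sum>n. w n * real (Suc n))" by (rule suminf_nonneg[OF w(3)]) (simp add: w(1))
      have "ennreal (t * W) * ennreal ((\<Sum>n. w n * real (Suc n)) / W) = ennreal (t * W * ((\<Sum>n. w n * real (Suc n)) / W))"
        by (rule ennreal_mult[symmetric]) (use W t s0 in \<open>simp_all del: of_nat_Suc\<close>)
      also have "t * W * ((\<Sum>n. w n * real (Suc n)) / W) = t * (\<Sum>n. w n * real (Suc n))" using W by simp
      finally show ?thesis .
    qed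
    finally show "(\<integral>\<^sup>+x. ennreal (real x) \<partial>cpois (t * W) (map_pmf Suc J)) \<le> ennreal (t * (\<Sum>n. w n * real (Suc n)))" .
  qed
qed

text \<open>Independent variables with means at most t B, scaled by c^(-m), have summable means.
  Their sum converges absolutely almost surely, and its law has the limit of the finite products as
  characteristic function.\<close>

lemma infinite_cpois:
  assumes c: "1 < c" and t: "0 < t"
    and w: "\<And>m n. 0 \<le> w m n" "\<And>m. 0 < w m 0" "\<And>m. summable (\<lambda>n. w m n * real (Suc n))" "\<And>m. (\<Sum>n. w m n * real (Suc n)) \<le> B"
    and V: "\<And>m y. (\<lambda>n. of_real (w m n) * (iexp (real (Suc n) * y) - 1)) sums V m y"
  obtains \<Theta> where "real_distribution \<Theta>" "\<And>z. (\<lambda>K. exp (of_real t * (\<Sum>m<K. V m (z / c ^ m)))) \<longlonglongrightarrow> char \<Theta> z"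
proof -
  have "\<exists>X :: nat pmf. (\<forall>y. (CLINT x|X. iexp (real x * y)) = exp (of_real t * V m y)) \<and>
     (\<integral>\<^sup>+x. ennreal (real x) \<partial>X) \<le> ennreal (t * (\<Sum>n. w m n * real (Suc n)))" for m
  proof (rule nat_cpois[of "w m", OF w(1) w(2) w(3) t])
    fix X :: "nat pmf"
    assume X: "\<And>y V. (\<lambda>n. of_real (w m n) * (iexp (real (Suc n) * y) - 1)) sums V \<Longrightarrow> (CLINT x|X. iexp (real x * y)) = exp (of_real t * V)"
      "(\<integral>\<^sup>+x. ennreal (real x) \<partial>X) \<le> ennreal (t * (\<Sum>n. w m n * real (Suc n)))"
    show ?thesis by (rule exI[of _ X], rule conjI, rule allI, rule X(1), rule V, rule X(2))
  qed
  from choice[OF allI[OF this]] obtain X :: "nat \<Rightarrow> nat pmf"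
    where XX: "\<forall>m. (\<forall>y. (CLINT x|X m. iexp (real x * y)) = exp (of_real t * V m y)) \<and>
      (\<integral>\<^sup>+x. ennreal (real x) \<partial>X m) \<le> ennreal (t * (\<Sum>n. w m n * real (Suc n)))" by (rule exE)
  have X: "(CLINT x|X m. iexp (real x * y)) = exp (of_real t * V m y)"
    "(\<integral>\<^sup>+x. ennreal (real x) \<partial>X m) \<le> ennreal (t * (\<Sum>n. w m n * real (Suc n)))" for m y
    using XX by (rule allE[of _ m], simp)+
  define D where "D m = distr (measure_pmf (X m)) borel real" for m
  have D: "prob_space (D m)" "sets (D m) = sets borel" for m
    by (auto simp: D_def intro: measure_pmf.prob_space_distr)
  let ?P = "PiM UNIV D"
  interpret prob_space ?P by (intro prob_space_PiM D)
  note coord = indep_coordinates[of D, OF D]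
  have [measurable]: "(\<lambda>\<omega>. \<omega> m / c ^ m) \<in> borel_measurable ?P" for m using coord(1)[of m] by measurable
  define S where "S \<omega> = (\<Sum>m. \<omega> m / c ^ m)" for \<omega> :: "nat \<Rightarrow> real"
  have Sm: "S \<in> borel_measurable ?P" unfolding S_def[abs_def] by measurable
  have B0: "0 \<le> B" using w(1,3,4)[of 0] by (meson mult_nonneg_nonneg of_nat_0_le_iff order_trans suminf_nonneg)
  have cs: "summable (\<lambda>m. t * B * (1 / c) ^ m)" using c by (intro summable_mult summable_geometric) simp
  have "(\<integral>\<^sup>+\<omega>. (\<Sum>m. ennreal \<bar>\<omega> m / c ^ m\<bar>) \<partial>?P) = (\<Sum>m. \<integral>\<^sup>+\<omega>. ennreal \<bar>\<omega> m / c ^ m\<bar> \<partial>?P)"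
    by (rule nn_integral_suminf) measurable
  also have "\<dots> \<le> (\<Sum>m. ennreal (t * B * (1 / c) ^ m))"
  proof (rule suminf_le)
    fix m
    have "(\<integral>\<^sup>+\<omega>. ennreal \<bar>\<omega> m / c ^ m\<bar> \<partial>?P) = (\<integral>\<^sup>+x. ennreal \<bar>x / c ^ m\<bar> \<partial>D m)"
      unfolding coord(2)[of m, symmetric] by (rule nn_integral_distr[OF coord(1), symmetric]) measurable
    also have "\<dots> = (\<integral>\<^sup>+x. ennreal (1 / c ^ m) * ennreal (real x) \<partial>X m)"
      using c unfolding D_def by (subst nn_integral_distr) (auto simp: ennreal_mult[symmetric] intro!: nn_integral_cong)
    also have "\<dots> = ennreal (1 / c ^ m) * (\<integral>\<^sup>+x. ennreal (real x) \<partial>X m)" by (rule nn_integral_cmult) simp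
    also have "\<dots> \<le> ennreal (1 / c ^ m) * ennreal (t * B)"
      using w(4)[of m] t by (intro mult_left_mono order_trans[OF X(2)] ennreal_leI) auto
    also have "\<dots> = ennreal (t * B * (1 / c) ^ m)"
      using c t B0 by (subst ennreal_mult[symmetric]) (auto simp: power_one_over mult.commute)
    finally show "(\<integral>\<^sup>+\<omega>. ennreal \<bar>\<omega> m / c ^ m\<bar> \<partial>?P) \<le> ennreal (t * B * (1 / c) ^ m)" .
  qed auto
  also have "\<dots> < \<top>" using cs c t B0 by (subst suminf_ennreal2) auto
  finally have "(\<integral>\<^sup>+\<omega>. (\<Sum>m. ennreal \<bar>\<omega> m / c ^ m\<bar>) \<partial>?P) \<noteq> \<infinity>" by auto
  then have "AE \<omega> in ?P. (\<Sum>m. ennreal \<bar>\<omega> m / c ^ m\<bar>) \<noteq> \<infinity>"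
    by (intro nn_integral_PInf_AE) measurable
  then have conv: "AE \<omega> in ?P. (\<lambda>K. \<Sum>m<K. \<omega> m / c ^ m) \<longlonglongrightarrow> S \<omega>"
  proof eventually_elim
    case (elim \<omega>)
    then have "summable (\<lambda>m. \<bar>\<omega> m / c ^ m\<bar>)" by (intro summable_suminf_not_top) auto
    then have "summable (\<lambda>m. \<omega> m / c ^ m)" by (rule summable_rabs_cancel)
    then show ?case unfolding S_def by (rule summable_LIMSEQ)
  qed
  show ?thesis
  proof (rule that)
    show "real_distribution (distr ?P borel S)" by (rule real_distribution_distr[OF Sm])
    fix z
    have im: "(\<lambda>x. iexp (z * x)) \<in> borel_measurable borel"
      by (intro borel_measurable_continuous_onI continuous_intros)
    have "(\<lambda>K. CLINT \<omega>|?P. iexp (z * (\<Sum>m<K. \<omega> m / c ^ m))) \<longlonglongrightarrow> (CLINT \<omega>|?P. iexp (z * S \<omega>))"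
    proof (rule integral_dominated_convergence[where w="\<lambda>_. 1"])
      show "(\<lambda>\<omega>. iexp (z * S \<omega>)) \<in> borel_measurable ?P" by (rule measurable_compose[OF Sm im])
      show "(\<lambda>\<omega>. iexp (z * (\<Sum>m<K. \<omega> m / c ^ m))) \<in> borel_measurable ?P" for K
        by (rule measurable_compose[OF _ im]) measurable
      show "AE \<omega> in ?P. (\<lambda>K. iexp (z * (\<Sum>m<K. \<omega> m / c ^ m))) \<longlonglongrightarrow> iexp (z * S \<omega>)"
        using conv by eventually_elim (intro tendsto_intros)
    qed auto
    moreover have "(CLINT \<omega>|?P. iexp (z * (\<Sum>m<K. \<omega> m / c ^ m))) = exp (of_real t * (\<Sum>m<K. V m (z / c ^ m)))" for K
    proof -
      have fm: "(\<lambda>x. iexp (x * (z / c ^ m))) \<in> borel_measurable borel" for m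
        by (intro borel_measurable_continuous_onI continuous_intros)
      have ind: "indep_vars (\<lambda>_. borel) (\<lambda>m \<omega>. iexp (\<omega> m * (z / c ^ m))) {..<K}"
        by (rule indep_vars_compose2[OF indep_vars_subset[OF coord(3)] fm]) simp
      have "iexp (z * (\<Sum>m<K. \<omega> m / c ^ m)) = (\<Prod>m<K. iexp (\<omega> m * (z / c ^ m)))" for \<omega> :: "nat \<Rightarrow> real"
        by (simp add: sum_distrib_left exp_sum[symmetric] mult_ac)
      then have "(CLINT \<omega>|?P. iexp (z * (\<Sum>m<K. \<omega> m / c ^ m))) = (CLINT \<omega>|?P. \<Prod>m<K. iexp (\<omega> m * (z / c ^ m)))" by presburger
      also have "\<dots> = (\<Prod>m<K. CLINT \<omega>|?P. iexp (\<omega> m * (z / c ^ m)))"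
      proof (rule indep_vars_lebesgue_integral[OF _ ind])
        show "integrable ?P (\<lambda>\<omega>. iexp (\<omega> m * (z / c ^ m)))" for m
        proof (rule integrable_const_bound[where B=1])
          show "(\<lambda>\<omega>. iexp (\<omega> m * (z / c ^ m))) \<in> borel_measurable ?P" by (rule measurable_compose[OF coord(1) fm])
        qed simp
      qed simp
      also have "\<dots> = (\<Prod>m<K. exp (of_real t * V m (z / c ^ m)))"
      proof (intro prod.cong refl)
        fix m
        have "(CLINT \<omega>|?P. iexp (\<omega> m * (z / c ^ m))) = (CLINT x|D m. iexp (x * (z / c ^ m)))"
          unfolding coord(2)[of m, symmetric] by (rule integral_distr[OF coord(1) fm, symmetric])
        also have "\<dots> = (CLINT x|X m. iexp (real x * (z / c ^ m)))"
          unfolding D_def by (rule integral_distr[OF _ fm]) simp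
        also have "\<dots> = exp (of_real t * V m (z / c ^ m))" by (rule X(1))
        finally show "(CLINT \<omega>|?P. iexp (\<omega> m * (z / c ^ m))) = exp (of_real t * V m (z / c ^ m))" .
      qed
      finally show ?thesis by (simp add: exp_sum sum_distrib_left)
    qed
    moreover have "char (distr ?P borel S) z = (CLINT \<omega>|?P. iexp (z * S \<omega>))"
      unfolding char_def by (rule integral_distr[OF Sm im])
    ultimately show "(\<lambda>K. exp (of_real t * (\<Sum>m<K. V m (z / c ^ m)))) \<longlonglongrightarrow> char (distr ?P borel S) z"
      by (simp only:)
  qed
qed

text \<open>The n-th root is explicit: the one-sided sum at time 1/n, symmetrized. Symmetrization
  doubles the real part of the exponent, and 2 Re V = R is the exponent of the symmetric Levy
  measure, so the n-th power is the given limit.\<close>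

lemma ID_infinite_product:
  assumes c: "1 < c"
    and w: "\<And>m n. 0 \<le> w m n" "\<And>m. 0 < w m 0" "\<And>m. summable (\<lambda>n. w m n * real (Suc n))" "\<And>m. (\<Sum>n. w m n * real (Suc n)) \<le> B"
    and R: "\<And>m y. (\<lambda>n. w m n * (2 * cos (real (Suc n) * y) - 2)) sums R m y"
    and \<sigma>: "real_distribution \<sigma>" and ch: "\<And>z. char \<sigma> z = of_real (H z)"
    and H: "\<And>z. (\<lambda>K. exp (\<Sum>m<K. R m (z / c ^ m))) \<longlonglongrightarrow> H z"
  shows "\<sigma> \<in> ID"
proof (rule ID_I[OF \<sigma>])
  fix n :: nat assume n: "1 \<le> n"
  define V where "V m y = (\<Sum>n. of_real (w m n) * (iexp (real (Suc n) * y) - 1))" for m y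
  have V: "(\<lambda>n. of_real (w m n) * (iexp (real (Suc n) * y) - 1)) sums V m y" for m y
  proof -
    have "summable (\<lambda>n. of_real (w m n) * (iexp (real (Suc n) * y) - 1))"
    proof (rule summable_comparison_test')
      show "summable (\<lambda>n. 2 * (w m n * real (Suc n)))" by (rule summable_mult[OF w(3)])
      fix n :: nat
      have "norm (iexp (real (Suc n) * y) - 1) \<le> norm (iexp (real (Suc n) * y)) + norm (1::complex)" by (rule norm_triangle_ineq4)
      then have "norm (iexp (real (Suc n) * y) - 1) \<le> 2" by simp
      also have "\<dots> \<le> 2 * real (Suc n)" by simp
      finally have "w m n * norm (iexp (real (Suc n) * y) - 1) \<le> w m n * (2 * real (Suc n))" by (rule mult_left_mono) (rule w(1))
      then show "norm (of_real (w m n) * (iexp (real (Suc n) * y) - 1)) \<le> 2 * (w m n * real (Suc n))"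
        using w(1)[of m n] by (simp only: norm_mult norm_of_real abs_of_nonneg mult.left_commute)
    qed
    then show ?thesis unfolding V_def by (rule summable_sums)
  qed
  have ReV: "2 * Re (V m y) = R m y" for m y
  proof -
    have s: "(\<lambda>n. 2 * Re (of_real (w m n) * (iexp (real (Suc n) * y) - 1))) sums (2 * Re (V m y))"
      by (intro sums_mult sums_Re V)
    have e: "2 * Re (of_real (w m n) * (iexp (real (Suc n) * y) - 1)) = w m n * (2 * cos (real (Suc n) * y) - 2)" for n
      by (simp only: Re_complex_of_real Im_complex_of_real times_complex.sel minus_complex.sel Re_iexp one_complex.sel mult_zero_left)
        (simp add: algebra_simps)
    show ?thesis by (rule sums_unique2[OF s[unfolded e] R])
  qed
  have t: "0 < 1 / real n" using n by simp
  obtain \<Theta> where \<Theta>: "real_distribution \<Theta>"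
    "\<And>z. (\<lambda>K. exp (of_real (1 / real n) * (\<Sum>m<K. V m (z / c ^ m)))) \<longlonglongrightarrow> char \<Theta> z"
    by (rule infinite_cpois[where w=w and V=V, OF c t w V]) (rule that)
  show "\<exists>\<tau>. real_distribution \<tau> \<and> (\<forall>z. char \<sigma> z = char \<tau> z ^ n)"
  proof (intro exI[of _ "symmetrization \<Theta>"] conjI allI)
    show "real_distribution (symmetrization \<Theta>)" by (rule symmetrization(1)[OF \<Theta>(1)])
    fix z
    have l: "(\<lambda>K. ((cmod (exp (of_real (1 / real n) * (\<Sum>m<K. V m (z / c ^ m)))))\<^sup>2) ^ n) \<longlonglongrightarrow> ((cmod (char \<Theta> z))\<^sup>2) ^ n"
      by (intro tendsto_intros \<Theta>(2))
    have e: "((cmod (exp (of_real (1 / real n) * (\<Sum>m<K. V m (z / c ^ m)))))\<^sup>2) ^ n = exp (\<Sum>m<K. R m (z / c ^ m))" for K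
    proof -
      have "((cmod (exp (of_real (1 / real n) * (\<Sum>m<K. V m (z / c ^ m)))))\<^sup>2) ^ n =
         exp (real n * (2 * ((1 / real n) * (\<Sum>m<K. Re (V m (z / c ^ m))))))"
        by (simp only: norm_exp_eq_Re Re_complex_of_real Im_complex_of_real times_complex.sel Re_sum exp_of_nat_mult exp_double mult_zero_left diff_zero)
      also have "real n * (2 * ((1 / real n) * (\<Sum>m<K. Re (V m (z / c ^ m))))) = (\<Sum>m<K. R m (z / c ^ m))"
        using n by (simp add: ReV[symmetric] sum_distrib_left)
      finally show ?thesis .
    qed
    have "H z = ((cmod (char \<Theta> z))\<^sup>2) ^ n" by (rule LIMSEQ_unique[OF H l[unfolded e]])
    then show "char \<sigma> z = char (symmetrization \<Theta>) z ^ n"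
      unfolding ch symmetrization(2)[OF \<Theta>(1)] by (simp only: of_real_power)
  qed
qed

section \<open>The two laws\<close>

lemma realizes_realization:
  assumes "1 < c" "0 < p" "0 < q" "0 < r" and R: "realizes k c p q r M N L"
  obtains u v w where "realization k c u v w M N L" "u = p * (u + v + w)" "v = q * (u + v + w)" "w = r * (u + v + w)" "0 < u + v + w"
proof -
  obtain u v w where uvw: "0 \<le> u" "0 \<le> v" "0 \<le> w" "0 < u + v + w"
    "p = u / (u + v + w)" "q = v / (u + v + w)" "r = w / (u + v + w)" "biv_compound_poisson k c u v w M N L"
    using R unfolding realizes_def by blast
  have e: "u = p * (u + v + w)" "v = q * (u + v + w)" "w = r * (u + v + w)"
  proof -
    have "x = x / y * y" if "0 < y" for x y :: real using that by simp
    note d = this[OF uvw(4)]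
    show "u = p * (u + v + w)" unfolding uvw(5) by (rule d)
    show "v = q * (u + v + w)" unfolding uvw(6) by (rule d)
    show "w = r * (u + v + w)" unfolding uvw(7) by (rule d)
  qed
  have "0 < p * (u + v + w)" "0 < q * (u + v + w)" "0 < r * (u + v + w)" using assms(2-4) uvw(4) by simp_all
  then have pos: "0 < u" "0 < v" "0 < w" unfolding e[symmetric] .
  have "realization k c u v w M N L" by (rule realization.intro) (rule assms(1) pos uvw(8))+
  from that[OF this e uvw(4)] show ?thesis .
qed

definition rho_char :: "int \<Rightarrow> real \<Rightarrow> real \<Rightarrow> real \<Rightarrow> real \<Rightarrow> real \<Rightarrow> complex" where
  "rho_char k c p q r z = (of_real p + of_real r * iexp (c powi (- k) * z)) / (1 - of_real q * iexp z)"

text \<open>The characteristic function is the same for every realization, so by Levy uniqueness the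
  description has at most one solution; the constructed process provides one.\<close>

lemma rho_law:
  assumes c: "1 < c" and p: "0 < p" "0 < q" "0 < r" "p + q + r = 1"
  shows "real_distribution (rho_law k c p q r)" "char (rho_law k c p q r) z = rho_char k c p q r z"
proof -
  let ?P = "\<lambda>\<sigma>. \<exists>(M :: (nat \<Rightarrow> real) measure) N L. realizes k c p q r M N L \<and>
        \<sigma> = distr M borel (\<lambda>\<omega>. L (first_jump_time N \<omega>) \<omega>)"
  have key: "real_distribution \<sigma> \<and> char \<sigma> = rho_char k c p q r" if P: "?P \<sigma>" for \<sigma>
  proof -
    obtain M :: "(nat \<Rightarrow> real) measure" and N L where R: "realizes k c p q r M N L"
      and \<sigma>: "\<sigma> = distr M borel (\<lambda>\<omega>. L (first_jump_time N \<omega>) \<omega>)" using P by blast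
    obtain u v w where B: "realization k c u v w M N L" and e: "u = p * (u + v + w)" "v = q * (u + v + w)" "w = r * (u + v + w)"
      and s: "0 < u + v + w"
      by (rule realizes_realization[OF c p(1-3) R]) (rule that)
    interpret realization k c u v w M N L by (rule B)
    define S where "S = tot"
    have s': "S \<noteq> 0" using s by (simp add: S_def tot_def)
    have e': "u = p * S" "v = q * S" "w = r * S" unfolding S_def tot_def by (rule e)+
    have "char \<sigma> z = rho_char k c p q r z" for z
    proof -
      have "char \<sigma> z = (of_real u + of_real w * iexp (al * z)) / (of_real S - of_real v * iexp z)"
        unfolding \<sigma> S_def by (rule char_rho)
      also have "of_real u + of_real w * iexp (al * z) = of_real S * (of_real p + of_real r * iexp (al * z))"
        by (simp add: e'(1,3) algebra_simps)
      also have "of_real S - of_real v * iexp z = of_real S * (1 - of_real q * iexp z)"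
        by (simp add: e'(2) algebra_simps)
      finally show ?thesis using s' by (simp add: rho_char_def al_def)
    qed
    then have "char \<sigma> = rho_char k c p q r" by (rule ext)
    moreover have "real_distribution \<sigma>" unfolding \<sigma> by (rule real_distribution_distr[OF measurable_rho])
    ultimately show ?thesis by (rule conjI[rotated])
  qed
  have ex: "?P (distr (pt_space (rate3 p q r)) borel (\<lambda>\<omega>. snd (pproc (c powi (- k)) (first_jump_time (\<lambda>t \<omega>. fst (pproc (c powi (- k)) t \<omega>)) \<omega>) \<omega>)))"
    by (rule exI, rule exI, rule exI, rule conjI[OF realizes_pproc[OF c p] refl])
  have uniq: "\<sigma> = \<sigma>'" if "?P \<sigma>" "?P \<sigma>'" for \<sigma> \<sigma>'
    using key[OF that(1)] key[OF that(2)] by (intro Levy_uniqueness) (simp_all only:)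
  have "\<exists>!\<sigma>. ?P \<sigma>" by (rule ex1I[where P="?P"], rule ex, erule uniq, rule ex)
  from key[OF theI'[OF this]] show "real_distribution (rho_law k c p q r)" "char (rho_law k c p q r) z = rho_char k c p q r z"
    by (auto simp: rho_law_def)
qed

text \<open>Iterating the equation K times leaves the factor g (z / c^K), which tends to g 0 = 1 by
  continuity; dividing by it gives the convergence of the partial products.\<close>

lemma fixed_point_product:
  fixes g f :: "real \<Rightarrow> complex"
  assumes c: "1 < c" and g: "isCont g 0" "g 0 = 1" and eq: "\<And>z. g z = f z * g (z / c)" and nz: "\<And>z. f z \<noteq> 0"
  shows "(\<lambda>K. \<Prod>m<K. f (z / c ^ m)) \<longlonglongrightarrow> g z"
proof -
  have it: "g z = (\<Prod>m<K. f (z / c ^ m)) * g (z / c ^ K)" for K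
  proof (induction K)
    case (Suc K)
    have "g (z / c ^ K) = f (z / c ^ K) * g (z / c ^ Suc K)" using eq[of "z / c ^ K"] by (simp add: mult.commute)
    then show ?case using Suc by (simp add: mult.assoc)
  qed simp
  have "(\<lambda>K. z * (1 / c) ^ K) \<longlonglongrightarrow> 0" using c by (intro tendsto_mult_right_zero LIMSEQ_power_zero) simp
  then have z0: "(\<lambda>K. z / c ^ K) \<longlonglongrightarrow> 0" by (simp add: power_one_over)
  have g1: "(\<lambda>K. g (z / c ^ K)) \<longlonglongrightarrow> 1" using isCont_tendsto_compose[OF g(1) z0] g(2) by simp
  have "(\<lambda>K. g z / g (z / c ^ K)) \<longlonglongrightarrow> g z / 1" by (intro tendsto_intros g1) simp
  moreover have "eventually (\<lambda>K. g z / g (z / c ^ K) = (\<Prod>m<K. f (z / c ^ m))) sequentially"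
  proof -
    have "eventually (\<lambda>K. g (z / c ^ K) \<noteq> 0) sequentially" using tendsto_imp_eventually_ne[OF g1] by simp
    then show ?thesis
    proof eventually_elim
      case (elim K)
      have "g z / g (z / c ^ K) = ((\<Prod>m<K. f (z / c ^ m)) * g (z / c ^ K)) / g (z / c ^ K)" by (simp only: it[of K, symmetric])
      then show ?case using elim by simp
    qed
  qed
  ultimately have "(\<lambda>K. \<Prod>m<K. f (z / c ^ m)) \<longlonglongrightarrow> g z / 1" by (rule Lim_transform_eventually)
  then show ?thesis by simp
qed

text \<open>The functional equation presents the characteristic function as a limit that mentions no
  realization; uniqueness rests on this.\<close>

lemma mu_law:
  assumes c: "1 < c" and p: "0 < p" "0 < q" "0 < r" "p + q + r = 1" and rp: "r < p"
  shows "real_distribution (mu_law k c p q r)"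
    "(\<lambda>K. \<Prod>m<K. rho_char k c p q r (z / c ^ m)) \<longlonglongrightarrow> char (mu_law k c p q r) z"
proof -
  let ?P = "\<lambda>\<sigma>. \<exists>(M :: (nat \<Rightarrow> real) measure) N L. realizes k c p q r M N L \<and>
        \<sigma> = distr M borel (\<lambda>\<omega>. Lim at_top (\<lambda>t. exp_integral c N L t \<omega>))"
  have q1: "q < 1" using p by simp
  have nz: "1 - of_real q * iexp z \<noteq> 0" for z
  proof
    assume "1 - of_real q * iexp z = 0"
    then have "norm (1 - of_real q * iexp z) = 0" by simp
    then show False using lgs_pos[of q z] p(2) q1 by (simp flip: cmod_1_minus)
  qed
  have nz2: "rho_char k c p q r z \<noteq> 0" for z
  proof -
    have "of_real p + of_real r * iexp (c powi (- k) * z) \<noteq> 0"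
    proof
      assume "of_real p + of_real r * iexp (c powi (- k) * z) = 0"
      then have "complex_of_real p = - (of_real r * iexp (c powi (- k) * z))" by (simp add: add_eq_0_iff2)
      then have "norm (complex_of_real p) = norm (- (of_real r * iexp (c powi (- k) * z)))" by (rule arg_cong)
      then have "\<bar>p\<bar> = \<bar>r\<bar>" by (simp only: norm_minus_cancel norm_mult norm_of_real norm_exp_i_times mult_1_right)
      then show False using p rp by simp
    qed
    then show ?thesis using nz by (simp add: rho_char_def)
  qed
  have key: "real_distribution \<sigma> \<and> (\<forall>z. (\<lambda>K. \<Prod>m<K. rho_char k c p q r (z / c ^ m)) \<longlonglongrightarrow> char \<sigma> z)" if P: "?P \<sigma>" for \<sigma>
  proof -
    obtain M :: "(nat \<Rightarrow> real) measure" and N L where R: "realizes k c p q r M N L"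
      and \<sigma>: "\<sigma> = distr M borel (\<lambda>\<omega>. Lim at_top (\<lambda>t. exp_integral c N L t \<omega>))" using P by blast
    obtain u v w where B: "realization k c u v w M N L" and e: "u = p * (u + v + w)" "v = q * (u + v + w)" "w = r * (u + v + w)"
      and s: "0 < u + v + w"
      by (rule realizes_realization[OF c p(1-3) R]) (rule that)
    interpret realization k c u v w M N L by (rule B)
    define S where "S = tot"
    have s': "S \<noteq> 0" using s by (simp add: S_def tot_def)
    have e': "u = p * S" "v = q * S" "w = r * S" unfolding S_def tot_def by (rule e)+
    interpret S: real_distribution \<sigma> unfolding \<sigma> by (rule real_distribution_distr[OF measurable_mu])
    have "char \<sigma> z = rho_char k c p q r z * char \<sigma> (z / c)" for z
    proof -
      have "of_real u + of_real w * iexp (al * z) = of_real S * (of_real p + of_real r * iexp (al * z))"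
        by (simp add: e'(1,3) algebra_simps)
      moreover have "of_real S - of_real v * iexp z = of_real S * (1 - of_real q * iexp z)"
        by (simp add: e'(2) algebra_simps)
      ultimately have "char \<sigma> z * (of_real S * (1 - of_real q * iexp z)) = (of_real S * (of_real p + of_real r * iexp (al * z))) * char \<sigma> (z / c)"
        using char_mu[of z, folded S_def] unfolding \<sigma> by (simp only:)
      then have "of_real S * (char \<sigma> z * (1 - of_real q * iexp z)) = of_real S * ((of_real p + of_real r * iexp (al * z)) * char \<sigma> (z / c))"
        by (simp only: mult.left_commute mult.assoc)
      then have "char \<sigma> z * (1 - of_real q * iexp z) = (of_real p + of_real r * iexp (al * z)) * char \<sigma> (z / c)"
        using s' by (simp only: mult_cancel_left of_real_eq_0_iff) simp
      then have "char \<sigma> z = (of_real p + of_real r * iexp (al * z)) * char \<sigma> (z / c) / (1 - of_real q * iexp z)"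
        using nz by (simp only: nonzero_eq_divide_eq not_False_eq_True)
      then show ?thesis by (simp add: rho_char_def al_def)
    qed
    from fixed_point_product[OF c S.isCont_char S.char_zero this nz2]
    show ?thesis using S.real_distribution_axioms by blast
  qed
  have ex: "?P (distr (pt_space (rate3 p q r)) borel (\<lambda>\<omega>. Lim at_top (\<lambda>t. exp_integral c (\<lambda>t \<omega>. fst (pproc (c powi (- k)) t \<omega>)) (\<lambda>t \<omega>. snd (pproc (c powi (- k)) t \<omega>)) t \<omega>)))"
    by (rule exI, rule exI, rule exI, rule conjI[OF realizes_pproc[OF c p] refl])
  have uniq: "\<sigma> = \<sigma>'" if "?P \<sigma>" "?P \<sigma>'" for \<sigma> \<sigma>'
  proof (rule Levy_uniqueness)
    show "real_distribution \<sigma>" "real_distribution \<sigma>'" using key[OF that(1)] key[OF that(2)] by auto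
    show "char \<sigma> = char \<sigma>'"
    proof
      fix z
      show "char \<sigma> z = char \<sigma>' z"
        using key[OF that(1)] key[OF that(2)] by (intro LIMSEQ_unique[of "\<lambda>K. \<Prod>m<K. rho_char k c p q r (z / c ^ m)"]) auto
    qed
  qed
  have "\<exists>!\<sigma>. ?P \<sigma>" by (rule ex1I[where P="?P"], rule ex, erule uniq, rule ex)
  from key[OF theI'[OF this]] show "real_distribution (mu_law k c p q r)"
    "(\<lambda>K. \<Prod>m<K. rho_char k c p q r (z / c ^ m)) \<longlonglongrightarrow> char (mu_law k c p q r) z"
    by (auto simp: mu_law_def)
qed

section \<open>The choice of the parameters\<close>

text \<open>What one factor of the product must satisfy: nonnegative masses \<open>w n\<close> at
  the points n + 1 and -(n + 1), a positive first mass, and a bound on the masses, common to all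
  factors, that makes their first moments uniformly bounded; \<open>R\<close> is the
  exponent.\<close>

definition lev_weight :: "(nat \<Rightarrow> real) \<Rightarrow> (real \<Rightarrow> real) \<Rightarrow> bool" where
  "lev_weight w R \<longleftrightarrow> (\<forall>n. 0 \<le> w n) \<and> 0 < w 0 \<and> (\<forall>n. w n * real (Suc n) \<le> 4 * (1 / 2) ^ Suc n) \<and>
     (\<forall>y. (\<lambda>n. w n * (2 * cos (real (Suc n) * y) - 2)) sums R y)"

text \<open>\<open>wB\<close> and \<open>wA\<close> are the masses for q = 1/2 and for -a = -1/16.
  Since \<open>wA\<close> is subtracted, only its positive entries, those with n + 1 even, have to
  be absorbed.\<close>

definition wB :: "nat \<Rightarrow> real" where "wB n = (1 / 2) ^ Suc n / real (Suc n)"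
definition wA :: "nat \<Rightarrow> real" where "wA n = (- (1 / 16)) ^ Suc n / real (Suc n)"

lemma abs_wA: "\<bar>wA n\<bar> \<le> (1 / 16) ^ Suc n / real (Suc n)"
  by (simp add: wA_def power_abs del: power_Suc of_nat_Suc)

lemma pow16_le: "(1 / 16 :: real) ^ Suc n \<le> 1 / 4 * (1 / 2) ^ Suc n"
proof -
  have "(1 / 16 :: real) ^ Suc n = (1 / 8) ^ Suc n * (1 / 2) ^ Suc n" by (simp only: power_mult_distrib[symmetric]) simp
  also have "(1 / 8 :: real) ^ Suc n \<le> 1 / 8" using power_le_one[of "1 / 8 :: real" n] by simp
  then have "(1 / 8 :: real) ^ Suc n * (1 / 2) ^ Suc n \<le> 1 / 4 * (1 / 2) ^ Suc n" by (intro mult_right_mono) auto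
  finally show ?thesis .
qed

lemma wA_le_wB: "\<bar>wA n\<bar> \<le> wB n / 4"
proof -
  have "(1 / 16 :: real) ^ Suc n / real (Suc n) \<le> (1 / 4 * (1 / 2) ^ Suc n) / real (Suc n)"
    by (intro divide_right_mono pow16_le) simp
  with abs_wA[of n] show ?thesis by (simp add: wB_def mult.commute del: power_Suc of_nat_Suc)
qed

lemma wB_Suc: "wB n * real (Suc n) = (1 / 2) ^ Suc n" by (simp add: wB_def del: power_Suc of_nat_Suc)

lemma wB_pos: "0 < wB n" by (simp add: wB_def)

lemma lev_weight_B: "lev_weight wB (lgs (1 / 2))"
  unfolding lev_weight_def
proof (intro conjI allI)
  show "0 \<le> wB n" for n using wB_pos[of n] by simp
  show "0 < wB 0" by (rule wB_pos)
  show "wB n * real (Suc n) \<le> 4 * (1 / 2) ^ Suc n" for n unfolding wB_Suc by simp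
  show "(\<lambda>n. wB n * (2 * cos (real (Suc n) * y) - 2)) sums lgs (1 / 2) y" for y
    unfolding wB_def by (rule lgs_sums) simp
qed

lemma wA_sums: "(\<lambda>n. wA n * (2 * cos (real (Suc n) * y) - 2)) sums lgs (- (1 / 16)) y"
  unfolding wA_def by (rule lgs_sums) simp

lemma lev_weight_AB: "lev_weight (\<lambda>n. wB n - wA n) (\<lambda>y. lgs (1 / 2) y - lgs (- (1 / 16)) y)"
  unfolding lev_weight_def
proof (intro conjI allI)
  have b: "0 < wB n - wA n" "wB n - wA n \<le> 4 * wB n" for n using wA_le_wB[of n] wB_pos[of n] by linarith+
  show "0 \<le> wB n - wA n" for n using b(1)[of n] by simp
  show "0 < wB 0 - wA 0" by (rule b)
  show "(wB n - wA n) * real (Suc n) \<le> 4 * (1 / 2) ^ Suc n" for n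
    using mult_right_mono[OF b(2)[of n], of "real (Suc n)"] wB_Suc[of n] by (simp only: mult.assoc)
  show "(\<lambda>n. (wB n - wA n) * (2 * cos (real (Suc n) * y) - 2)) sums (lgs (1 / 2) y - lgs (- (1 / 16)) y)" for y
    using lev_weight_B wA_sums unfolding left_diff_distrib lev_weight_def by (intro sums_diff) auto
qed

text \<open>Scaling the argument by \<open>2\<close> moves the weight at \<open>l\<close> to \<open>2 l\<close>. The smallness of \<open>1 / 16\<close> compared to
  \<open>(1 / 2)\<^sup>2\<close> lets the first weight absorb both negative parts.\<close>

lemma lev_weight_D: "lev_weight (\<lambda>n. wB n - wA n - comb (\<lambda>_. 0) wA n)
   (\<lambda>y. lgs (1 / 2) y - lgs (- (1 / 16)) y - lgs (- (1 / 16)) (2 * y))"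
  unfolding lev_weight_def
proof (intro conjI allI)
  \<comment> \<open>The stretched weight of l + 1 arrives at 2 (l + 1) = n + 1, hence the index n =
    2 l + 1. The bound is sharp at l = 0, where 1/16 is half of wB 1 = 1/8; with the quarter used by
    \<open>wA n\<close> there remains at least a quarter of \<open>wB n\<close>.\<close>
  have cb: "\<bar>comb (\<lambda>_. 0) wA n\<bar> \<le> wB n / 2" for n
  proof (cases "even n")
    case True
    then show ?thesis using wB_pos[of n] by (simp add: comb_def)
  next
    case False
    then obtain l where n: "n = 2 * l + 1" by (rule oddE)
    have "\<bar>wA l\<bar> \<le> (1 / 16) ^ Suc l / real (Suc l)" by (rule abs_wA)
    also have "\<dots> = (1 / 4) ^ Suc l * (1 / 4) ^ Suc l / real (Suc l)" by (simp flip: power_mult_distrib)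
    also have "\<dots> \<le> 1 / 4 * (1 / 4) ^ Suc l / real (Suc l)"
    proof -
      have "(1 / 4 :: real) ^ Suc l \<le> 1 / 4" using power_le_one[of "1 / 4 :: real" l] by simp
      then show ?thesis by (intro divide_right_mono mult_right_mono) auto
    qed
    also have "(1 / 4 :: real) ^ Suc l = (1 / 2) ^ Suc n"
    proof -
      have "(1 / 4 :: real) = (1 / 2) ^ 2" by (simp add: power2_eq_square)
      then have "(1 / 4 :: real) ^ Suc l = (1 / 2) ^ (2 * Suc l)" by (simp only: power_mult)
      then show ?thesis by (simp add: n)
    qed
    also have "1 / 4 * (1 / 2) ^ Suc n / real (Suc l) = wB n / 2"
      unfolding wB_def by (simp add: n field_simps)
    finally show ?thesis using False by (simp add: comb_def n)
  qed
  have b: "0 < wB n - wA n - comb (\<lambda>_. 0) wA n" "wB n - wA n - comb (\<lambda>_. 0) wA n \<le> 4 * wB n" for n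
    using wA_le_wB[of n] wB_pos[of n] cb[of n] by linarith+
  show "0 \<le> wB n - wA n - comb (\<lambda>_. 0) wA n" for n using b(1)[of n] by simp
  show "0 < wB 0 - wA 0 - comb (\<lambda>_. 0) wA 0" by (rule b)
  show "(wB n - wA n - comb (\<lambda>_. 0) wA n) * real (Suc n) \<le> 4 * (1 / 2) ^ Suc n" for n
    using mult_right_mono[OF b(2)[of n], of "real (Suc n)"] wB_Suc[of n] by (simp only: mult.assoc)
  fix y
  have s: "comb (\<lambda>_. 0) (\<lambda>n. wA n * (2 * cos (real (Suc n) * (2 * y)) - 2)) sums (0 + lgs (- (1 / 16)) (2 * y))"
    by (intro comb_sums sums_zero wA_sums)
  have e: "comb (\<lambda>_. 0) (\<lambda>n. wA n * (2 * cos (real (Suc n) * (2 * y)) - 2)) n = comb (\<lambda>_. 0) wA n * (2 * cos (real (Suc n) * y) - 2)" for n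
  proof (cases "even n")
    case False
    then obtain l where n: "n = 2 * l + 1" by (rule oddE)
    have e: "real (Suc l) * (2 * y) = real (Suc n) * y" by (simp add: n algebra_simps)
    have "(n - 1) div 2 = l" by (simp add: n)
    then show ?thesis using False by (simp only: comb_def e if_False)
  qed (simp add: comb_def)
  have "(\<lambda>n. comb (\<lambda>_. 0) wA n * (2 * cos (real (Suc n) * y) - 2)) sums lgs (- (1 / 16)) (2 * y)"
    using s unfolding ext[of "comb (\<lambda>_. 0) _", OF e] by (simp only: add_0)
  moreover have "(\<lambda>n. (wB n - wA n) * (2 * cos (real (Suc n) * y) - 2)) sums (lgs (1 / 2) y - lgs (- (1 / 16)) y)"
    using lev_weight_AB unfolding lev_weight_def by blast
  ultimately show "(\<lambda>n. (wB n - wA n - comb (\<lambda>_. 0) wA n) * (2 * cos (real (Suc n) * y) - 2)) sums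
     (lgs (1 / 2) y - lgs (- (1 / 16)) y - lgs (- (1 / 16)) (2 * y))"
    unfolding left_diff_distrib[of "wB _ - wA _"] by (intro sums_diff)
qed

lemma ID_lev_weights:
  assumes c: "1 < c" and wR: "\<And>m. lev_weight (w m) (R m)"
    and \<sigma>: "real_distribution \<sigma>" and ch: "\<And>z. char \<sigma> z = of_real (H z)"
    and H: "\<And>z. (\<lambda>K. exp (\<Sum>m<K. R m (z / c ^ m))) \<longlonglongrightarrow> H z"
  shows "\<sigma> \<in> ID"
proof -
  have g: "(\<lambda>n. 4 * (1 / 2 :: real) ^ Suc n) sums (4 * (1 / 2) * (1 / (1 - 1 / 2)))"
    using sums_mult[OF geometric_sums[of "1 / 2 :: real"], of "4 * (1 / 2)"] by (simp add: mult.assoc)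
  have w: "0 \<le> w m n" "0 < w m 0" "w m n * real (Suc n) \<le> 4 * (1 / 2) ^ Suc n"
    "(\<lambda>n. w m n * (2 * cos (real (Suc n) * y) - 2)) sums R m y" for m n y
    using wR[of m] by (auto simp: lev_weight_def simp del: of_nat_Suc power_Suc)
  have s: "summable (\<lambda>n. w m n * real (Suc n))" for m
  proof (rule summable_comparison_test'[OF sums_summable[OF g]])
    show "norm (w m n * real (Suc n)) \<le> 4 * (1 / 2) ^ Suc n" for n
      using w(1)[of m n] w(3)[of m n] by (simp only: real_norm_def abs_of_nonneg mult_nonneg_nonneg of_nat_0_le_iff)
  qed
  have B: "(\<Sum>n. w m n * real (Suc n)) \<le> 4 * (1 / 2) * (1 / (1 - 1 / 2))" for m
    unfolding sums_unique[OF g] by (rule suminf_le[OF w(3) s sums_summable[OF g]])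
  show ?thesis by (rule ID_infinite_product[OF c w(1,2) s B w(4) \<sigma> ch H])
qed

text \<open>The difference consists of a fixed number of terms of a null sequence. It allows
  negative parts to be moved between factors whose indices differ by J.\<close>

lemma shifted_sum_tendsto_0:
  fixes f :: "nat \<Rightarrow> real"
  assumes "f \<longlonglongrightarrow> 0"
  shows "(\<lambda>K. (\<Sum>i<K + J. f i) - (\<Sum>i<K. f i)) \<longlonglongrightarrow> 0"
proof (induction J)
  case (Suc J)
  have "(\<lambda>K. ((\<Sum>i<K + J. f i) - (\<Sum>i<K. f i)) + f (K + J)) \<longlonglongrightarrow> 0 + 0"
    by (intro tendsto_add Suc LIMSEQ_ignore_initial_segment assms)
  then show ?case by (simp add: algebra_simps)
qed simp

lemma sqrt2_irrational: "sqrt 2 \<notin> \<rat>"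
proof
  assume "sqrt 2 \<in> \<rat>"
  then obtain m n :: nat where mn: "n \<noteq> 0" "\<bar>sqrt 2\<bar> = real m / real n" "coprime m n"
    by (rule Rats_abs_nat_div_natE)
  then have "real m = sqrt 2 * real n" by (simp add: field_simps)
  then have "(real m)\<^sup>2 = 2 * (real n)\<^sup>2" by (simp add: power_mult_distrib)
  then have e: "m\<^sup>2 = 2 * n\<^sup>2" by (metis of_nat_eq_iff of_nat_mult of_nat_numeral of_nat_power)
  then have "even (m\<^sup>2)" by simp
  then have "even m" by simp
  then obtain l where l: "m = 2 * l" by (rule evenE)
  then have "n\<^sup>2 = 2 * l\<^sup>2" using e by (simp add: power_mult_distrib)
  then have "even (n\<^sup>2)" by simp
  then have "even n" by simp
  with \<open>even m\<close> mn(3) show False by (meson coprime_common_divisor odd_one)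
qed

theorem corollary7p6:
  fixes k :: int
  assumes "k \<noteq> 0"
  shows "\<exists>c p q r :: real. c > 1 \<and> p \<ge> 0 \<and> q \<ge> 0 \<and> r \<ge> 0 \<and> p + q + r = 1 \<and>
           p + r > 0 \<and> q + r > 0 \<and>
           symmetrization (mu_law k c p q r) \<in> ID \<and>
           symmetrization (rho_law k c p q r) \<in> ID0"
proof -
  define J where "J = nat \<bar>k\<bar>"
  have J: "0 < J" using assms by (simp add: J_def)
  define c where "c = 2 powr (1 / real (2 * J))"
  have c: "1 < c" unfolding c_def by (rule gr_one_powr) (use J in auto)
  have c0: "c \<noteq> 0" using c by simp
  have c2J: "c ^ (2 * J) = 2"
  proof -
    have "c ^ (2 * J) = c powr real (2 * J)" using c by (subst powr_realpow) auto
    also have "\<dots> = 2 powr 1" unfolding c_def powr_powr using J by simp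
    finally show ?thesis by simp
  qed
  then have cJ2: "c ^ J * c ^ J = 2" by (simp add: mult_2 power_add)
  have cJ: "c ^ J = sqrt 2"
    using c cJ2 by (intro real_sqrt_unique[symmetric]) (auto simp: power2_eq_square)
  define \<alpha> where "\<alpha> = c powi (- k)"
  have \<alpha>: "\<alpha> = (if 0 < k then 1 / c ^ J else c ^ J)"
    using assms by (auto simp: \<alpha>_def J_def power_int_def inverse_eq_divide power_one_over)
  have \<alpha>0: "0 < \<alpha>" using c by (simp add: \<alpha>)
  have "\<alpha> \<noteq> 0" using \<alpha>0 by simp
  have \<alpha>irr: "\<alpha> \<notin> \<rat>"
  proof
    assume "\<alpha> \<in> \<rat>"
    then have i: "1 / \<alpha> \<in> \<rat>" by simp
    have "1 / \<alpha> = sqrt 2 \<or> \<alpha> = sqrt 2" unfolding \<alpha> cJ by simp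
    with \<open>\<alpha> \<in> \<rat>\<close> i sqrt2_irrational show False by metis
  qed
  \<comment> \<open>Solves r = p / 16 together with p + r = 1 - q = 1/2.\<close>
  define p :: real where "p = 8 / 17"
  define q :: real where "q = 1 / 2"
  define r :: real where "r = 1 / 34"
  have p: "0 < p" "0 < q" "0 < r" "p + q + r = 1" "r < p" by (simp_all add: p_def q_def r_def)
  have ph: "(cmod (rho_char k c p q r z))\<^sup>2 = phi (1 / 2) (1 / 16) \<alpha> z" for z
    unfolding rho_char_def \<alpha>_def[symmetric] q_def by (rule phi_eq) (simp_all add: p_def r_def)
  have rho: "symmetrization (rho_law k c p q r) \<in> ID0"
  proof -
    note R = rho_law[OF c p(1-4), of k]
    have ch: "char (symmetrization (rho_law k c p q r)) z = of_real (phi (1 / 2) (1 / 16) \<alpha> z)" for z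
      unfolding symmetrization(2)[OF R(1)] R(2) ph ..
    have "quasi_infinitely_divisible (symmetrization (rho_law k c p q r))"
      by (rule quasi_ID_phi[OF _ _ _ _ \<alpha>0 \<alpha>irr symmetrization(1)[OF R(1)] ch]) simp_all
    moreover have "symmetrization (rho_law k c p q r) \<notin> ID"
      by (rule not_ID_phi[OF _ _ _ _ \<alpha>0 \<alpha>irr ch]) simp_all
    ultimately show ?thesis by (simp add: ID0_def)
  qed
  let ?LB = "lgs (1 / 2)" and ?LA = "\<lambda>y. lgs (- (1 / 16)) y"
  note Mu = mu_law[OF c p, of k]
  define H where "H z = (cmod (char (mu_law k c p q r) z))\<^sup>2" for z
  have zc: "(\<lambda>m. x / c ^ m) \<longlonglongrightarrow> 0" for x
  proof -
    have "(\<lambda>m. x * (1 / c) ^ m) \<longlonglongrightarrow> 0" using c by (intro tendsto_mult_right_zero LIMSEQ_power_zero) simp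
    then show ?thesis by (simp add: power_one_over)
  qed
  \<comment> \<open>Continuity of \<open>lgs\<close> at 0; it makes the boundary terms of the
    regroupings below vanish.\<close>
  have LA0: "(\<lambda>m. ?LA (x / c ^ m)) \<longlonglongrightarrow> 0" for x
  proof -
    have "(\<lambda>m. ?LA (x / c ^ m)) \<longlonglongrightarrow> 2 * ln (1 - - (1 / 16)) - ln (1 - 2 * - (1 / 16) * cos 0 + (- (1 / 16))\<^sup>2)"
      unfolding lgs_def by (intro tendsto_intros zc) (simp add: power2_eq_square)
    moreover have "2 * ln (1 - - (1 / 16)) - ln (1 - 2 * - (1 / 16) * cos 0 + (- (1 / 16))\<^sup>2) = ?LA 0"
      by (simp only: lgs_def)
    moreover have "?LA 0 = 0" by (rule lgs_0) simp
    ultimately show ?thesis by (simp only:)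
  qed
  have Hlim: "(\<lambda>K. exp ((\<Sum>m<K. ?LB (z / c ^ m)) - (\<Sum>m<K. ?LA (\<alpha> * z / c ^ m)))) \<longlonglongrightarrow> H z" for z
  proof -
    have l: "(\<lambda>K. (cmod (\<Prod>m<K. rho_char k c p q r (z / c ^ m)))\<^sup>2) \<longlonglongrightarrow> H z"
      unfolding H_def by (intro tendsto_intros Mu(2))
    have "(cmod (\<Prod>m<K. rho_char k c p q r (z / c ^ m)))\<^sup>2 = exp ((\<Sum>m<K. ?LB (z / c ^ m)) - (\<Sum>m<K. ?LA (\<alpha> * z / c ^ m)))" for K
    proof -
      have "(cmod (\<Prod>m<K. rho_char k c p q r (z / c ^ m)))\<^sup>2 = (\<Prod>m<K. (cmod (rho_char k c p q r (z / c ^ m)))\<^sup>2)"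
        by (simp only: prod_norm[symmetric] prod_power_distrib)
      also have "\<dots> = exp (\<Sum>m<K. ?LB (z / c ^ m) - ?LA (\<alpha> * z / c ^ m))"
        unfolding ph phi_def by (simp only: exp_sum[OF finite_lessThan] times_divide_eq_right)
      finally show ?thesis by (simp only: sum_subtractf)
    qed
    with l show ?thesis by (simp only:)
  qed
  have mu: "symmetrization (mu_law k c p q r) \<in> ID"
  proof (cases "0 < k")
    case True
    \<comment> \<open>Here \<open>\<alpha> * z / c ^ m\<close> is z / c^(m + J), the argument of
      factor m + J, to which the negative part of factor m is handed. The first J factors keep only
      positive masses.\<close>
    define w where "w m = (if m < J then wB else (\<lambda>n. wB n - wA n))" for m
    define R where "R m = (if m < J then ?LB else (\<lambda>y. ?LB y - ?LA y))" for m
    show ?thesis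
    proof (rule ID_lev_weights[OF c])
      show "lev_weight (w m) (R m)" for m
        using lev_weight_B lev_weight_AB by (simp add: w_def R_def)
      show "real_distribution (symmetrization (mu_law k c p q r))" by (rule symmetrization(1)[OF Mu(1)])
      show "char (symmetrization (mu_law k c p q r)) z = of_real (H z)" for z
        unfolding H_def by (rule symmetrization(2)[OF Mu(1)])
      fix z
      define f where "f m = ?LA (z / c ^ m)" for m
      have f0: "f \<longlonglongrightarrow> 0" unfolding f_def by (rule LA0)
      have shift: "(\<Sum>m<K. ?LA (\<alpha> * z / c ^ m)) = (\<Sum>i<K + J. f i) - (\<Sum>i<J. f i)" for K
      proof -
        have "(\<Sum>m<K. ?LA (\<alpha> * z / c ^ m)) = (\<Sum>m<K. f (m + J))"
          using True by (intro sum.cong refl) (simp add: f_def \<alpha> power_add mult.commute)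
        moreover have "(\<Sum>i<K + J. f i) = (\<Sum>i<J. f i) + (\<Sum>m<K. f (m + J))"
          by (induction K) simp_all
        ultimately show ?thesis by simp
      qed
      have R: "(\<Sum>m<K. R m (z / c ^ m)) = (\<Sum>m<K. ?LB (z / c ^ m)) - ((\<Sum>i<K. f i) - (\<Sum>i<J. f i))" if "J \<le> K" for K
        using that by (induction K rule: dec_induct)
          (simp_all add: R_def f_def)
      \<comment> \<open>Before and after regrouping the partial sums of the exponents differ by
        \<open>f K\<close>, ..., \<open>f (K + J - 1)\<close>, which tend to 0.\<close>
      have "(\<lambda>K. exp ((\<Sum>m<K. ?LB (z / c ^ m)) - (\<Sum>m<K. ?LA (\<alpha> * z / c ^ m))) * exp ((\<Sum>i<K + J. f i) - (\<Sum>i<K. f i))) \<longlonglongrightarrow> H z * exp 0"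
        by (intro tendsto_mult Hlim tendsto_exp shifted_sum_tendsto_0 f0)
      moreover have "eventually (\<lambda>K. exp ((\<Sum>m<K. ?LB (z / c ^ m)) - (\<Sum>m<K. ?LA (\<alpha> * z / c ^ m))) * exp ((\<Sum>i<K + J. f i) - (\<Sum>i<K. f i))
          = exp (\<Sum>m<K. R m (z / c ^ m))) sequentially"
        using eventually_ge_at_top[of J] by eventually_elim (simp only: shift R exp_add[symmetric], simp)
      ultimately have "(\<lambda>K. exp (\<Sum>m<K. R m (z / c ^ m))) \<longlonglongrightarrow> H z * exp 0" by (rule Lim_transform_eventually)
      then show "(\<lambda>K. exp (\<Sum>m<K. R m (z / c ^ m))) \<longlonglongrightarrow> H z" by simp
    qed
  next
    case False
    \<comment> \<open>Here the negative part of factor m has the argument c^J z / c^m. For m at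
      least J this is the argument of factor m - J, which receives it. The first J of them go to
      factor m + J instead: since c^(2J) = 2, their argument is twice that of the receiving
      factor.\<close>
    define w where "w m = (if J \<le> m \<and> m < 2 * J then (\<lambda>n. wB n - wA n - comb (\<lambda>_. 0) wA n) else (\<lambda>n. wB n - wA n))" for m
    define R where "R m = (if J \<le> m \<and> m < 2 * J then (\<lambda>y. ?LB y - ?LA y - ?LA (2 * y)) else (\<lambda>y. ?LB y - ?LA y))" for m
    show ?thesis
    proof (rule ID_lev_weights[OF c])
      show "lev_weight (w m) (R m)" for m
        using lev_weight_D lev_weight_AB by (simp add: w_def R_def)
      show "real_distribution (symmetrization (mu_law k c p q r))" by (rule symmetrization(1)[OF Mu(1)])
      show "char (symmetrization (mu_law k c p q r)) z = of_real (H z)" for z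
        unfolding H_def by (rule symmetrization(2)[OF Mu(1)])
      fix z
      define f where "f m = ?LA (c ^ J * z / c ^ m)" for m
      have f0: "f \<longlonglongrightarrow> 0" unfolding f_def by (rule LA0)
      have e1: "?LA (\<alpha> * z / c ^ m) = f m" for m using False by (simp add: f_def \<alpha>)
      have e2: "?LA (z / c ^ m) = f (m + J)" for m using c0 by (simp add: f_def power_add mult.commute)
      have e3: "?LA (2 * (z / c ^ (m + J))) = f m" for m
      proof -
        have "2 * (z / c ^ (m + J)) = c ^ J * c ^ J * z / (c ^ m * c ^ J)" unfolding cJ2 by (simp add: power_add)
        also have "\<dots> = c ^ J * z / c ^ m" using c0 by simp
        finally show ?thesis by (simp only: f_def)
      qed
      have split: "(\<Sum>i<K + J. f i) = (\<Sum>i<J. f i) + (\<Sum>m<K. f (m + J))" for K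
        by (induction K) simp_all
      define D where "D m = (if J \<le> m \<and> m < 2 * J then f (m - J) else 0)" for m
      have RD: "R m (z / c ^ m) = ?LB (z / c ^ m) - f (m + J) - D m" for m
      proof (cases "J \<le> m \<and> m < 2 * J")
        case True
        then have "m - J + J = m" by simp
        with e3[of "m - J"] True show ?thesis by (simp add: R_def D_def e2)
      next
        case False
        have "R m = (\<lambda>y. ?LB y - ?LA y)" "D m = 0" unfolding R_def D_def if_not_P[OF False] by (rule refl)+
        then show ?thesis by (simp only: e2 diff_zero)
      qed
      have Ds: "(\<Sum>m<K. D m) = (\<Sum>i<J. f i)" if "2 * J \<le> K" for K
      proof -
        have "(\<Sum>m<K. D m) = (\<Sum>m\<in>{J..<2 * J}. D m)"
          using that by (intro sum.mono_neutral_right) (auto simp: D_def)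
        also have "\<dots> = (\<Sum>m\<in>{0 + J..<J + J}. f (m - J))" by (intro sum.cong) (auto simp: D_def)
        also have "\<dots> = (\<Sum>i<J. f i)" by (simp only: sum.shift_bounds_nat_ivl add_diff_cancel_right' lessThan_atLeast0)
        finally show ?thesis .
      qed
      have R: "(\<Sum>m<K. R m (z / c ^ m)) = (\<Sum>m<K. ?LB (z / c ^ m)) - (\<Sum>i<K + J. f i)" if "2 * J \<le> K" for K
        unfolding RD sum_subtractf Ds[OF that] split by simp
      have "(\<lambda>K. exp ((\<Sum>m<K. ?LB (z / c ^ m)) - (\<Sum>m<K. ?LA (\<alpha> * z / c ^ m))) * exp (- ((\<Sum>i<K + J. f i) - (\<Sum>i<K. f i)))) \<longlonglongrightarrow> H z * exp (- 0)"
        by (intro tendsto_mult Hlim tendsto_exp tendsto_minus shifted_sum_tendsto_0 f0)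
      moreover have "eventually (\<lambda>K. exp ((\<Sum>m<K. ?LB (z / c ^ m)) - (\<Sum>m<K. ?LA (\<alpha> * z / c ^ m))) * exp (- ((\<Sum>i<K + J. f i) - (\<Sum>i<K. f i)))
          = exp (\<Sum>m<K. R m (z / c ^ m))) sequentially"
        using eventually_ge_at_top[of "2 * J"] by eventually_elim (simp only: e1 R exp_add[symmetric], simp)
      ultimately have "(\<lambda>K. exp (\<Sum>m<K. R m (z / c ^ m))) \<longlonglongrightarrow> H z * exp (- 0)" by (rule Lim_transform_eventually)
      then show "(\<lambda>K. exp (\<Sum>m<K. R m (z / c ^ m))) \<longlonglongrightarrow> H z" by simp
    qed
  qed
  have "c > 1 \<and> p \<ge> 0 \<and> q \<ge> 0 \<and> r \<ge> 0 \<and> p + q + r = 1 \<and> p + r > 0 \<and> q + r > 0 \<and>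
      symmetrization (mu_law k c p q r) \<in> ID \<and> symmetrization (rho_law k c p q r) \<in> ID0"
    using c p mu rho by (simp add: add_pos_pos)
  then show ?thesis by (intro exI)
qed

end
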